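(* Let $\Gamma$ be an infinite finitely generated amenable group and let $\mu$ be an admissible probability measure on $\Gamma$. Let $N_\mu$ be the spectral distribution and $\Lambda_\mu$ the $L^2$-isoperimetric profile of the Laplace operator $\Delta_\mu$. Let $L:(0,\infty)\to(0,\infty)$ be a decreasing function such that $\lim_{x\to\infty}L(x)=0$, and assume that $L\circ\exp$ is doubling near infinity. Let $L^{-1}$ be the generalized inverse of $L$. (1) If $L(v)\preceq\Lambda_\mu(v)$ near infinity, then $N_\mu(\lambda)\preceq\frac{1}{L^{-1}(\lambda)}$ near zero in the dilatational sense. (2) If $L(v)\succeq\Lambda_\mu(v)$ near infinity, then $N_\mu(\lambda)\succeq\frac{1}{L^{-1}(\lambda)}$ near zero in the dilatational sense.
   Context: "Decreasing" means non-increasing. Admissible measures: a probability measure $\mu$ on a finitely generated group $\Gamma$ is admissible if it is symmetric ($\mu(\{\gamma\})=\mu(\{\gamma^{-1}\})$ for all $\gamma$), has finite second moment ($\int_\Gamma l(\gamma)^2\,d\mu(\gamma)<\infty$, with $l$ the length function of some word metric on $\Gamma$), and its support contains a finite generating set of $\Gamma$. Operators: $R_\mu:l^2(\Gamma)\to l^2(\Gamma)$, $R_\mu(f)(x)=\sum_{\gamma\in\Gamma}f(x\gamma^{-1})\mu(\gamma)$, and $\Delta_\mu=\mathrm{id}-R_\mu$, a positive bounded operator. For a bounded self-adjoint operator $A$ put $E^A_\lambda=\chi_{(-\infty,\lambda]}(A)$. For a bounded operator $A$ on $l^2(\Gamma)$ commuting with the left $\Gamma$-action, $\mathrm{tr}_\Gamma(A)=\langle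 A\delta_e,\delta_e\rangle$. The spectral distribution of $\Delta_\mu$ is $N_\mu:[0,\infty)\to[0,\infty)$, $N_\mu(\lambda)=\mathrm{tr}_\Gamma(E^{\Delta_\mu}_\lambda)$. $L^2$-isoperimetric profile: $\Lambda_\mu:[1,\infty)\to(0,\infty)$, $\Lambda_\mu(v)=\inf_{1\le|\Omega|\le v}\lambda_1(\Omega)$ over finite subsets $\Omega\subset\Gamma$, where $\lambda_1(\Omega)=\inf_{\emptyset\ne\mathrm{supp}(f)\subset\Omega}\langle\Delta_\mu f,f\rangle/\|f\|_2^2$. Generalized inverse: for decreasing $L:(0,\infty)\to(0,\infty)$, $L^{-1}(x)=\inf\{v>0: L(v)\le x\}$, defined for $x>\inf L$. Doubling near infinity: a decreasing positive function $g$ is doubling near infinity if there is $c>0$ with $g(2x)\ge c\,g(x)$ for all sufficiently large $x$. Asymptotic comparison: $f\preceq g$ near infinity means there are $C,D,x_0>0$ with $f(x)\le Cg(Dx)$ for all $x\ge x_0$. For $f,g:[0,\infty)\to[0,\infty)$, $f\preceq g$ near zero in the dilatational sense means there are $D,\epsilon>0$ with $f(\lambda)\le g(D\lambda)$ for all $\lambda\in[0,\epsilon)$. $f\succeq g$ means $g\preceq f$. An expression defined only for $\lambda>0$ (such as $1/L^{-1}(\lambda)$) is given the value $0$ at $\lambda=0$. *)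

theory Defs
  imports "HOL-Algebra.Generated_Groups" "HOL-Probability.Probability"
begin

section \<open>Groups and admissible measures\<close>

definition finite_generating_set :: "('g, 'b) monoid_scheme \<Rightarrow> 'g set \<Rightarrow> bool" where
  "finite_generating_set G S \<longleftrightarrow>
     finite S \<and> S \<subseteq> carrier G \<and> generate G S = carrier G"

definition finitely_generated_group :: "('g, 'b) monoid_scheme \<Rightarrow> bool" where
  "finitely_generated_group G \<longleftrightarrow> group G \<and> (\<exists>S. finite_generating_set G S)"

text \<open>Amenability in the sense of von Neumann: a left-invariant finitely additive probability
  measure defined on all subsets of the group.\<close>

definition amenable_group :: "('g, 'b) monoid_scheme \<Rightarrow> bool" where
  "amenable_group G \<longleftrightarrow> group G \<and>
     (\<exists>m :: 'g set \<Rightarrow> real.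
        m (carrier G) = 1 \<and>
        (\<forall>A. A \<subseteq> carrier G \<longrightarrow> 0 \<le> m A) \<and>
        (\<forall>A B. A \<subseteq> carrier G \<longrightarrow> B \<subseteq> carrier G \<longrightarrow> A \<inter> B = {} \<longrightarrow>
           m (A \<union> B) = m A + m B) \<and>
        (\<forall>x \<in> carrier G. \<forall>A. A \<subseteq> carrier G \<longrightarrow> m (x <#\<^bsub>G\<^esub> A) = m A))"

definition word_length :: "('g, 'b) monoid_scheme \<Rightarrow> 'g set \<Rightarrow> 'g \<Rightarrow> nat" where
  "word_length G S x =
     (LEAST n. \<exists>ws. length ws = n \<and> set ws \<subseteq> S \<union> m_inv G ` S \<and>
                    foldr (\<lambda>a b. a \<otimes>\<^bsub>G\<^esub> b) ws \<one>\<^bsub>G\<^esub> = x)"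

text \<open>A finitely generated group is countable, so its probability measures are exactly the
  probability mass functions supported in the carrier.\<close>

definition admissible_measure :: "('g, 'b) monoid_scheme \<Rightarrow> 'g pmf \<Rightarrow> bool" where
  "admissible_measure G \<mu> \<longleftrightarrow>
     set_pmf \<mu> \<subseteq> carrier G \<and>
     (\<forall>x \<in> carrier G. pmf \<mu> x = pmf \<mu> (inv\<^bsub>G\<^esub> x)) \<and>
     (\<exists>S. finite_generating_set G S \<and>
        integrable (measure_pmf \<mu>) (\<lambda>x. (real (word_length G S x))\<^sup>2)) \<and>
     (\<exists>S. finite_generating_set G S \<and> S \<subseteq> set_pmf \<mu>)"


section \<open>The Hilbert space of square-summable functions\<close>

text \<open>Functions on the group are functions on the ambient type that vanish off the carrier.
  Operators are functions on all of \<open>'g \<Rightarrow> complex\<close>; only their values on the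
  Hilbert space are meaningful.\<close>

definition ell2 :: "('g, 'b) monoid_scheme \<Rightarrow> ('g \<Rightarrow> complex) set" where
  "ell2 G = {f. (\<forall>x. x \<notin> carrier G \<longrightarrow> f x = 0) \<and>
                (\<lambda>x. (cmod (f x))\<^sup>2) summable_on carrier G}"

definition ell2_inner ::
    "('g, 'b) monoid_scheme \<Rightarrow> ('g \<Rightarrow> complex) \<Rightarrow> ('g \<Rightarrow> complex) \<Rightarrow> complex" where
  "ell2_inner G f g = (\<Sum>\<^sub>\<infinity>x\<in>carrier G. f x * cnj (g x))"

definition ell2_norm :: "('g, 'b) monoid_scheme \<Rightarrow> ('g \<Rightarrow> complex) \<Rightarrow> real" where
  "ell2_norm G f = sqrt (\<Sum>\<^sub>\<infinity>x\<in>carrier G. (cmod (f x))\<^sup>2)"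

definition bounded_operator ::
    "('g, 'b) monoid_scheme \<Rightarrow> (('g \<Rightarrow> complex) \<Rightarrow> ('g \<Rightarrow> complex)) \<Rightarrow> bool" where
  "bounded_operator G A \<longleftrightarrow>
     (\<forall>f \<in> ell2 G. A f \<in> ell2 G) \<and>
     (\<forall>f \<in> ell2 G. \<forall>g \<in> ell2 G. A (\<lambda>x. f x + g x) = (\<lambda>x. A f x + A g x)) \<and>
     (\<forall>c. \<forall>f \<in> ell2 G. A (\<lambda>x. c * f x) = (\<lambda>x. c * A f x)) \<and>
     (\<exists>C. \<forall>f \<in> ell2 G. ell2_norm G (A f) \<le> C * ell2_norm G f)"

definition orthogonal_projection ::
    "('g, 'b) monoid_scheme \<Rightarrow> (('g \<Rightarrow> complex) \<Rightarrow> ('g \<Rightarrow> complex)) \<Rightarrow> bool" where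
  "orthogonal_projection G P \<longleftrightarrow>
     bounded_operator G P \<and>
     (\<forall>f \<in> ell2 G. P (P f) = P f) \<and>
     (\<forall>f \<in> ell2 G. \<forall>g \<in> ell2 G. ell2_inner G (P f) g = ell2_inner G f (P g))"


section \<open>Spectral projections\<close>

text \<open>Projection-valued measures on the Borel sets of the real line with bounded support;
  countable additivity is in the strong operator topology.\<close>

definition projection_valued_measure ::
    "('g, 'b) monoid_scheme \<Rightarrow> (real set \<Rightarrow> ('g \<Rightarrow> complex) \<Rightarrow> ('g \<Rightarrow> complex)) \<Rightarrow> bool" where
  "projection_valued_measure G E \<longleftrightarrow>
     (\<forall>B \<in> sets borel. orthogonal_projection G (E B)) \<and>
     (\<exists>a. \<forall>f \<in> ell2 G. E {-a<..<a} f = f) \<and>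
     (\<forall>f \<in> ell2 G. E {} f = (\<lambda>x. 0)) \<and>
     (\<forall>B \<in> sets borel. \<forall>C \<in> sets borel. \<forall>f \<in> ell2 G. E B (E C f) = E (B \<inter> C) f) \<and>
     (\<forall>B :: nat \<Rightarrow> real set. range B \<subseteq> sets borel \<longrightarrow> disjoint_family B \<longrightarrow>
        (\<forall>f \<in> ell2 G.
           (\<lambda>n. ell2_norm G (\<lambda>x. E (\<Union>i. B i) f x - (\<Sum>i<n. E (B i) f x)))
             \<longlonglongrightarrow> 0))"

definition scalar_spectral_measure ::
    "('g, 'b) monoid_scheme \<Rightarrow> (real set \<Rightarrow> ('g \<Rightarrow> complex) \<Rightarrow> ('g \<Rightarrow> complex)) \<Rightarrow>
     ('g \<Rightarrow> complex) \<Rightarrow> real measure" where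
  "scalar_spectral_measure G E f =
     measure_of UNIV (sets borel) (\<lambda>B. ennreal (Re (ell2_inner G (E B f) f)))"

text \<open>\<open>A = \<integral> t dE(t)\<close>, in the weak sense; the diagonal determines \<open>A\<close> by polarization.\<close>

definition spectral_measure_for ::
    "('g, 'b) monoid_scheme \<Rightarrow> (('g \<Rightarrow> complex) \<Rightarrow> ('g \<Rightarrow> complex)) \<Rightarrow>
     (real set \<Rightarrow> ('g \<Rightarrow> complex) \<Rightarrow> ('g \<Rightarrow> complex)) \<Rightarrow> bool" where
  "spectral_measure_for G A E \<longleftrightarrow>
     projection_valued_measure G E \<and>
     (\<forall>f \<in> ell2 G.
        ell2_inner G (A f) f =
          complex_of_real (\<integral>t. t \<partial>scalar_spectral_measure G E f))"

text \<open>\<open>\<chi>\<^bsub>B\<^esub>(A)\<close> for a bounded self-adjoint operator \<open>A\<close>. By the spectral theorem the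
  spectral measure of \<open>A\<close> exists and is unique on Borel sets and on the Hilbert space, so the
  choice made here is immaterial.\<close>

definition spectral_measure ::
    "('g, 'b) monoid_scheme \<Rightarrow> (('g \<Rightarrow> complex) \<Rightarrow> ('g \<Rightarrow> complex)) \<Rightarrow>
     real set \<Rightarrow> ('g \<Rightarrow> complex) \<Rightarrow> ('g \<Rightarrow> complex)" where
  "spectral_measure G A = (SOME E. spectral_measure_for G A E)"

definition spectral_projection ::
    "('g, 'b) monoid_scheme \<Rightarrow> (('g \<Rightarrow> complex) \<Rightarrow> ('g \<Rightarrow> complex)) \<Rightarrow>
     real \<Rightarrow> ('g \<Rightarrow> complex) \<Rightarrow> ('g \<Rightarrow> complex)" where
  "spectral_projection G A l = spectral_measure G A {..l}"

definition group_trace ::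
    "('g, 'b) monoid_scheme \<Rightarrow> (('g \<Rightarrow> complex) \<Rightarrow> ('g \<Rightarrow> complex)) \<Rightarrow> complex" where
  "group_trace G A = ell2_inner G (A (indicator {\<one>\<^bsub>G\<^esub>})) (indicator {\<one>\<^bsub>G\<^esub>})"


section \<open>The Laplace operator\<close>

definition markov_operator ::
    "('g, 'b) monoid_scheme \<Rightarrow> 'g pmf \<Rightarrow> ('g \<Rightarrow> complex) \<Rightarrow> ('g \<Rightarrow> complex)" where
  "markov_operator G \<mu> f = (\<lambda>x. if x \<in> carrier G
     then (\<Sum>\<^sub>\<infinity>y\<in>carrier G. f (x \<otimes>\<^bsub>G\<^esub> inv\<^bsub>G\<^esub> y) * complex_of_real (pmf \<mu> y)) else 0)"

definition laplace_operator ::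
    "('g, 'b) monoid_scheme \<Rightarrow> 'g pmf \<Rightarrow> ('g \<Rightarrow> complex) \<Rightarrow> ('g \<Rightarrow> complex)" where
  "laplace_operator G \<mu> f = (\<lambda>x. f x - markov_operator G \<mu> f x)"

definition spectral_distribution :: "('g, 'b) monoid_scheme \<Rightarrow> 'g pmf \<Rightarrow> real \<Rightarrow> real" where
  "spectral_distribution G \<mu> l =
     Re (group_trace G (spectral_projection G (laplace_operator G \<mu>) l))"

definition lambda1 :: "('g, 'b) monoid_scheme \<Rightarrow> 'g pmf \<Rightarrow> 'g set \<Rightarrow> real" where
  "lambda1 G \<mu> \<Omega> =
     Inf {Re (ell2_inner G (laplace_operator G \<mu> f) f) / (ell2_norm G f)\<^sup>2 | f.
            f \<in> ell2 G \<and> {x. f x \<noteq> 0} \<noteq> {} \<and> {x. f x \<noteq> 0} \<subseteq> \<Omega>}"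

definition isoperimetric_profile :: "('g, 'b) monoid_scheme \<Rightarrow> 'g pmf \<Rightarrow> real \<Rightarrow> real" where
  "isoperimetric_profile G \<mu> v =
     Inf {lambda1 G \<mu> \<Omega> | \<Omega>.
            finite \<Omega> \<and> \<Omega> \<subseteq> carrier G \<and> 1 \<le> card \<Omega> \<and> real (card \<Omega>) \<le> v}"


section \<open>Asymptotic comparison\<close>

definition generalized_inverse :: "(real \<Rightarrow> real) \<Rightarrow> real \<Rightarrow> real" where
  "generalized_inverse L x = Inf {v. 0 < v \<and> L v \<le> x}"

definition recip_generalized_inverse :: "(real \<Rightarrow> real) \<Rightarrow> real \<Rightarrow> real" where
  "recip_generalized_inverse L l = (if l = 0 then 0 else 1 / generalized_inverse L l)"

definition doubling_near_infinity :: "(real \<Rightarrow> real) \<Rightarrow> bool" where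
  "doubling_near_infinity g \<longleftrightarrow> (\<exists>c>0. \<forall>\<^sub>F x in at_top. g (2 * x) \<ge> c * g x)"

text \<open>Functions defined only on some \<open>[a, \<infinity>)\<close> may be compared as well: enlarging
  \<open>x0\<close> keeps both \<open>x\<close> and \<open>D * x\<close> inside the domains.\<close>

definition preceq_near_infinity :: "(real \<Rightarrow> real) \<Rightarrow> (real \<Rightarrow> real) \<Rightarrow> bool" where
  "preceq_near_infinity f g \<longleftrightarrow>
     (\<exists>C>0. \<exists>D>0. \<exists>x0>0. \<forall>x\<ge>x0. f x \<le> C * g (D * x))"

definition dil_preceq_near_zero :: "(real \<Rightarrow> real) \<Rightarrow> (real \<Rightarrow> real) \<Rightarrow> bool" where
  "dil_preceq_near_zero f g \<longleftrightarrow>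
     (\<exists>D>0. \<exists>\<epsilon>>0. \<forall>l. 0 \<le> l \<and> l < \<epsilon> \<longrightarrow> f l \<le> g (D * l))"

end

theory Submission
  imports Defs
begin

text \<open>
  Let \<open>E\<^sub>l\<close> be the spectral projection of \<open>\<Delta>\<close> on \<open>(-\<infinity>, l]\<close>, so that \<open>N(l) = \<parallel>E\<^sub>l \<delta>\<parallel>\<^sup>2\<close>.

  Lower bound on \<open>N\<close>: a function \<open>f\<close> on \<open>\<Omega>\<close> with Rayleigh quotient at most \<open>l\<close> keeps half of its mass
  under \<open>E\<^bsub>2l\<^esub>\<close>, while invariance under left translations gives \<open>\<parallel>E\<^bsub>2l\<^esub> f\<parallel>\<^sup>2 \<le> card \<Omega> N(2l) \<parallel>f\<parallel>\<^sup>2\<close>; hence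
  \<open>\<Lambda>(v) \<le> l\<close> implies \<open>N(2l) \<ge> 1 / (2v)\<close>.

  Upper bound on \<open>N\<close>: if \<open>N(l) \<ge> 1 / v\<close>, the lazy walk \<open>f\<^sub>n = (1 - \<Delta>/2)\<^sup>n \<delta>\<close> satisfies
  \<open>\<parallel>f\<^sub>n\<parallel>\<^sup>2 \<ge> (1 - l/2)\<^bsup>2n\<^esup> / v\<close>. Up to time \<open>2 ln v / l\<close> this is polynomial in \<open>1 / v\<close>, so at some
  such time the energy of \<open>f\<^sub>n\<close> is at most a multiple of \<open>l\<close> times its mass, and truncating the
  probability density \<open>f\<^sub>n\<close> yields \<open>\<Lambda>(C v\<^sup>5) \<le> 6l\<close>. Doubling of \<open>L \<circ> exp\<close> absorbs the powers of \<open>v\<close>.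

  Existence of \<open>E\<^sub>l\<close> is the spectral theorem. For a positive operator \<open>A\<close>, the range of \<open>E\<^sub>l\<close> is the space
  of vectors with \<open>\<parallel>A\<^sup>n x\<parallel> = O(l\<^sup>n)\<close>; this description gives uniqueness and the commutation of \<open>E\<^sub>l\<close>
  with every isometry commuting with \<open>A\<close>.
\<close>

section \<open>Orthogonal projections in real Hilbert spaces\<close>

text \<open>\<open>spectral_distribution\<close> rests on a spectral measure chosen by
  \<open>SOME\<close>, so its value is accessible only once some spectral measure is known to exist
  and any two are known to agree on half-lines \<open>{..l}\<close>. Hence both halves of the
  spectral theorem appear, uniqueness exactly in that form. The family \<open>low_proj l\<close> is
  built without functional calculus; its one delicate property, that the form is at least
  \<open>l\<close> on the orthogonal complement of \<open>low_space l\<close>, takes a single square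
  root. The Borel projections are then recovered from the Stieltjes measures of
  \<open>l \<mapsto> (norm (low_proj l x))^2\<close>.

  The abstract theory has real scalars. Multiplications by complex numbers of modulus 1 are
  isometries commuting with the Laplacian, and invariance under them returns complex linearity.

  On the asymptotic side the two estimates lose powers of \<open>v\<close> but only constant factors
  in \<open>l\<close>. Replacing \<open>v\<close> by its square costs one constant factor in
  \<open>L\<close>, which the dilation of \<open>l\<close> swallows; a logarithm of \<open>v\<close>
  in front of \<open>l\<close> could not be removed in this way.\<close>

definition self_adjoint :: "('a::real_inner \<Rightarrow> 'a) \<Rightarrow> bool" where
  "self_adjoint T \<longleftrightarrow> bounded_linear T \<and> (\<forall>x y. inner (T x) y = inner x (T y))"

definition orth_proj :: "('a::real_inner \<Rightarrow> 'a) \<Rightarrow> bool" where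
  "orth_proj P \<longleftrightarrow> self_adjoint P \<and> (\<forall>x. P (P x) = P x)"

lemma self_adjointD:
  assumes "self_adjoint T"
  shows "bounded_linear T" "inner (T x) y = inner x (T y)"
    "T (x + y) = T x + T y" "T (x - y) = T x - T y" "T (r *\<^sub>R x) = r *\<^sub>R T x"
    "T 0 = 0" "T (- x) = - T x"
  using assms bounded_linear.linear[of T]
  by (auto simp: self_adjoint_def linear_add linear_diff linear_scale linear_0 linear_neg)

text \<open>Testing the difference \<open>U\<close> at \<open>x + U x\<close> leaves the cross term
  \<open>2 * inner (U x) (U x)\<close>, by symmetry of \<open>U\<close>. Without symmetry the claim
  fails over the reals, where a rotation by a right angle has zero quadratic form.\<close>

lemma self_adjoint_eqI:
  fixes S T :: "'a::real_inner \<Rightarrow> 'a"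
  assumes S: "self_adjoint S" and T: "self_adjoint T"
    and eq: "\<And>x. inner (S x) x = inner (T x) x"
  shows "S = T"
proof
  fix x
  define U where "U = (\<lambda>y. S y - T y)"
  have U: "inner (U y) y = 0" for y
    by (simp add: U_def inner_diff_left eq)
  have add: "U (y + z) = U y + U z" and sym: "inner (U y) z = inner (U z) y" for y z
    by (simp_all add: U_def self_adjointD(3)[OF S] self_adjointD(3)[OF T] inner_diff_left
        self_adjointD(2)[OF S, of y] self_adjointD(2)[OF T, of y] inner_commute[of y])
  have "inner (U (x + U x)) (x + U x) = inner (U x) x + 2 * inner (U x) (U x) + inner (U (U x)) (U x)"
    using sym[of "U x" x] by (simp add: add inner_add_left inner_add_right)
  then show "S x = T x"
    using U by (simp add: U_def)
qed

lemma orth_projD: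
  assumes "orth_proj P"
  shows "self_adjoint P" "P (P x) = P x" "inner (P x) x = (norm (P x))\<^sup>2"
    "(norm (x - P x))\<^sup>2 = (norm x)\<^sup>2 - (norm (P x))\<^sup>2" "norm (P x) \<le> norm x"
proof -
  show 1: "self_adjoint P" and 2: "\<And>x. P (P x) = P x"
    using assms by (auto simp: orth_proj_def)
  show 3: "inner (P x) x = (norm (P x))\<^sup>2"
    by (metis 2 power2_norm_eq_inner self_adjointD(2)[OF 1])
  show 4: "(norm (x - P x))\<^sup>2 = (norm x)\<^sup>2 - (norm (P x))\<^sup>2"
    using 3 unfolding power2_norm_eq_inner by (simp add: inner_simps inner_commute)
  show "norm (P x) \<le> norm x"
    by (smt (verit) 4 norm_ge_zero power2_le_imp_le zero_le_power2)
qed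

lemma orth_proj_fixed_iff:
  assumes "orth_proj P"
  shows "P x = x \<longleftrightarrow> (norm x)\<^sup>2 \<le> inner (P x) x"
  using orth_projD(3,4)[OF assms, of x]
  by (metis diff_le_0_iff_le diff_self norm_eq_zero order_refl power2_less_eq_zero_iff right_minus_eq)

lemma orth_proj_complement:
  fixes P :: "'a::real_inner \<Rightarrow> 'a"
  assumes "orth_proj P"
  shows "orth_proj (\<lambda>x. x - P x)"
  using assms self_adjointD[OF orth_projD(1)[OF assms]]
  by (auto simp: orth_proj_def self_adjoint_def inner_simps intro!: bounded_linear_sub bounded_linear_ident)

text \<open>By the parallelogram law a minimizing sequence for the distance to \<open>M\<close> is
  Cauchy; varying its limit inside \<open>M\<close> gives orthogonality.\<close>

lemma ex_orthogonal_projection: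
  fixes M :: "'a::{real_inner, banach} set"
  assumes M: "subspace M" "closed M"
  shows "\<exists>p\<in>M. \<forall>m\<in>M. inner (x - p) m = 0"
proof -
  define d where "d = (INF m\<in>M. (norm (x - m))\<^sup>2)"
  have M0: "0 \<in> M" using M subspace_0 by blast
  have bdd: "bdd_below ((\<lambda>m. (norm (x - m))\<^sup>2) ` M)"
    by (rule bdd_belowI[of _ 0]) auto
  have d_le: "d \<le> (norm (x - m))\<^sup>2" if "m \<in> M" for m
    unfolding d_def using bdd that by (rule cINF_lower)
  have "\<exists>m\<in>M. (norm (x - m))\<^sup>2 < d + inverse (real (Suc n))" for n
    using cINF_less_iff[OF _ bdd, of "d + inverse (real (Suc n))"] M0 unfolding d_def
    by (metis empty_iff less_add_same_cancel1 inverse_Suc)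
  then obtain p where p: "\<And>n. p n \<in> M" "\<And>n. (norm (x - p n))\<^sup>2 < d + inverse (real (Suc n))"
    by metis
  have par: "(norm (p n - p k))\<^sup>2 \<le> 2 * inverse (real (Suc n)) + 2 * inverse (real (Suc k))" for n k
  proof -
    have "(1/2) *\<^sub>R (p n + p k) \<in> M"
      using M p(1) by (simp add: subspace_add subspace_scale)
    then have "d \<le> (norm (x - (1/2) *\<^sub>R (p n + p k)))\<^sup>2" by (rule d_le)
    also have "4 * \<dots> = 2 * (norm (x - p n))\<^sup>2 + 2 * (norm (x - p k))\<^sup>2 - (norm (p n - p k))\<^sup>2"
      unfolding power2_norm_eq_inner by (simp add: inner_simps inner_commute algebra_simps)
    finally show ?thesis using p(2)[of n] p(2)[of k] by linarith
  qed
  have "Cauchy p"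
  proof (rule metric_CauchyI)
    fix e :: real assume e: "0 < e"
    obtain N where N: "inverse (real (Suc N)) < e\<^sup>2 / 4"
      using reals_Archimedean[of "e\<^sup>2 / 4"] e by auto
    have "dist (p n) (p k) < e" if "N \<le> n" "N \<le> k" for n k
    proof -
      have "inverse (real (Suc n)) \<le> inverse (real (Suc N))" "inverse (real (Suc k)) \<le> inverse (real (Suc N))"
        using that by (auto simp: field_simps)
      then have "(norm (p n - p k))\<^sup>2 < e\<^sup>2" using par[of n k] N by linarith
      then show ?thesis using e by (simp add: dist_norm power_less_imp_less_base)
    qed
    then show "\<exists>M. \<forall>m\<ge>M. \<forall>n\<ge>M. dist (p m) (p n) < e" by blast
  qed
  then obtain q where q: "p \<longlonglongrightarrow> q" using Cauchy_convergent convergent_def by blast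
  have qM: "q \<in> M" using M(2) q p(1) closed_sequentially by blast
  have "(\<lambda>n. (norm (x - p n))\<^sup>2) \<longlonglongrightarrow> (norm (x - q))\<^sup>2"
    by (intro tendsto_intros q)
  moreover have "(\<lambda>n. d + inverse (real (Suc n))) \<longlonglongrightarrow> d + 0"
    by (intro tendsto_intros LIMSEQ_inverse_real_of_nat)
  ultimately have "(norm (x - q))\<^sup>2 \<le> d + 0"
    by (rule LIMSEQ_le) (use p(2) in \<open>auto intro!: exI[of _ 0] less_imp_le\<close>)
  then have qd: "(norm (x - q))\<^sup>2 \<le> d" by simp
  have "inner (x - q) m = 0" if m: "m \<in> M" for m
  proof -
    \<comment> \<open>Nearly the minimizing step length; the \<open>+ 1\<close> in the denominator
      also covers \<open>m = 0\<close>.\<close>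
    define t where "t = inner (x - q) m / (inner m m + 1)"
    have pos: "inner m m + 1 > 0" by (simp add: add_nonneg_pos)
    have "q + t *\<^sub>R m \<in> M" using M qM m by (simp add: subspace_add subspace_scale)
    have "(norm (x - q))\<^sup>2 \<le> (norm (x - q - t *\<^sub>R m))\<^sup>2"
      using order_trans[OF qd d_le[OF \<open>q + t *\<^sub>R m \<in> M\<close>]] by (simp only: diff_diff_add)
    also have "\<dots> = (norm (x - q))\<^sup>2 - 2 * t * inner (x - q) m + t\<^sup>2 * inner m m"
      unfolding power2_norm_eq_inner by (simp add: inner_simps inner_commute algebra_simps power2_eq_square)
    also have "inner (x - q) m = t * (inner m m + 1)" using pos by (simp add: t_def)
    finally have "t\<^sup>2 * (inner m m + 2) \<le> 0" by (simp add: algebra_simps power2_eq_square)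
    then have "t = 0" using pos by (simp add: mult_le_0_iff)
    then show ?thesis using pos by (simp add: t_def)
  qed
  then show ?thesis using qM by blast
qed

definition proj_onto :: "'a::{real_inner, banach} set \<Rightarrow> 'a \<Rightarrow> 'a" where
  "proj_onto M x = (SOME p. p \<in> M \<and> (\<forall>m\<in>M. inner (x - p) m = 0))"

context
  fixes M :: "'a::{real_inner, banach} set"
  assumes M: "subspace M" "closed M"
begin

lemma proj_onto_mem: "proj_onto M x \<in> M"
  and proj_onto_orth: "m \<in> M \<Longrightarrow> inner (x - proj_onto M x) m = 0"
proof -
  have "\<exists>p. p \<in> M \<and> (\<forall>m\<in>M. inner (x - p) m = 0)"
    using ex_orthogonal_projection[OF M] by blast
  from someI_ex[OF this] show "proj_onto M x \<in> M" "m \<in> M \<Longrightarrow> inner (x - proj_onto M x) m = 0"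
    unfolding proj_onto_def by blast+
qed

lemma proj_onto_eqI:
  assumes "p \<in> M" "\<And>m. m \<in> M \<Longrightarrow> inner (x - p) m = 0"
  shows "proj_onto M x = p"
proof -
  have m: "proj_onto M x - p \<in> M"
    using M assms(1) proj_onto_mem by (simp add: subspace_diff)
  have "inner (proj_onto M x - p) (proj_onto M x - p)
      = inner (x - p) (proj_onto M x - p) - inner (x - proj_onto M x) (proj_onto M x - p)"
    by (simp add: inner_simps)
  also have "\<dots> = 0" using assms(2)[OF m] proj_onto_orth[OF m] by simp
  finally show ?thesis by simp
qed

lemma proj_onto_id: "x \<in> M \<Longrightarrow> proj_onto M x = x"
  by (rule proj_onto_eqI) auto

lemma proj_onto_orth_proj: "orth_proj (proj_onto M)"
proof -
  note mem = proj_onto_mem and orth = proj_onto_orth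
  have add: "proj_onto M (x + y) = proj_onto M x + proj_onto M y" for x y
  proof (rule proj_onto_eqI)
    show "inner (x + y - (proj_onto M x + proj_onto M y)) m = 0" if "m \<in> M" for m
      using orth[OF that, of x] orth[OF that, of y] by (simp add: inner_simps)
  qed (use M mem in \<open>simp add: subspace_add\<close>)
  have scale: "proj_onto M (r *\<^sub>R x) = r *\<^sub>R proj_onto M x" for r x
  proof (rule proj_onto_eqI)
    show "inner (r *\<^sub>R x - r *\<^sub>R proj_onto M x) m = 0" if "m \<in> M" for m
      using orth[OF that, of x] by (simp add: inner_simps)
  qed (use M mem in \<open>simp add: subspace_scale\<close>)
  have le: "norm (proj_onto M x) \<le> norm x" for x
  proof -
    have "(norm x)\<^sup>2 = (norm (proj_onto M x))\<^sup>2 + (norm (x - proj_onto M x))\<^sup>2"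
      using orth[OF mem, of x x] unfolding power2_norm_eq_inner
      by (simp add: inner_simps inner_commute)
    then have "(norm (proj_onto M x))\<^sup>2 \<le> (norm x)\<^sup>2" by simp
    then show ?thesis by (rule power2_le_imp_le) simp
  qed
  have "bounded_linear (proj_onto M)"
    by (rule bounded_linear_intro[where K=1]) (simp_all add: add scale le)
  moreover have "inner (proj_onto M x) y = inner x (proj_onto M y)" for x y
    using orth[OF mem, of x y] orth[OF mem, of y x] by (simp add: inner_simps inner_commute)
  ultimately show ?thesis
    by (simp add: orth_proj_def self_adjoint_def proj_onto_id mem)
qed

text \<open>If \<open>T\<close> preserves both \<open>M\<close> and its orthogonal complement, then
  \<open>T p + T (x - p)\<close> is the orthogonal decomposition of \<open>T x\<close>.\<close>

lemma proj_onto_commute: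
  assumes T: "bounded_linear T"
    and inv: "\<And>m. m \<in> M \<Longrightarrow> T m \<in> M"
    and orth: "\<And>x. (\<And>m. m \<in> M \<Longrightarrow> inner x m = 0) \<Longrightarrow> (\<And>m. m \<in> M \<Longrightarrow> inner (T x) m = 0)"
  shows "proj_onto M (T x) = T (proj_onto M x)"
proof (rule proj_onto_eqI)
  show "T (proj_onto M x) \<in> M" using inv proj_onto_mem by blast
  show "inner (T x - T (proj_onto M x)) m = 0" if "m \<in> M" for m
  proof -
    have "inner (T (x - proj_onto M x)) m = 0"
      by (rule orth[OF _ that]) (rule proj_onto_orth)
    then show ?thesis using bounded_linear.linear[OF T] by (simp add: linear_diff)
  qed
qed

lemma orth_proj_eq_proj_onto:
  assumes P: "orth_proj P" and mem: "\<And>x. P x \<in> M" and fixed: "\<And>x. x \<in> M \<Longrightarrow> P x = x"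
  shows "P = proj_onto M"
proof
  fix x
  have "inner (x - P x) m = 0" if "m \<in> M" for m
    using fixed[OF that] self_adjointD(2)[OF orth_projD(1)[OF P], of x m] by (simp add: inner_diff_left)
  then show "P x = proj_onto M x" using proj_onto_eqI[OF mem] by metis
qed

end

text \<open>The bound forces the ranges to be pairwise orthogonal; Pythagoras then turns the bounded
  scalar series into a norm-convergent series of vectors. This serves countable disjoint unions of
  Borel sets.\<close>

lemma orth_proj_sum:
  fixes P :: "nat \<Rightarrow> 'a::{real_inner, banach} \<Rightarrow> 'a"
  assumes P: "\<And>i. orth_proj (P i)"
    and bound: "\<And>n x. (\<Sum>i<n. inner (P i x) x) \<le> (norm x)\<^sup>2"
  shows "\<exists>Q. orth_proj Q \<and> (\<forall>x. (\<lambda>n. \<Sum>i<n. P i x) \<longlonglongrightarrow> Q x)"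
proof -
  note sa = orth_projD(1)[OF P]
  have nonneg: "0 \<le> inner (P i x) x" for i x by (simp add: orth_projD(3)[OF P])
  \<comment> \<open>Test the bound at \<open>P j x\<close>: the \<open>j\<close>-th term already
    equals its squared norm, so nothing is left for the index \<open>i\<close>.\<close>
  have orth: "P i (P j x) = 0" if "i \<noteq> j" for i j x
  proof -
    define n where "n = Suc (max i j)"
    have "inner (P i (P j x)) (P j x) + inner (P j (P j x)) (P j x) = (\<Sum>k\<in>{i,j}. inner (P k (P j x)) (P j x))"
      using that by simp
    also have "\<dots> \<le> (\<Sum>k<n. inner (P k (P j x)) (P j x))"
      by (rule sum_mono2) (auto simp: n_def nonneg)
    also have "\<dots> \<le> (norm (P j x))\<^sup>2" by (rule bound)
    finally have "(norm (P i (P j x)))\<^sup>2 + (norm (P j x))\<^sup>2 \<le> (norm (P j x))\<^sup>2"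
      by (simp only: orth_projD(2,3)[OF P] power2_norm_eq_inner[symmetric])
    then show ?thesis by simp
  qed
  have inner_PP: "inner (P i x) (P j y) = (if i = j then inner (P i x) y else 0)" for i j x y
    using self_adjointD(2)[OF sa, of i x "P j y"] orth[of i j y]
    by (auto simp: orth_projD(2)[OF P] self_adjointD(2)[OF sa])
  have norm_sum: "(norm (\<Sum>i\<in>I. P i x))\<^sup>2 = (\<Sum>i\<in>I. inner (P i x) x)" if "finite I" for I x
    unfolding power2_norm_eq_inner inner_sum_left inner_sum_right
    using that by (simp add: inner_PP)
  have summ: "summable (\<lambda>i. inner (P i x) x)" for x
  proof (rule bounded_imp_summable[OF nonneg])
    show "(\<Sum>i\<le>n. inner (P i x) x) \<le> (norm x)\<^sup>2" for n
      using bound[of x "Suc n"] by (simp only: lessThan_Suc_atMost)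
  qed
  define Q where "Q x = (\<Sum>i. P i x)" for x
  have "summable (\<lambda>i. P i x)" for x
    unfolding summable_Cauchy
  proof (intro allI impI)
    fix e :: real assume e: "0 < e"
    then obtain N where N: "\<And>m n. m \<ge> N \<Longrightarrow> norm (\<Sum>i=m..<n. inner (P i x) x) < e\<^sup>2"
      using summ[of x] unfolding summable_Cauchy by (metis zero_less_power)
    have "norm (\<Sum>i=m..<n. P i x) < e" if "m \<ge> N" for m n
    proof -
      have "(norm (\<Sum>i=m..<n. P i x))\<^sup>2 < e\<^sup>2"
        using N[OF that, of n] by (simp add: norm_sum) 
      then show ?thesis using e by (simp add: power_less_imp_less_base)
    qed
    then show "\<exists>N. \<forall>m\<ge>N. \<forall>n. norm (\<Sum>i=m..<n. P i x) < e" by blast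
  qed
  then have Q: "(\<lambda>i. P i x) sums Q x" for x
    by (simp add: Q_def summable_sums)
  then have lim: "(\<lambda>n. \<Sum>i<n. P i x) \<longlonglongrightarrow> Q x" for x by (simp add: sums_def)
  have "Q (x + y) = Q x + Q y" for x y
    using sums_unique2[OF Q[of "x + y"]] sums_add[OF Q[of x] Q[of y]] by (simp add: self_adjointD[OF sa])
  moreover have "Q (r *\<^sub>R x) = r *\<^sub>R Q x" for r x
    using sums_unique2[OF Q[of "r *\<^sub>R x"]] sums_scaleR_right[OF Q[of x], of r] by (simp add: self_adjointD[OF sa])
  moreover have "norm (Q x) \<le> norm x" for x
  proof (rule LIMSEQ_le_const2[OF tendsto_norm[OF lim]])
    have "norm (\<Sum>i<n. P i x) \<le> norm x" for n
      by (rule power2_le_imp_le) (simp_all add: norm_sum bound)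
    then show "\<exists>N. \<forall>n\<ge>N. norm (\<Sum>i<n. P i x) \<le> norm x" by blast
  qed
  ultimately have bl: "bounded_linear Q" by (intro bounded_linear_intro[where K=1]) simp_all
  have "inner (Q x) y = inner x (Q y)" for x y
  proof (rule LIMSEQ_unique)
    show "(\<lambda>n. inner (\<Sum>i<n. P i x) y) \<longlonglongrightarrow> inner (Q x) y" by (intro tendsto_intros lim)
    have "(\<lambda>n. inner x (\<Sum>i<n. P i y)) \<longlonglongrightarrow> inner x (Q y)" by (intro tendsto_intros lim)
    then show "(\<lambda>n. inner (\<Sum>i<n. P i x) y) \<longlonglongrightarrow> inner x (Q y)"
      by (simp add: inner_sum_left inner_sum_right self_adjointD(2)[OF sa])
  qed
  moreover have "Q (Q x) = Q x" for x
  proof -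
    have "P i (Q x) = P i x" for i
    proof -
      have "(\<lambda>j. P i (P j x)) sums P i (Q x)"
        by (rule bounded_linear.sums[OF self_adjointD(1)[OF sa] Q])
      moreover have "(\<lambda>j. P i (P j x)) = (\<lambda>j. if j = i then P i x else 0)"
        using orth by (auto simp: orth_projD(2)[OF P])
      ultimately show ?thesis using sums_single[of i "\<lambda>_. P i x"] sums_unique2 by metis
    qed
    then show ?thesis using Q[of "Q x"] Q[of x] sums_unique2 by simp
  qed
  ultimately show ?thesis using bl lim by (auto simp: orth_proj_def self_adjoint_def)
qed

section \<open>Square roots of positive operators\<close>

lemma bounded_linear_funpow:
  fixes T :: "'a::real_normed_vector \<Rightarrow> 'a"
  shows "bounded_linear T \<Longrightarrow> bounded_linear (T ^^ n)"
proof (induction n)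
  case (Suc n)
  then show ?case using bounded_linear_compose[of T "T ^^ n"] by (simp add: o_def)
qed (simp add: id_def bounded_linear_ident)

lemma funpow_self_adjoint:
  "self_adjoint T \<Longrightarrow> inner ((T ^^ n) x) y = inner x ((T ^^ n) y)"
  by (induction n arbitrary: x y) (simp_all add: self_adjointD(2) funpow_swap1)

lemma funpow_commute:
  assumes "\<And>x. T (X x) = X (T x)"
  shows "T ((X ^^ n) x) = (X ^^ n) (T x)"
  by (induction n) (simp_all add: assms)

declare sum.cong [fundef_cong]

text \<open>The Taylor coefficients of \<open>1 - sqrt (1 - t)\<close>, generated by \<open>y = (t + y\<^sup>2) / 2\<close>.\<close>

fun sqrt_coeff :: "nat \<Rightarrow> real" where
  "sqrt_coeff n = (if n = 0 then 0 else if n = 1 then 1/2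
     else (\<Sum>i\<in>{1..<n}. sqrt_coeff i * sqrt_coeff (n - i)) / 2)"

declare sqrt_coeff.simps [simp del]

lemma sqrt_coeff_0: "sqrt_coeff 0 = 0"
  by (simp add: sqrt_coeff.simps)

lemma sqrt_coeff_nonneg: "0 \<le> sqrt_coeff n"
proof (induction n rule: less_induct)
  case (less n)
  show ?case
    by (subst sqrt_coeff.simps) (auto intro!: sum_nonneg mult_nonneg_nonneg less)
qed

text \<open>The coefficient form of \<open>2 y = t + y^2\<close>; the Cauchy product may run over
  all \<open>i \<le> n\<close> because the constant coefficient is zero.\<close>

lemma sqrt_coeff_rec:
  "2 * sqrt_coeff n = (if n = 1 then 1 else 0) + (\<Sum>i\<le>n. sqrt_coeff i * sqrt_coeff (n - i))"
proof (cases "n \<le> 1")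
  case True
  then have "n = 0 \<or> n = 1" by auto
  then show ?thesis
    by (auto simp: sqrt_coeff_0 sqrt_coeff.simps[of 1] sqrt_coeff.simps[of "Suc 0"])
next
  case False
  have "(\<Sum>i\<le>n. sqrt_coeff i * sqrt_coeff (n - i)) = (\<Sum>i\<in>{1..<n}. sqrt_coeff i * sqrt_coeff (n - i))"
    by (rule sum.mono_neutral_right) (auto simp: sqrt_coeff_0 not_less Suc_le_eq le_less)
  then show ?thesis using False sqrt_coeff.simps[of n] by simp
qed

text \<open>For the partial sums \<open>s n\<close> the recursion gives
  \<open>2 * s (n + 1) \<le> 1 + (s n)^2\<close>: in a nonzero product of degree at most
  \<open>n + 1\<close> both indices are positive, hence at most \<open>n\<close>. So the bound 1
  reproduces itself.\<close>

lemma sum_sqrt_coeff_le: "(\<Sum>k\<le>n. sqrt_coeff k) \<le> 1"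
proof (induction n)
  case 0
  then show ?case by (simp add: sqrt_coeff_0)
next
  case (Suc n)
  let ?c = sqrt_coeff
  let ?T = "{(i, j). i + j \<le> Suc n}"
  have fin: "finite ?T"
    by (rule finite_subset[of _ "{..Suc n} \<times> {..Suc n}"]) auto
  have "2 * (\<Sum>k\<le>Suc n. ?c k) = (\<Sum>k\<le>Suc n. (if k = 1 then 1 else 0) + (\<Sum>i\<le>k. ?c i * ?c (k - i)))"
    by (simp only: sum_distrib_left sqrt_coeff_rec)
  also have "\<dots> = (\<Sum>k\<le>Suc n. (if k = 1 then 1 else 0)) + (\<Sum>(i, j)\<in>?T. ?c i * ?c j)"
    by (simp only: sum.distrib sum.triangle_reindex_eq)
  also have "(\<Sum>k\<le>Suc n. (if k = 1 then 1 else 0 :: real)) = 1"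
    by (subst sum.delta) auto
  also have "(\<Sum>(i, j)\<in>?T. ?c i * ?c j) = (\<Sum>(i, j)\<in>?T \<inter> {..n} \<times> {..n}. ?c i * ?c j)"
  proof (rule sum.mono_neutral_right)
    show "\<forall>p\<in>?T - ?T \<inter> {..n} \<times> {..n}. (case p of (i, j) \<Rightarrow> ?c i * ?c j) = 0"
    proof
      fix p assume "p \<in> ?T - ?T \<inter> {..n} \<times> {..n}"
      then have "fst p = 0 \<or> snd p = 0" by (cases p) auto
      then show "(case p of (i, j) \<Rightarrow> ?c i * ?c j) = 0" by (cases p) (auto simp: sqrt_coeff_0)
    qed
  qed (use fin in auto)
  also have "\<dots> \<le> (\<Sum>(i, j)\<in>{..n} \<times> {..n}. ?c i * ?c j)"
    by (rule sum_mono2) (auto intro!: mult_nonneg_nonneg sqrt_coeff_nonneg)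
  also have "\<dots> = (\<Sum>k\<le>n. ?c k) * (\<Sum>k\<le>n. ?c k)"
    by (simp add: sum_product sum.cartesian_product)
  also have "\<dots> \<le> 1 * 1"
    using Suc by (intro mult_mono) (auto intro!: sum_nonneg sqrt_coeff_nonneg)
  finally show ?case by simp
qed

lemma summable_sqrt_coeff: "summable sqrt_coeff"
  by (rule bounded_imp_summable[of _ 1]) (auto simp: sqrt_coeff_nonneg sum_sqrt_coeff_le)

lemma suminf_sqrt_coeff_le: "suminf sqrt_coeff \<le> 1"
  by (rule suminf_le_const[OF summable_sqrt_coeff])
    (metis sum_mono2 sqrt_coeff_nonneg sum_sqrt_coeff_le finite_atMost lessThan_subset_iff lessThan_Suc_atMost order_trans le_SucI order_refl)

lemma abs_summable_sqrt_coeff_product: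
  "(\<lambda>p. norm (sqrt_coeff (fst p) * sqrt_coeff (snd p))) summable_on UNIV \<times> UNIV"
proof -
  have "sqrt_coeff summable_on UNIV"
    by (simp add: summable_on_UNIV_nonneg_real_iff sqrt_coeff_nonneg summable_sqrt_coeff)
  then have "(\<lambda>i. norm (sqrt_coeff i)) summable_on UNIV"
    using summable_on_iff_abs_summable_on_real[of sqrt_coeff UNIV] by blast
  then have 1: "(\<lambda>j. norm (sqrt_coeff i * sqrt_coeff j)) summable_on UNIV" for i
    unfolding norm_mult by (rule summable_on_cmult_right)
  have 2: "(\<lambda>i. norm (\<Sum>\<^sub>\<infinity>j. norm (sqrt_coeff i * sqrt_coeff j))) summable_on UNIV"
    unfolding norm_mult infsum_cmult_right' using \<open>(\<lambda>i. norm (sqrt_coeff i)) summable_on UNIV\<close>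
    by (simp only: norm_mult real_norm_def abs_abs) (rule summable_on_cmult_left)
  show ?thesis
    unfolding Infinite_Sum.abs_summable_on_Sigma_iff using 1 2 by simp
qed

text \<open>The series \<open>Y = \<Sum> c_k X^k\<close> represents \<open>1 - sqrt (1 - X)\<close>,
  so \<open>Q = 1 - Y\<close> squares to \<open>1 - X\<close>; it converges for every contraction
  since the coefficients are nonnegative with sum at most 1. Commutation with everything that
  commutes with \<open>X\<close> is recorded because the absolute value built from \<open>Q\<close>
  must commute with the original operator.\<close>

lemma ex_sqrt_operator:
  fixes X :: "'a::{real_inner, banach} \<Rightarrow> 'a"
  assumes X: "self_adjoint X" and contr: "\<And>x. norm (X x) \<le> norm x"
  shows "\<exists>Q. self_adjoint Q \<and> (\<forall>x. 0 \<le> inner (Q x) x) \<and> (\<forall>x. Q (Q x) = x - X x) \<and>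
    (\<forall>T. bounded_linear T \<longrightarrow> (\<forall>x. T (X x) = X (T x)) \<longrightarrow> (\<forall>x. T (Q x) = Q (T x)))"
proof -
  let ?c = sqrt_coeff
  note blX = bounded_linear_funpow[OF self_adjointD(1)[OF X]]
  have le: "norm ((X ^^ k) x) \<le> norm x" for k x
    by (induction k) (auto intro: order_trans[OF contr])
  have smn: "summable (\<lambda>k. ?c k * norm x)" for x :: 'a
    by (rule summable_mult2[OF summable_sqrt_coeff])
  have nle: "norm (?c k *\<^sub>R (X ^^ k) x) \<le> ?c k * norm x" for k x
    using le[of k x] by (simp add: sqrt_coeff_nonneg mult_left_mono)
  have smm: "summable (\<lambda>k. norm (?c k *\<^sub>R (X ^^ k) x))" for x
    by (rule summable_comparison_test'[OF smn, of 0 _ x]) (use nle in simp)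
  define Y where "Y x = (\<Sum>k. ?c k *\<^sub>R (X ^^ k) x)" for x
  have Y: "(\<lambda>k. ?c k *\<^sub>R (X ^^ k) x) sums Y x" for x
    unfolding Y_def using summable_norm_cancel[OF smm] by (rule summable_sums)
  have comm: "T (Y x) = Y (T x)" if T: "bounded_linear T" "\<And>x. T (X x) = X (T x)" for T x
  proof -
    have "(\<lambda>k. T (?c k *\<^sub>R (X ^^ k) x)) sums T (Y x)"
      by (rule bounded_linear.sums[OF T(1) Y])
    moreover have "T (?c k *\<^sub>R (X ^^ k) x) = ?c k *\<^sub>R (X ^^ k) (T x)" for k
      by (simp add: linear_scale bounded_linear.linear[OF T(1)] funpow_commute[of T X, OF T(2)])
    ultimately show ?thesis using Y[of "T x"] sums_unique2 by simp
  qed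
  have normY: "norm (Y x) \<le> norm x" for x
  proof -
    have "norm (Y x) \<le> (\<Sum>k. ?c k * norm x)"
      unfolding Y_def by (rule order_trans[OF summable_norm[OF smm] suminf_le[OF nle smm smn]])
    also have "\<dots> = suminf ?c * norm x" by (rule suminf_mult2[OF summable_sqrt_coeff, symmetric])
    also have "\<dots> \<le> 1 * norm x" by (intro mult_right_mono suminf_sqrt_coeff_le) simp
    finally show ?thesis by simp
  qed
  have addY: "Y (x + y) = Y x + Y y" for x y
    using sums_unique2[OF Y[of "x + y"]] sums_add[OF Y[of x] Y[of y]]
    by (simp add: linear_add[OF bounded_linear.linear[OF blX]] scaleR_add_right)
  have scaleY: "Y (r *\<^sub>R x) = r *\<^sub>R Y x" for r x
    using sums_unique2[OF Y[of "r *\<^sub>R x"]] sums_scaleR_right[OF Y[of x], of r]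
    by (simp add: linear_scale[OF bounded_linear.linear[OF blX]] scaleR_scaleR mult.commute)
  have blY: "bounded_linear Y"
    by (rule bounded_linear_intro[where K=1]) (simp_all add: addY scaleY normY)
  have saY: "inner (Y x) y = inner x (Y y)" for x y
  proof (rule sums_unique2)
    show "(\<lambda>k. inner (?c k *\<^sub>R (X ^^ k) x) y) sums inner (Y x) y"
      by (rule bounded_linear.sums[OF bounded_linear_inner_left Y])
    show "(\<lambda>k. inner (?c k *\<^sub>R (X ^^ k) x) y) sums inner x (Y y)"
      using bounded_linear.sums[OF bounded_linear_inner_right Y, of x y]
      by (simp add: funpow_self_adjoint[OF X])
  qed
  have YY: "2 *\<^sub>R Y x = X x + Y (Y x)" for x
  proof -
    \<comment> \<open>Row sums of this absolutely summable double family give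
      \<open>Y (Y x)\<close>; its antidiagonal sums are evaluated by \<open>sqrt_coeff_rec\<close>,
      which yields \<open>2 Y - X\<close>.\<close>
    define f where "f = (\<lambda>(i, j). (?c i * ?c j) *\<^sub>R (X ^^ (i + j)) x)"
    have absf: "(\<lambda>p. norm (f p)) summable_on UNIV \<times> UNIV"
    proof (rule Infinite_Sum.abs_summable_on_comparison_test)
      show "(\<lambda>p. norm (norm x * (?c (fst p) * ?c (snd p)))) summable_on UNIV \<times> UNIV"
        using abs_summable_sqrt_coeff_product
        by (simp only: norm_mult) (intro summable_on_cmult_right)
      show "norm (f p) \<le> norm (norm x * (?c (fst p) * ?c (snd p)))" for p
        using le[of "fst p + snd p" x]
        by (simp add: f_def split_beta sqrt_coeff_nonneg mult.commute[of "norm x"] mult_left_mono)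
    qed
    then have sf: "f summable_on UNIV \<times> UNIV" by (rule abs_summable_summable)
    have infsum_nat: "infsum g UNIV = s" if "(\<lambda>n. norm (g n)) sums t" "g sums s" for g :: "nat \<Rightarrow> 'a" and s t
      using norm_summable_imp_has_sum[of g s] that by (auto simp: sums_iff infsumI)
    have "Y (Y x) = infsum (\<lambda>i. ?c i *\<^sub>R (X ^^ i) (Y x)) UNIV"
      by (rule infsum_nat[OF summable_sums[OF smm] Y, symmetric])
    also have "\<dots> = infsum (\<lambda>i. infsum (\<lambda>j. f (i, j)) UNIV) UNIV"
    proof (rule infsum_cong)
      fix i
      have "(\<lambda>j. ?c i *\<^sub>R (X ^^ i) (?c j *\<^sub>R (X ^^ j) x)) sums (?c i *\<^sub>R (X ^^ i) (Y x))"
        by (intro sums_scaleR_right bounded_linear.sums[OF blX Y])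
      then have 1: "(\<lambda>j. f (i, j)) sums (?c i *\<^sub>R (X ^^ i) (Y x))"
        by (simp add: f_def linear_scale[OF bounded_linear.linear[OF blX]] funpow_add)
      have 2: "summable (\<lambda>j. norm (f (i, j)))"
      proof (rule summable_comparison_test'[of "\<lambda>j. ?c i * (?c j * norm x)" 0])
        show "summable (\<lambda>j. ?c i * (?c j * norm x))" by (intro summable_mult smn)
        show "norm (norm (f (i, j))) \<le> ?c i * (?c j * norm x)" for j
          using le[of "i + j" x] by (simp add: f_def sqrt_coeff_nonneg mult_left_mono mult.assoc)
      qed
      show "?c i *\<^sub>R (X ^^ i) (Y x) = infsum (\<lambda>j. f (i, j)) UNIV"
        by (rule infsum_nat[OF summable_sums[OF 2] 1, symmetric])
    qed
    also have "\<dots> = infsum f (UNIV \<times> UNIV)"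
      using infsum_Sigma'_banach[of "\<lambda>i j. f (i, j)" UNIV "\<lambda>_. UNIV"] sf by (simp add: case_prod_unfold)
    also have "\<dots> = infsum (\<lambda>(k, i). f (i, k - i)) (SIGMA k:UNIV. {..k})"
      by (rule infsum_reindex_bij_witness[of _ "\<lambda>(k, i). (i, k - i)" "\<lambda>(i, j). (i + j, i)"]) auto
    also have "\<dots> = infsum (\<lambda>k. \<Sum>i\<le>k. f (i, k - i)) UNIV"
    proof -
      have "(\<lambda>(k, i). f (i, k - i)) summable_on (SIGMA k:UNIV. {..k})"
        using sf
        by (subst summable_on_reindex_bij_witness[of _ "\<lambda>(i, j). (i + j, i)" "\<lambda>(k, i). (i, k - i)" _ f]) auto
      from infsum_Sigma'_banach[OF this] show ?thesis by simp
    qed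
    also have "\<dots> = infsum (\<lambda>k. 2 *\<^sub>R (?c k *\<^sub>R (X ^^ k) x) - (if k = 1 then X x else 0)) UNIV"
    proof (rule infsum_cong)
      fix k
      have "(\<Sum>i\<le>k. f (i, k - i)) = (\<Sum>i\<le>k. ?c i * ?c (k - i)) *\<^sub>R (X ^^ k) x"
        by (simp add: f_def scaleR_left.sum)
      also have "\<dots> = (2 * ?c k - (if k = 1 then 1 else 0)) *\<^sub>R (X ^^ k) x"
        by (simp add: sqrt_coeff_rec)
      finally show "(\<Sum>i\<le>k. f (i, k - i)) = 2 *\<^sub>R (?c k *\<^sub>R (X ^^ k) x) - (if k = 1 then X x else 0)"
        by (auto simp: algebra_simps)
    qed
    also have "\<dots> = 2 *\<^sub>R Y x - X x"
    proof (rule infsum_nat[OF summable_sums])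
      show "(\<lambda>k. 2 *\<^sub>R (?c k *\<^sub>R (X ^^ k) x) - (if k = 1 then X x else 0)) sums (2 *\<^sub>R Y x - X x)"
        using sums_single[of 1 "\<lambda>_. X x"] by (intro sums_diff sums_scaleR_right Y) simp
      show "summable (\<lambda>k. norm (2 *\<^sub>R (?c k *\<^sub>R (X ^^ k) x) - (if k = 1 then X x else 0)))"
      proof (rule summable_comparison_test'[of "\<lambda>k. 2 * norm (?c k *\<^sub>R (X ^^ k) x) + (if k = 1 then norm (X x) else 0)" 0])
        show "summable (\<lambda>k. 2 * norm (?c k *\<^sub>R (X ^^ k) x) + (if k = 1 then norm (X x) else 0))"
          by (intro summable_add summable_mult smm sums_summable[OF sums_single])
      next
        fix k
        show "norm (norm (2 *\<^sub>R (?c k *\<^sub>R (X ^^ k) x) - (if k = 1 then X x else 0)))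
            \<le> 2 * norm (?c k *\<^sub>R (X ^^ k) x) + (if k = 1 then norm (X x) else 0)"
          using norm_triangle_ineq4[of "2 *\<^sub>R (?c k *\<^sub>R (X ^^ k) x)" "if k = 1 then X x else 0"]
          by (cases "k = 1") (simp_all add: abs_mult mult.assoc)
      qed
    qed
    finally show ?thesis by simp
  qed
  define Q where "Q = (\<lambda>x. x - Y x)"
  have "self_adjoint Q"
    unfolding self_adjoint_def Q_def
    by (auto simp: inner_simps saY intro!: bounded_linear_sub bounded_linear_ident blY)
  moreover have "0 \<le> inner (Q x) x" for x
  proof -
    have "inner (Y x) x \<le> norm (Y x) * norm x" by (rule norm_cauchy_schwarz)
    also have "\<dots> \<le> norm x * norm x" by (intro mult_right_mono normY) simp
    finally show ?thesis by (simp add: Q_def inner_simps dot_square_norm power2_eq_square)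
  qed
  moreover have "Q (Q x) = x - X x" for x
  proof -
    have "Q (Q x) = x - 2 *\<^sub>R Y x + Y (Y x)"
      by (simp add: Q_def linear_diff[OF bounded_linear.linear[OF blY]] scaleR_2)
    then show ?thesis by (simp add: YY)
  qed
  moreover have "T (Q x) = Q (T x)" if "bounded_linear T" "\<And>x. T (X x) = X (T x)" for T x
    using comm[OF that] by (simp add: Q_def linear_diff[OF bounded_linear.linear[OF that(1)]])
  ultimately show ?thesis by blast
qed

section \<open>The spectral resolution of a positive operator\<close>

text \<open>The form at \<open>x + t y\<close> is a quadratic polynomial in \<open>t\<close> without
  negative values, so its discriminant is at most zero.\<close>

lemma positive_Cauchy_Schwarz:
  assumes A: "self_adjoint A" and pos: "\<And>x. 0 \<le> inner (A x) x"
  shows "(inner (A x) y)\<^sup>2 \<le> inner (A x) x * inner (A y) y"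
proof -
  define a b c where "a = inner (A x) x" and "b = inner (A x) y" and "c = inner (A y) y"
  have q: "0 \<le> a + 2 * t * b + t\<^sup>2 * c" for t
  proof -
    have "inner (A (x + t *\<^sub>R y)) (x + t *\<^sub>R y) = a + 2 * t * b + t\<^sup>2 * c"
      using self_adjointD(2)[OF A, of y x]
      by (simp add: a_def b_def c_def self_adjointD(3,5)[OF A] inner_simps inner_commute[of y "A x"]
          power2_eq_square algebra_simps)
    then show ?thesis using pos by metis
  qed
  show ?thesis unfolding a_def[symmetric] b_def[symmetric] c_def[symmetric]
  proof (cases "c = 0")
    case True
    \<comment> \<open>For \<open>c = 0\<close> the polynomial is affine in \<open>t\<close>, and
      with \<open>b \<noteq> 0\<close> it would take the value \<open>-1\<close>.\<close>
    have "b = 0"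
    proof (rule ccontr)
      assume "b \<noteq> 0"
      then have "a + 2 * (- (a + 1) / (2 * b)) * b = - 1" by (simp add: field_simps)
      then show False using q[of "- (a + 1) / (2 * b)"] True by simp
    qed
    then show "b\<^sup>2 \<le> a * c" using True by simp
  next
    case False
    then have c: "0 < c" using pos[of y] by (simp add: c_def)
    have "0 \<le> a - b\<^sup>2 / c"
      using q[of "- b / c"] c by (simp add: power2_eq_square field_simps)
    then show "b\<^sup>2 \<le> a * c" using c by (simp add: field_simps)
  qed
qed

locale positive_operator =
  fixes A :: "'a::{real_inner, banach} \<Rightarrow> 'a"
  assumes self_adj: "self_adjoint A" and pos: "\<And>x. 0 \<le> inner (A x) x"
begin

lemmas A_simps = self_adjointD(3-7)[OF self_adj]

lemma linear_pow: "linear (A ^^ n)"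
  using bounded_linear.linear[OF bounded_linear_funpow[OF self_adjointD(1)[OF self_adj]]] .

text \<open>The range of the spectral projection on \<open>(-\<infinity>, l]\<close> consists of the vectors whose orbit under
  \<open>A\<close> grows at rate at most \<open>l\<close>; for \<open>l < 0\<close> the condition at \<open>n = 0\<close> leaves only the zero vector.\<close>

definition low_space :: "real \<Rightarrow> 'a set" where
  "low_space l = {x. \<forall>n. norm ((A ^^ Suc n) x) \<le> l * norm ((A ^^ n) x)}"

definition low_proj :: "real \<Rightarrow> 'a \<Rightarrow> 'a" where
  "low_proj l = proj_onto (low_space l)"

lemma low_spaceD: "x \<in> low_space l \<Longrightarrow> norm (A x) \<le> l * norm x"
  unfolding low_space_def by (drule CollectD, drule spec[of _ 0]) simp

lemma low_space_invariant: "x \<in> low_space l \<Longrightarrow> A x \<in> low_space l"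
proof -
  assume "x \<in> low_space l"
  then have "norm ((A ^^ Suc (Suc n)) x) \<le> l * norm ((A ^^ Suc n) x)" for n
    unfolding low_space_def by blast
  then show ?thesis by (simp add: low_space_def funpow_swap1)
qed

lemma low_space_neg: "l < 0 \<Longrightarrow> low_space l = {0}"
proof
  show "low_space l \<subseteq> {0}" if "l < 0"
  proof
    fix x assume "x \<in> low_space l"
    then have "0 \<le> l * norm x" using low_spaceD[of x l] norm_ge_zero[of "A x"] by linarith
    then show "x \<in> {0}" using that by (auto simp: zero_le_mult_iff)
  qed
  have "(A ^^ n) 0 = 0" for n by (rule linear_0[OF linear_pow])
  then show "{0} \<subseteq> low_space l" unfolding low_space_def by (simp del: funpow.simps)
qed

text \<open>Log-convexity of \<open>n \<mapsto> norm ((A ^^ n) x)\<close>: successive ratios do not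
  decrease.\<close>

lemma norm_sq_le_norm_AA: "(norm (A x))\<^sup>2 \<le> norm x * norm (A (A x))"
  using norm_cauchy_schwarz[of x "A (A x)"]
  by (simp add: power2_norm_eq_inner self_adjointD(2)[OF self_adj])

text \<open>Passage from a form bound to a norm bound: Cauchy-Schwarz for the form of
  \<open>A\<close>, applied to \<open>z\<close> and \<open>A z\<close>. The bound is therefore
  required at both vectors, which is why it is used on \<open>A\<close>-invariant spaces.\<close>

lemma norm_le_of_quadratic_le:
  assumes l: "0 \<le> l" and z: "inner (A z) z \<le> l * (norm z)\<^sup>2" "inner (A (A z)) (A z) \<le> l * (norm (A z))\<^sup>2"
  shows "norm (A z) \<le> l * norm z"
proof (cases "A z = 0")
  case True
  then show ?thesis using l by simp
next
  case False
  have "((norm (A z))\<^sup>2)\<^sup>2 \<le> inner (A z) z * inner (A (A z)) (A z)"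
    using positive_Cauchy_Schwarz[OF self_adj pos, of z "A z"] by (simp add: power2_norm_eq_inner)
  also have "\<dots> \<le> (l * (norm z)\<^sup>2) * (l * (norm (A z))\<^sup>2)"
    using l by (intro mult_mono z pos) auto
  finally have "(norm (A z))\<^sup>2 * (norm (A z))\<^sup>2 \<le> (l * norm z)\<^sup>2 * (norm (A z))\<^sup>2"
    by (simp add: power2_eq_square mult_ac)
  then have "(norm (A z))\<^sup>2 \<le> (l * norm z)\<^sup>2" using False by (subst (asm) mult_le_cancel_right) simp
  then show ?thesis by (rule power2_le_imp_le) (use l in simp)
qed

text \<open>By log-convexity an initial ratio \<open>r > l\<close> persists along the orbit, so
  \<open>norm ((A ^^ n) x) \<ge> r ^ n * norm x\<close>, which eventually exceeds
  \<open>C * l ^ n\<close>.\<close>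

lemma geometric_growth_imp_step:
  assumes l: "0 \<le> l" and bound: "\<And>n. norm ((A ^^ n) x) \<le> C * l ^ n"
  shows "norm (A x) \<le> l * norm x"
proof (rule ccontr)
  assume neg: "\<not> norm (A x) \<le> l * norm x"
  have x: "0 < norm x"
  proof (rule ccontr)
    assume "\<not> 0 < norm x"
    then have "x = 0" by simp
    then show False using neg by (simp add: A_simps)
  qed
  define r where "r = norm (A x) / norm x"
  have r: "l < r" using neg x by (simp add: r_def field_simps)
  then have r0: "0 < r" using l by simp
  have step: "0 < norm ((A ^^ n) x) \<and> r * norm ((A ^^ n) x) \<le> norm ((A ^^ Suc n) x)" for n
  proof (induction n)
    case 0
    then show ?case using x by (simp add: r_def)
  next
    case (Suc n)
    let ?a = "norm ((A ^^ n) x)" and ?b = "norm ((A ^^ Suc n) x)" and ?c = "norm ((A ^^ Suc (Suc n)) x)"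
    have b: "0 < ?b" using Suc r0 by (meson less_le_trans mult_pos_pos)
    have "r * ?a * ?b \<le> ?b\<^sup>2" using Suc b by (simp add: power2_eq_square mult_right_mono)
    also have "?b\<^sup>2 \<le> ?a * ?c" using norm_sq_le_norm_AA[of "(A ^^ n) x"] by simp
    finally have "?a * (r * ?b) \<le> ?a * ?c" by (simp add: mult_ac)
    then show ?case using Suc b by simp
  qed
  have pow: "r ^ n * norm x \<le> norm ((A ^^ n) x)" for n
  proof (induction n)
    case (Suc n)
    have "r ^ Suc n * norm x \<le> r * norm ((A ^^ n) x)" using Suc r0 by simp
    also have "\<dots> \<le> norm ((A ^^ Suc n) x)" using step by blast
    finally show ?case .
  qed simp
  have le: "r ^ n * norm x \<le> C * l ^ n" for n using pow bound order_trans by blast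
  have "0 < l"
  proof (rule ccontr)
    assume "\<not> 0 < l"
    then have "l = 0" using l by simp
    then show False using le[of 1] r0 x by (simp add: mult_le_0_iff)
  qed
  then have "(r / l) ^ n \<le> C / norm x" for n
    using le[of n] x by (simp add: power_divide field_simps)
  moreover have "1 < r / l" using r \<open>0 < l\<close> by simp
  then obtain n where "C / norm x < (r / l) ^ n" using real_arch_pow by blast
  ultimately show False by (meson not_le)
qed

text \<open>The two descriptions complement each other: the growth bound with a free constant is
  visibly stable under sums, while the stepwise bound is visibly closed and monotone in
  \<open>l\<close>.\<close>

lemma low_space_iff:
  assumes l: "0 \<le> l"
  shows "x \<in> low_space l \<longleftrightarrow> (\<exists>C. \<forall>n. norm ((A ^^ n) x) \<le> C * l ^ n)"
proof
  assume x: "x \<in> low_space l"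
  have "norm ((A ^^ n) x) \<le> norm x * l ^ n" for n
  proof (induction n)
    case (Suc n)
    have "norm ((A ^^ Suc n) x) \<le> l * norm ((A ^^ n) x)" using x by (simp add: low_space_def)
    also have "\<dots> \<le> l * (norm x * l ^ n)" using Suc l by (intro mult_left_mono)
    finally show ?case by (simp add: mult_ac)
  qed simp
  then show "\<exists>C. \<forall>n. norm ((A ^^ n) x) \<le> C * l ^ n" by blast
next
  assume "\<exists>C. \<forall>n. norm ((A ^^ n) x) \<le> C * l ^ n"
  then obtain C where C: "\<And>n. norm ((A ^^ n) x) \<le> C * l ^ n" by blast
  have "norm (A ((A ^^ k) x)) \<le> l * norm ((A ^^ k) x)" for k
  proof (rule geometric_growth_imp_step[OF l, of _ "C * l ^ k"])
    show "norm ((A ^^ n) ((A ^^ k) x)) \<le> C * l ^ k * l ^ n" for n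
      using C[of "n + k"] by (simp add: funpow_add power_add mult_ac)
  qed
  then show "x \<in> low_space l" by (simp add: low_space_def)
qed

lemma low_space_subspace: "subspace (low_space l)"
proof (cases "l < 0")
  case True
  then show ?thesis by (simp add: low_space_neg subspace_single_0)
next
  case False
  then have l: "0 \<le> l" by simp
  show ?thesis
  proof (rule subspaceI)
    have "(A ^^ n) 0 = 0" for n by (rule linear_0[OF linear_pow])
    then show "0 \<in> low_space l" by (auto simp: low_space_iff[OF l] intro!: exI[of _ 0])
  next
    fix x y assume "x \<in> low_space l" "y \<in> low_space l"
    then obtain C D where "\<And>n. norm ((A ^^ n) x) \<le> C * l ^ n" "\<And>n. norm ((A ^^ n) y) \<le> D * l ^ n"
      unfolding low_space_iff[OF l] by blast
    then have "norm ((A ^^ n) (x + y)) \<le> (C + D) * l ^ n" for n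
      by (simp only: linear_add[OF linear_pow] distrib_right norm_triangle_le[OF add_mono])
    then show "x + y \<in> low_space l" unfolding low_space_iff[OF l] by blast
  next
    fix c x assume "x \<in> low_space l"
    then show "c *\<^sub>R x \<in> low_space l"
      by (auto simp: low_space_def linear_scale[OF linear_pow] A_simps mult_left_mono mult.left_commute[of l])
  qed
qed

lemma low_space_closed: "closed (low_space l)"
proof -
  have "low_space l = (\<Inter>n. {x. norm ((A ^^ Suc n) x) \<le> l * norm ((A ^^ n) x)})"
    by (auto simp: low_space_def)
  moreover have "closed {x. norm ((A ^^ Suc n) x) \<le> l * norm ((A ^^ n) x)}" for n
    by (intro closed_Collect_le continuous_intros linear_continuous_on
        bounded_linear_funpow[OF self_adjointD(1)[OF self_adj]])
  ultimately show ?thesis by (simp add: closed_INT)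
qed

lemma low_space_mono: "l \<le> m \<Longrightarrow> low_space l \<subseteq> low_space m"
  unfolding low_space_def by (auto intro!: order_trans[OF _ mult_right_mono[of l m]])

lemma low_space_eq_Inter: "(\<And>m. l < m \<Longrightarrow> x \<in> low_space m) \<Longrightarrow> x \<in> low_space l"
  unfolding low_space_def
proof (intro CollectI allI)
  fix n assume *: "\<And>m. l < m \<Longrightarrow> x \<in> {x. \<forall>n. norm ((A ^^ Suc n) x) \<le> m * norm ((A ^^ n) x)}"
  have "((\<lambda>m. m * norm ((A ^^ n) x)) \<longlongrightarrow> l * norm ((A ^^ n) x)) (at_right l)"
    by (intro tendsto_intros)
  then show "norm ((A ^^ Suc n) x) \<le> l * norm ((A ^^ n) x)"
    by (rule tendsto_lowerbound) (use * in \<open>auto simp: eventually_at_right_less eventually_mono[OF eventually_at_right_less[of l]]\<close>)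
qed

lemmas low_proj_mem = proj_onto_mem[OF low_space_subspace low_space_closed, folded low_proj_def]
lemmas low_proj_orth = proj_onto_orth[OF low_space_subspace low_space_closed, folded low_proj_def]
lemmas low_proj_id = proj_onto_id[OF low_space_subspace low_space_closed, folded low_proj_def]
lemmas low_proj_eqI = proj_onto_eqI[OF low_space_subspace low_space_closed, folded low_proj_def]
lemmas low_proj_orth_proj = proj_onto_orth_proj[OF low_space_subspace low_space_closed, folded low_proj_def]
lemmas low_proj_commute = proj_onto_commute[OF low_space_subspace low_space_closed, folded low_proj_def]

lemma low_proj_A: "low_proj l (A x) = A (low_proj l x)"
  by (rule low_proj_commute[OF self_adjointD(1)[OF self_adj]])
    (auto simp: low_space_invariant self_adjointD(2)[OF self_adj])

text \<open>\<open>U\<close> preserves the norms along every orbit of \<open>A\<close>, hence maps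
  the low space onto itself, and its complement as well since \<open>U\<close> is onto. The
  instances used are left translations and unit complex scalars.\<close>

lemma low_proj_isometry:
  assumes U: "bounded_linear U" "\<And>x y. inner (U x) (U y) = inner x y" "surj U" "\<And>x. U (A x) = A (U x)"
  shows "low_proj l (U x) = U (low_proj l x)"
proof (rule low_proj_commute[OF U(1)])
  have n: "norm (U x) = norm x" for x by (simp add: norm_eq_sqrt_inner U(2))
  have p: "norm ((A ^^ n) (U x)) = norm ((A ^^ n) x)" for n x
    using funpow_commute[of U A, OF U(4)] n by metis
  have iff: "U x \<in> low_space l \<longleftrightarrow> x \<in> low_space l" for x
    unfolding low_space_def by (simp only: p mem_Collect_eq)
  show "U m \<in> low_space l" if "m \<in> low_space l" for m using that iff by blast
  show "inner (U x) m = 0" if x: "\<And>m. m \<in> low_space l \<Longrightarrow> inner x m = 0" and m: "m \<in> low_space l" for x m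
  proof -
    obtain k where "m = U k" using U(3) by (metis surjE)
    then show ?thesis using x[of k] m iff U(2) by simp
  qed
qed

text \<open>With \<open>W = |A - l|\<close>, the kernel of \<open>W + (A - l)\<close> lies in the low space, and on its orthogonal
  complement \<open>A - l = W \<ge> 0\<close>.\<close>

lemma low_space_orth_ge:
  assumes x: "\<And>m. m \<in> low_space l \<Longrightarrow> inner x m = 0"
  shows "l * (norm x)\<^sup>2 \<le> inner (A x) x"
proof (cases "l < 0")
  case True
  then have "l * (norm x)\<^sup>2 \<le> 0" by (simp add: mult_le_0_iff)
  then show ?thesis using pos[of x] by linarith
next
  case False
  define S where "S = (\<lambda>x. A x - l *\<^sub>R x)"
  have blS: "bounded_linear S" unfolding S_def
    by (intro bounded_linear_sub self_adjointD(1)[OF self_adj] bounded_linear_scaleR_right)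
  have S: "self_adjoint S"
    unfolding self_adjoint_def using blS
    by (auto simp: S_def inner_simps self_adjointD(2)[OF self_adj])
  obtain K where K: "\<And>x. norm (S x) \<le> norm x * K" "0 < K"
    using bounded_linear.pos_bounded[OF blS] by blast
  \<comment> \<open>As \<open>K\<close> bounds the norm of \<open>S\<close>, the operator
    \<open>1 - S^2 / K^2\<close> is a contraction, and the square root of \<open>1 - X\<close> is
    \<open>|S| / K\<close>.\<close>
  define X where "X = (\<lambda>x. x - (1 / K\<^sup>2) *\<^sub>R S (S x))"
  have blX: "bounded_linear X" unfolding X_def
    by (intro bounded_linear_sub bounded_linear_ident bounded_linear_const_scaleR bounded_linear_compose[OF blS] blS)
  have X: "self_adjoint X"
    unfolding self_adjoint_def using blX
    by (auto simp: X_def inner_simps self_adjointD(2)[OF S])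
  have contr: "norm (X y) \<le> norm y" for y
  proof (rule power2_le_imp_le)
    have i: "inner (S (S y)) y = inner (S y) (S y)" "inner y (S (S y)) = inner (S y) (S y)"
      by (simp_all add: self_adjointD(2)[OF S])
    have 1: "(norm (X y))\<^sup>2 = (norm y)\<^sup>2 - 2 * ((norm (S y))\<^sup>2 / K\<^sup>2) + (norm (S (S y)))\<^sup>2 / K\<^sup>2 / K\<^sup>2"
      unfolding X_def power2_norm_eq_inner by (simp add: inner_diff_left inner_diff_right i diff_divide_distrib)
    have "(norm (S (S y)))\<^sup>2 \<le> (norm (S y))\<^sup>2 * K\<^sup>2"
      using power_mono[OF K(1)[of "S y"], of 2] by (simp add: power_mult_distrib)
    then have 2: "(norm (S (S y)))\<^sup>2 / K\<^sup>2 / K\<^sup>2 \<le> (norm (S y))\<^sup>2 / K\<^sup>2"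
      using K(2) by (intro divide_right_mono) (simp_all add: pos_divide_le_eq)
    have "0 \<le> (norm (S y))\<^sup>2 / K\<^sup>2" by simp
    then show "(norm (X y))\<^sup>2 \<le> (norm y)\<^sup>2" using 1 2 by linarith
  qed simp
  obtain Q where Q: "self_adjoint Q" "\<And>y. 0 \<le> inner (Q y) y" "\<And>y. Q (Q y) = y - X y"
    "\<And>T y. bounded_linear T \<Longrightarrow> (\<And>z. T (X z) = X (T z)) \<Longrightarrow> T (Q y) = Q (T y)"
    using ex_sqrt_operator[OF X contr] by metis
  define W where "W = (\<lambda>y. K *\<^sub>R Q y)"
  have W: "self_adjoint W"
    using Q(1) by (auto simp: self_adjoint_def W_def intro!: bounded_linear_const_scaleR)
  have Wpos: "0 \<le> inner (W y) y" for y using Q(2) K(2) by (simp add: W_def)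
  have WW: "W (W y) = S (S y)" for y
    using K(2) by (simp add: W_def self_adjointD(5)[OF Q(1)] Q(3) X_def power2_eq_square)
  have SA: "S (A y) = A (S y)" for y by (simp add: S_def A_simps)
  have AQ: "A (Q y) = Q (A y)" for y
    by (rule Q(4)[OF self_adjointD(1)[OF self_adj]]) (simp add: X_def A_simps SA)
  have AW: "A (W y) = W (A y)" for y by (simp add: W_def A_simps AQ)
  have SW: "S (W y) = W (S y)" for y
    by (simp add: S_def AW self_adjointD(4,5)[OF W])
  define N where "N = {y. W y + S y = 0}"
  \<comment> \<open>On \<open>N\<close> the form of \<open>W + A - l\<close> vanishes and
    \<open>W \<ge> 0\<close>, so the form of \<open>A\<close> is at most \<open>l\<close>.
    \<open>N\<close> is \<open>A\<close>-invariant, so this improves to a norm bound along the whole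
    orbit.\<close>
  have N_low: "y \<in> low_space l" if "y \<in> N" for y
  proof -
    have NA: "A y \<in> N" if "y \<in> N" for y
    proof -
      have "W (A y) + S (A y) = A (W y + S y)" by (simp add: AW SA A_simps)
      also have "\<dots> = 0" using that by (simp only: N_def mem_Collect_eq A_simps)
      finally show ?thesis by (simp add: N_def)
    qed
    have Npow: "(A ^^ n) y \<in> N" for n by (induction n) (auto simp: NA that)
    have le: "inner (A z) z \<le> l * (norm z)\<^sup>2" if "z \<in> N" for z
    proof -
      have "inner (W z + S z) z = 0" using that by (simp add: N_def)
      then show ?thesis using Wpos[of z]
        by (simp add: inner_simps S_def power2_norm_eq_inner)
    qed
    have "norm (A z) \<le> l * norm z" if "z \<in> N" for z
      using False that by (intro norm_le_of_quadratic_le le NA) auto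
    then show ?thesis using Npow by (simp add: low_space_def)
  qed
  \<comment> \<open>\<open>(W + S) (W - S) = W^2 - S^2 = 0\<close> since \<open>W\<close> and
    \<open>S\<close> commute, so \<open>W - S\<close> maps into \<open>N\<close>. Moving
    \<open>W - S\<close> across the inner product then gives
    \<open>inner y y = inner x ((W - S) y) = 0\<close>.\<close>
  define y where "y = W x - S x"
  have yN: "y \<in> N"
    by (simp add: N_def y_def WW SW self_adjointD(4)[OF W] self_adjointD(4)[OF S])
  have zN: "W y - S y \<in> N"
    using yN by (simp add: N_def WW SW self_adjointD(4)[OF W] self_adjointD(4)[OF S])
  have "inner y y = inner x (W y - S y)"
    by (simp add: y_def inner_diff_left inner_diff_right self_adjointD(2)[OF W, of x] self_adjointD(2)[OF S, of x]
        self_adjointD(4)[OF W] self_adjointD(4)[OF S])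
  also have "\<dots> = 0" using x N_low zN by blast
  finally have "W x = S x" by (simp add: y_def)
  then show ?thesis using Wpos[of x] by (simp add: S_def inner_simps power2_norm_eq_inner)
qed

end

section \<open>The spectral theorem\<close>

text \<open>Mirrors \<open>projection_valued_measure\<close> clause by clause in a real Hilbert
  space, so that spectral measures can be carried across \<open>vec\<close> and \<open>fn\<close> in
  both directions.\<close>

definition proj_measure :: "(real set \<Rightarrow> 'a::{real_inner, banach} \<Rightarrow> 'a) \<Rightarrow> bool" where
  "proj_measure E \<longleftrightarrow>
     (\<forall>B\<in>sets borel. orth_proj (E B)) \<and>
     (\<exists>a. \<forall>x. E {-a<..<a} x = x) \<and>
     (\<forall>x. E {} x = 0) \<and>
     (\<forall>B\<in>sets borel. \<forall>C\<in>sets borel. \<forall>x. E B (E C x) = E (B \<inter> C) x) \<and>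
     (\<forall>B :: nat \<Rightarrow> real set. range B \<subseteq> sets borel \<longrightarrow> disjoint_family B \<longrightarrow>
        (\<forall>x. (\<lambda>n. \<Sum>i<n. E (B i) x) \<longlonglongrightarrow> E (\<Union>i. B i) x))"

definition diagonal_measure :: "(real set \<Rightarrow> 'a::{real_inner, banach} \<Rightarrow> 'a) \<Rightarrow> 'a \<Rightarrow> real measure" where
  "diagonal_measure E x = measure_of UNIV (sets borel) (\<lambda>B. ennreal (inner (E B x) x))"

definition resolves :: "('a::{real_inner, banach} \<Rightarrow> 'a) \<Rightarrow> (real set \<Rightarrow> 'a \<Rightarrow> 'a) \<Rightarrow> bool" where
  "resolves A E \<longleftrightarrow> proj_measure E \<and> (\<forall>x. inner (A x) x = (\<integral>t. t \<partial>diagonal_measure E x))"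

text \<open>On a subdivision of \<open>{a..b}\<close> into \<open>n\<close> equal pieces the bounds
  telescope to \<open>(b - a) / n * (F b - F a)\<close>, which tends to 0. No continuity of
  \<open>F\<close> enters, so jumps of the spectral function are harmless.\<close>

lemma eq_of_quadratic_increments:
  fixes h F :: "real \<Rightarrow> real"
  assumes inc: "\<And>a b. a \<le> b \<Longrightarrow> \<bar>h b - h a\<bar> \<le> (b - a) * (F b - F a)" and ab: "a \<le> b"
  shows "h b = h a"
proof (rule ccontr)
  assume neq: "h b \<noteq> h a"
  obtain n :: nat where n: "(b - a) * (F b - F a) / \<bar>h b - h a\<bar> < real n"
    using reals_Archimedean2 by blast
  have "0 \<le> (b - a) * (F b - F a)" using inc[OF ab] by linarith
  then have n0: "0 < real n" using n by (smt (verit) divide_nonneg_nonneg abs_ge_zero)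
  define t where "t i = a + real i * ((b - a) / n)" for i
  have t: "t 0 = a" "t n = b" using n0 by (auto simp: t_def)
  have d: "t (Suc i) - t i = (b - a) / n" for i by (simp add: t_def distrib_right add_divide_distrib)
  have "\<bar>h b - h a\<bar> = \<bar>\<Sum>i<n. h (t (Suc i)) - h (t i)\<bar>"
    using sum_lessThan_telescope[of "\<lambda>i. h (t i)" n] by (simp add: t)
  also have "\<dots> \<le> (\<Sum>i<n. \<bar>h (t (Suc i)) - h (t i)\<bar>)" by (rule sum_abs)
  also have "\<dots> \<le> (\<Sum>i<n. (b - a) / n * (F (t (Suc i)) - F (t i)))"
  proof (rule sum_mono)
    fix i
    have "0 \<le> (b - a) / n" using ab by simp
    then have "t i \<le> t (Suc i)" using d[of i] by linarith
    from inc[OF this] show "\<bar>h (t (Suc i)) - h (t i)\<bar> \<le> (b - a) / n * (F (t (Suc i)) - F (t i))"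
      by (simp only: d)
  qed
  also have "\<dots> = (b - a) / n * (F b - F a)"
    by (simp only: sum_distrib_left[symmetric] sum_lessThan_telescope[of "\<lambda>i. F (t i)" n] t)
  finally have "\<bar>h b - h a\<bar> * n \<le> (b - a) * (F b - F a)" using n0 by (simp add: field_simps)
  moreover have "(b - a) * (F b - F a) < \<bar>h b - h a\<bar> * n"
    using n neq by (simp add: field_simps)
  ultimately show False by linarith
qed

section \<open>Existence of the resolution: right continuity, Stieltjes measures, Borel
  projections\<close>

context positive_operator
begin

lemma low_proj_low_proj:
  assumes "l \<le> m"
  shows "low_proj m (low_proj l x) = low_proj l x" "low_proj l (low_proj m x) = low_proj l x"
proof -
  show "low_proj m (low_proj l x) = low_proj l x"
    using low_space_mono[OF assms] low_proj_mem low_proj_id by blast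
  show "low_proj l (low_proj m x) = low_proj l x"
  proof (rule low_proj_eqI[OF low_proj_mem])
    fix k assume k: "k \<in> low_space l"
    then have "inner (x - low_proj l x) k = 0" "inner (x - low_proj m x) k = 0"
      using low_proj_orth low_space_mono[OF assms] by blast+
    then show "inner (low_proj m x - low_proj l x) k = 0" by (simp add: inner_simps)
  qed
qed

definition spec_fun :: "'a \<Rightarrow> real \<Rightarrow> real" where
  "spec_fun x l = (norm (low_proj l x))\<^sup>2"

lemma spec_fun_diff:
  assumes "l \<le> m"
  shows "spec_fun x m - spec_fun x l = (norm (low_proj m x - low_proj l x))\<^sup>2"
  using orth_projD(4)[OF low_proj_orth_proj, of "low_proj m x" l]
  by (simp add: spec_fun_def low_proj_low_proj[OF assms])

lemma spec_fun_mono: "l \<le> m \<Longrightarrow> spec_fun x l \<le> spec_fun x m"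
  using spec_fun_diff[of l m x] zero_le_power2[of "norm (low_proj m x - low_proj l x)"] by linarith

lemma spec_fun_nonneg: "0 \<le> spec_fun x l"
  by (simp add: spec_fun_def)

lemma low_proj_neg: "l < 0 \<Longrightarrow> low_proj l x = 0"
  using low_proj_mem[of l x] by (simp add: low_space_neg)

definition bnd :: real where
  "bnd = (SOME K. 0 < K \<and> (\<forall>x. norm (A x) \<le> norm x * K))"

lemma bnd: "0 < bnd" "norm (A x) \<le> bnd * norm x"
proof -
  have "\<exists>K. 0 < K \<and> (\<forall>x. norm (A x) \<le> norm x * K)"
    using bounded_linear.pos_bounded[OF self_adjointD(1)[OF self_adj]] by blast
  from someI_ex[OF this] show "0 < bnd" "norm (A x) \<le> bnd * norm x"
    unfolding bnd_def[symmetric] by (auto simp: mult.commute)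
qed

lemma low_proj_bnd: "bnd \<le> l \<Longrightarrow> low_proj l x = x"
proof -
  have "x \<in> low_space bnd" by (simp add: low_space_def bnd)
  then show "bnd \<le> l \<Longrightarrow> low_proj l x = x" using low_space_mono low_proj_id by blast
qed

text \<open>The squared norms decrease, hence converge, and \<open>spec_fun_diff\<close> turns this
  into the Cauchy property of the vectors. The limit lies in \<open>low_space m\<close> for all
  \<open>m > l\<close>, hence in \<open>low_space l\<close>, and the residual stays orthogonal to
  \<open>low_space l\<close>.\<close>

lemma low_proj_right_continuous:
  assumes "decseq s" "s \<longlonglongrightarrow> l"
  shows "(\<lambda>n. low_proj (s n) x) \<longlonglongrightarrow> low_proj l x"
proof -
  have le: "l \<le> s n" for n using decseq_ge[OF assms] .
  have mono: "low_space (s n) \<subseteq> low_space (s m)" if "m \<le> n" for m n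
    using low_space_mono assms(1) that by (simp add: decseq_def)
  have conv: "convergent (\<lambda>n. spec_fun x (s n))"
  proof (rule decseq_convergent[of _ 0])
    show "decseq (\<lambda>n. spec_fun x (s n))"
      using assms(1) by (auto simp: decseq_def intro: spec_fun_mono)
  qed (auto simp: spec_fun_nonneg convergent_def)
  have "Cauchy (\<lambda>n. low_proj (s n) x)"
  proof (rule metric_CauchyI)
    fix e :: real assume e: "0 < e"
    have "Cauchy (\<lambda>n. spec_fun x (s n))"
      using conv by (rule convergent_Cauchy)
    then obtain N where N: "\<And>m n. N \<le> m \<Longrightarrow> N \<le> n \<Longrightarrow> dist (spec_fun x (s m)) (spec_fun x (s n)) < e\<^sup>2"
      using e by (metis metric_CauchyD zero_less_power)
    have "dist (low_proj (s m) x) (low_proj (s n) x) < e" if "N \<le> m" "N \<le> n" for m n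
    proof (rule power_less_imp_less_base[of _ 2])
      have "(norm (low_proj (s m) x - low_proj (s n) x))\<^sup>2 = \<bar>spec_fun x (s m) - spec_fun x (s n)\<bar>"
      proof (cases "s n \<le> s m")
        case True
        then show ?thesis using spec_fun_diff[OF True, of x] by (simp add: abs_of_nonneg)
      next
        case False
        then have "s m \<le> s n" by simp
        from spec_fun_diff[OF this, of x] show ?thesis
          by (simp add: norm_minus_commute abs_minus_commute[of "spec_fun x (s m)"])
      qed
      then show "(dist (low_proj (s m) x) (low_proj (s n) x))\<^sup>2 < e\<^sup>2"
        using N[OF that] by (simp add: dist_norm)
    qed (use e in simp)
    then show "\<exists>M. \<forall>m\<ge>M. \<forall>n\<ge>M. dist (low_proj (s m) x) (low_proj (s n) x) < e" by blast
  qed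
  then obtain g where g: "(\<lambda>n. low_proj (s n) x) \<longlonglongrightarrow> g"
    using Cauchy_convergent convergent_def by blast
  have "g \<in> low_space l"
  proof (rule low_space_eq_Inter)
    fix m assume "l < m"
    then obtain N where N: "s N < m"
      using assms(2) order_tendstoD(2) eventually_sequentially by (metis order_refl)
    have "g \<in> low_space (s N)"
    proof (rule closed_sequentially[OF low_space_closed])
      show "low_proj (s (n + N)) x \<in> low_space (s N)" for n
        using mono[of N "n + N"] low_proj_mem by auto
      show "(\<lambda>n. low_proj (s (n + N)) x) \<longlonglongrightarrow> g" using g by (rule LIMSEQ_ignore_initial_segment)
    qed
    then show "g \<in> low_space m" using low_space_mono[of "s N" m] N by auto
  qed
  moreover have "inner (x - g) k = 0" if k: "k \<in> low_space l" for k
  proof (rule LIMSEQ_unique)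
    show "(\<lambda>n. inner (x - low_proj (s n) x) k) \<longlonglongrightarrow> inner (x - g) k" by (intro tendsto_intros g)
    have "inner (x - low_proj (s n) x) k = 0" for n
      using low_proj_orth low_space_mono[OF le] k by blast
    then show "(\<lambda>n. inner (x - low_proj (s n) x) k) \<longlonglongrightarrow> 0" by simp
  qed
  ultimately have "low_proj l x = g" by (rule low_proj_eqI)
  then show ?thesis using g by simp
qed

lemma spec_fun_right_continuous: "continuous (at_right l) (spec_fun x)"
  unfolding continuous_within
proof (rule tendsto_at_right_sequentially[of l "l + 1"])
  fix s assume "decseq s" "s \<longlonglongrightarrow> l"
  then show "(\<lambda>n. spec_fun x (s n)) \<longlonglongrightarrow> spec_fun x l"
    unfolding spec_fun_def by (intro tendsto_intros low_proj_right_continuous)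
qed simp

definition spec_measure :: "'a \<Rightarrow> real measure" where
  "spec_measure x = interval_measure (spec_fun x)"

lemma sets_spec_measure [simp, measurable_cong]: "sets (spec_measure x) = sets borel"
  and space_spec_measure [simp]: "space (spec_measure x) = UNIV"
  by (simp_all add: spec_measure_def)

lemma emeasure_spec_measure_Ioc:
  "l \<le> m \<Longrightarrow> emeasure (spec_measure x) {l<..m} = ennreal (spec_fun x m - spec_fun x l)"
  unfolding spec_measure_def
  by (rule emeasure_interval_measure_Ioc) (auto intro: spec_fun_mono spec_fun_right_continuous)

lemma spec_measure_neg: "l < 0 \<Longrightarrow> emeasure (spec_measure x) {..l} = 0"
proof -
  assume l: "l < 0"
  have "emeasure (spec_measure x) (\<Union>n::nat. {l - real n<..l}) = 0"
    by (rule emeasure_UN_eq_0) (use l in \<open>auto simp: emeasure_spec_measure_Ioc spec_fun_def low_proj_neg\<close>)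
  moreover have "(\<Union>n::nat. {l - real n<..l}) = {..l}"
  proof -
    have "\<exists>n::nat. l - real n < t" for t
      using reals_Archimedean2[of "l - t"] by (auto simp: algebra_simps)
    then show ?thesis by auto
  qed
  ultimately show ?thesis by simp
qed

lemma emeasure_spec_measure_Iic: "emeasure (spec_measure x) {..l} = ennreal (spec_fun x l)"
proof -
  define a where "a = min l 0 - 1"
  have a: "a \<le> l" "a < 0" by (auto simp: a_def)
  have "emeasure (spec_measure x) ({..a} \<union> {a<..l}) = emeasure (spec_measure x) {..a} + emeasure (spec_measure x) {a<..l}"
    by (intro plus_emeasure[symmetric]) auto
  moreover have "{..a} \<union> {a<..l} = {..l}" using a by auto
  ultimately show ?thesis
    using a by (simp add: spec_measure_neg emeasure_spec_measure_Ioc) (simp add: spec_fun_def low_proj_neg)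
qed

lemma spec_measure_above: "bnd \<le> l \<Longrightarrow> emeasure (spec_measure x) {l<..} = 0"
proof -
  assume l: "bnd \<le> l"
  have "emeasure (spec_measure x) (\<Union>n::nat. {l<..l + real n}) = 0"
    by (rule emeasure_UN_eq_0) (use l in \<open>auto simp: emeasure_spec_measure_Ioc spec_fun_def low_proj_bnd\<close>)
  moreover have "(\<Union>n::nat. {l<..l + real n}) = {l<..}"
  proof -
    have "\<exists>n::nat. t \<le> l + real n" for t
      using real_arch_simple[of "t - l"] by (auto simp: algebra_simps)
    then show ?thesis by auto
  qed
  ultimately show ?thesis by simp
qed

lemma emeasure_spec_measure_UNIV: "emeasure (spec_measure x) UNIV = ennreal ((norm x)\<^sup>2)"
proof -
  have "emeasure (spec_measure x) ({..bnd} \<union> {bnd<..}) = emeasure (spec_measure x) {..bnd} + emeasure (spec_measure x) {bnd<..}"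
    by (intro plus_emeasure[symmetric]) auto
  moreover have "{..bnd} \<union> {bnd<..} = UNIV" by auto
  ultimately show ?thesis
    by (simp add: spec_measure_above emeasure_spec_measure_Iic spec_fun_def low_proj_bnd)
qed

sublocale spec: finite_measure "spec_measure x" for x
  by (rule finite_measureI) (simp add: emeasure_spec_measure_UNIV)

lemma measure_spec_measure_UNIV: "measure (spec_measure x) UNIV = (norm x)\<^sup>2"
  by (simp add: measure_def emeasure_spec_measure_UNIV)

lemma measure_spec_measure_Iic: "measure (spec_measure x) {..l} = spec_fun x l"
  by (simp add: measure_def emeasure_spec_measure_Iic spec_fun_nonneg)

lemma measure_spec_measure_le: "measure (spec_measure x) B \<le> (norm x)\<^sup>2"
  using spec.bounded_measure[of x B] by (simp add: measure_spec_measure_UNIV)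

lemma AE_spec_measure: "AE t in spec_measure x. -1 < t \<and> t \<le> bnd"
proof -
  have n: "{..-1} \<in> null_sets (spec_measure x)" "{bnd<..} \<in> null_sets (spec_measure x)"
    by (auto simp: null_sets_def spec_measure_neg spec_measure_above)
  show ?thesis using AE_not_in[OF n(1)] AE_not_in[OF n(2)] by eventually_elim auto
qed

text \<open>The sets whose measures form the quadratic form of an orthogonal projection are a Dynkin
  system: complements come from \<open>x - P x\<close>, disjoint unions from
  \<open>orth_proj_sum\<close>. It contains the half-lines, which are stable under intersection and
  generate the Borel sets.\<close>

lemma ex_spec_proj:
  assumes "B \<in> sets borel"
  shows "\<exists>P. orth_proj P \<and> (\<forall>x. inner (P x) x = measure (spec_measure x) B)"
proof -
  have gen: "sets borel = sigma_sets UNIV (range (\<lambda>a::real. {..a}))"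
    by (subst borel_eq_atMost) simp
  have IS: "Int_stable (range (\<lambda>a::real. {..a}))"
    by (auto simp: Int_stable_def)
  have "range (\<lambda>a::real. {..a}) \<subseteq> Pow UNIV" by simp
  from IS this assms[unfolded gen] show ?thesis
  proof (induction rule: sigma_sets_induct_disjoint)
    case (basic B)
    then obtain a where "B = {..a}" by auto
    then show ?case
      using low_proj_orth_proj[of a] orth_projD(3)[OF low_proj_orth_proj, of a]
      by (auto simp: measure_spec_measure_Iic spec_fun_def)
  next
    case empty
    have "orth_proj (\<lambda>x::'a. 0)" by (simp add: orth_proj_def self_adjoint_def bounded_linear_zero)
    then show ?case by (intro exI[of _ "\<lambda>x. 0"]) auto
  next
    case (compl B)
    then obtain P where P: "orth_proj P" "\<And>x. inner (P x) x = measure (spec_measure x) B" by blast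
    have B: "B \<in> sets borel" using compl gen by simp
    have "measure (spec_measure x) (UNIV - B) = (norm x)\<^sup>2 - measure (spec_measure x) B" for x
      using spec.finite_measure_compl[of B x] B by (simp add: measure_spec_measure_UNIV)
    then show ?case
      using orth_proj_complement[OF P(1)] P(2)
      by (intro exI[of _ "\<lambda>x. x - P x"]) (auto simp: inner_diff_left power2_norm_eq_inner)
  next
    case (union B)
    have B: "B i \<in> sets borel" for i using union(2) gen by auto
    from union(3) obtain P where P: "\<And>i. orth_proj (P i)"
      "\<And>i x. inner (P i x) x = measure (spec_measure x) (B i)" by metis
    have bound: "(\<Sum>i<n. inner (P i x) x) \<le> (norm x)\<^sup>2" for n x
    proof -
      have "(\<Sum>i<n. inner (P i x) x) = measure (spec_measure x) (\<Union>i<n. B i)"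
        unfolding P(2) using B union(1)
        by (intro spec.finite_measure_finite_Union[symmetric]) (auto intro: disjoint_family_on_mono)
      then show ?thesis using measure_spec_measure_le by simp
    qed
    obtain Q where Q: "orth_proj Q" "\<And>x. (\<lambda>n. \<Sum>i<n. P i x) \<longlonglongrightarrow> Q x"
      using orth_proj_sum[of P, OF P(1) bound] by blast
    have "inner (Q x) x = measure (spec_measure x) (\<Union>i. B i)" for x
    proof (rule LIMSEQ_unique)
      show "(\<lambda>n. inner (\<Sum>i<n. P i x) x) \<longlonglongrightarrow> inner (Q x) x" by (intro tendsto_intros Q)
      have "(\<lambda>i. measure (spec_measure x) (B i)) sums measure (spec_measure x) (\<Union>i. B i)"
        using B union(1) by (intro spec.finite_measure_UNION) auto
      then show "(\<lambda>n. inner (\<Sum>i<n. P i x) x) \<longlonglongrightarrow> measure (spec_measure x) (\<Union>i. B i)"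
        by (simp add: sums_def inner_sum_left P(2))
    qed
    then show ?case using Q(1) by blast
  qed
qed

definition spec_proj :: "real set \<Rightarrow> 'a \<Rightarrow> 'a" where
  "spec_proj B = (SOME P. orth_proj P \<and> (\<forall>x. inner (P x) x = measure (spec_measure x) B))"

lemma spec_proj:
  assumes "B \<in> sets borel"
  shows "orth_proj (spec_proj B)" "inner (spec_proj B x) x = measure (spec_measure x) B"
  using someI_ex[OF ex_spec_proj[OF assms]] unfolding spec_proj_def by auto

lemma spec_proj_eqI:
  assumes "B \<in> sets borel" "self_adjoint P" "\<And>x. inner (P x) x = measure (spec_measure x) B"
  shows "spec_proj B = P"
  using self_adjoint_eqI[OF orth_projD(1)[OF spec_proj(1)[OF assms(1)]] assms(2)]
  by (simp add: spec_proj(2)[OF assms(1)] assms(3))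

lemma spec_proj_full:
  assumes "B \<in> sets borel" "\<And>x. measure (spec_measure x) B = (norm x)\<^sup>2"
  shows "spec_proj B x = x"
  using orth_proj_fixed_iff[OF spec_proj(1)[OF assms(1)], of x] by (simp add: spec_proj(2)[OF assms(1)] assms(2))

text \<open>The spectral measure of a vector in the range of \<open>spec_proj C\<close> has its full
  mass on \<open>C\<close>, so nothing remains for \<open>B\<close>.\<close>

lemma spec_proj_disjoint:
  assumes "B \<in> sets borel" "C \<in> sets borel" "B \<inter> C = {}"
  shows "spec_proj B (spec_proj C x) = 0"
proof -
  let ?g = "spec_proj C x"
  have "measure (spec_measure ?g) B + measure (spec_measure ?g) C = measure (spec_measure ?g) (B \<union> C)"
    using assms by (intro spec.finite_measure_Union[symmetric]) auto
  also have "\<dots> \<le> (norm ?g)\<^sup>2" by (rule measure_spec_measure_le)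
  finally have "(norm (spec_proj B ?g))\<^sup>2 + (norm (spec_proj C ?g))\<^sup>2 \<le> (norm ?g)\<^sup>2"
    using assms by (simp only: spec_proj(2)[symmetric] orth_projD(3)[OF spec_proj(1)])
  then show ?thesis using assms orth_projD(2)[OF spec_proj(1)] by simp
qed

text \<open>Split \<open>C\<close> into \<open>B \<inter> C\<close> and \<open>C - B\<close>. The
  second part is annihilated by \<open>spec_proj B\<close>; a vector in the range of the first has
  full mass on \<open>B \<inter> C\<close>, hence on \<open>B\<close>, and is fixed.\<close>

lemma spec_proj_Int:
  assumes B: "B \<in> sets borel" and C: "C \<in> sets borel"
  shows "spec_proj B (spec_proj C x) = spec_proj (B \<inter> C) x"
proof -
  have BC: "B \<inter> C \<in> sets borel" and CB: "C - B \<in> sets borel" using B C by auto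
  note sa = orth_projD(1)[OF spec_proj(1)]
  have "spec_proj C = (\<lambda>x. spec_proj (B \<inter> C) x + spec_proj (C - B) x)"
  proof (rule spec_proj_eqI[OF C])
    show "self_adjoint (\<lambda>x. spec_proj (B \<inter> C) x + spec_proj (C - B) x)"
      using sa[OF BC] sa[OF CB] by (auto simp: self_adjoint_def inner_simps intro!: bounded_linear_add)
    have "measure (spec_measure x) ((B \<inter> C) \<union> (C - B)) = measure (spec_measure x) (B \<inter> C) + measure (spec_measure x) (C - B)" for x
      using BC CB by (intro spec.finite_measure_Union) auto
    moreover have "(B \<inter> C) \<union> (C - B) = C" by auto
    ultimately show "inner (spec_proj (B \<inter> C) x + spec_proj (C - B) x) x = measure (spec_measure x) C" for x
      using BC CB by (simp add: inner_simps spec_proj(2))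
  qed
  then have "spec_proj B (spec_proj C x) = spec_proj B (spec_proj (B \<inter> C) x) + spec_proj B (spec_proj (C - B) x)"
    using self_adjointD(3)[OF sa[OF B]] by simp
  also have "spec_proj B (spec_proj (C - B) x) = 0"
    using B CB by (intro spec_proj_disjoint) auto
  also have "spec_proj B (spec_proj (B \<inter> C) x) = spec_proj (B \<inter> C) x"
  proof -
    let ?g = "spec_proj (B \<inter> C) x"
    have "(norm ?g)\<^sup>2 = inner (spec_proj (B \<inter> C) ?g) ?g"
      using orth_projD(2,3)[OF spec_proj(1)[OF BC]] by (simp add: power2_norm_eq_inner)
    also have "\<dots> \<le> inner (spec_proj B ?g) ?g"
      unfolding spec_proj(2)[OF B] spec_proj(2)[OF BC] using B BC by (intro spec.finite_measure_mono) auto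
    finally show ?thesis using orth_proj_fixed_iff[OF spec_proj(1)[OF B]] by blast
  qed
  finally show ?thesis by simp
qed

lemma spec_proj_UN:
  assumes B: "range B \<subseteq> sets borel" "disjoint_family B"
  shows "(\<lambda>n. \<Sum>i<n. spec_proj (B i) x) \<longlonglongrightarrow> spec_proj (\<Union>i. B i) x"
proof -
  have Bi: "B i \<in> sets borel" for i using B by auto
  have bound: "(\<Sum>i<n. inner (spec_proj (B i) x) x) \<le> (norm x)\<^sup>2" for n x
  proof -
    have "(\<Sum>i<n. inner (spec_proj (B i) x) x) = measure (spec_measure x) (\<Union>i<n. B i)"
      unfolding spec_proj(2)[OF Bi] using Bi B(2)
      by (intro spec.finite_measure_finite_Union[symmetric]) (auto intro: disjoint_family_on_mono)
    then show ?thesis using measure_spec_measure_le by simp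
  qed
  obtain Q where Q: "orth_proj Q" "\<And>x. (\<lambda>n. \<Sum>i<n. spec_proj (B i) x) \<longlonglongrightarrow> Q x"
    using orth_proj_sum[of "\<lambda>i. spec_proj (B i)", OF spec_proj(1)[OF Bi] bound] by blast
  have "inner (Q x) x = measure (spec_measure x) (\<Union>i. B i)" for x
  proof (rule LIMSEQ_unique)
    show "(\<lambda>n. inner (\<Sum>i<n. spec_proj (B i) x) x) \<longlonglongrightarrow> inner (Q x) x" by (intro tendsto_intros Q)
    have "(\<lambda>i. measure (spec_measure x) (B i)) sums measure (spec_measure x) (\<Union>i. B i)"
      using Bi B(2) by (intro spec.finite_measure_UNION) auto
    then show "(\<lambda>n. inner (\<Sum>i<n. spec_proj (B i) x) x) \<longlonglongrightarrow> measure (spec_measure x) (\<Union>i. B i)"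
      by (simp add: sums_def inner_sum_left spec_proj(2)[OF Bi])
  qed
  then have "spec_proj (\<Union>i. B i) = Q"
    using Bi by (intro spec_proj_eqI orth_projD(1)[OF Q(1)]) auto
  then show ?thesis using Q(2) by simp
qed

lemma proj_measure_spec_proj: "proj_measure spec_proj"
  unfolding proj_measure_def
proof (intro conjI ballI allI impI)
  define a where "a = max 1 (bnd + 1)"
  have "measure (spec_measure x) {-a<..<a} = (norm x)\<^sup>2" for x
  proof -
    have "measure (spec_measure x) {-a<..<a} = measure (spec_measure x) UNIV"
      by (rule spec.finite_measure_eq_AE) (use AE_spec_measure[of x] in \<open>auto simp: a_def elim: eventually_mono\<close>)
    then show ?thesis by (simp add: measure_spec_measure_UNIV)
  qed
  then show "\<exists>a. \<forall>x. spec_proj {-a<..<a} x = x"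
    using spec_proj_full[of "{-a<..<a}"] by (intro exI[of _ a]) auto
  have "spec_proj {} = (\<lambda>x. 0)"
    by (rule spec_proj_eqI) (auto simp: self_adjoint_def bounded_linear_zero)
  then show "spec_proj {} x = 0" for x by simp
qed (auto intro!: spec_proj spec_proj_Int spec_proj_UN)

text \<open>The conjugate of \<open>spec_proj B\<close> by \<open>U\<close> is symmetric and has the
  same quadratic form, because \<open>U\<close> preserves \<open>spec_fun\<close>; symmetric
  operators are determined by that form.\<close>

lemma spec_proj_isometry:
  assumes B: "B \<in> sets borel"
    and U: "bounded_linear U" "\<And>x y. inner (U x) (U y) = inner x y" "surj U" "\<And>x. U (A x) = A (U x)"
  shows "spec_proj B (U x) = U (spec_proj B x)"
proof -
  have n: "norm (U x) = norm x" for x by (simp add: norm_eq_sqrt_inner U(2))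
  then have "inj U"
    using linear_injective_0[OF bounded_linear.linear[OF U(1)]] by (metis norm_eq_zero)
  then have inv: "inv_into UNIV U (U x) = x" "U (inv_into UNIV U x) = x" for x
    using U(3) by (auto simp: f_inv_into_f)
  define P where "P x = inv_into UNIV U (spec_proj B (U x))" for x
  have UP: "U (P x) = spec_proj B (U x)" for x by (simp add: P_def inv)
  note lin = bounded_linear.linear[OF U(1)] and sa = orth_projD(1)[OF spec_proj(1)[OF B]]
  have inj: "x = y" if "U x = U y" for x y using that inv by metis
  have "bounded_linear P"
  proof (rule bounded_linear_intro[where K=1])
    show "P (x + y) = P x + P y" for x y
      by (rule inj) (simp add: UP linear_add[OF lin] self_adjointD[OF sa])
    show "P (r *\<^sub>R x) = r *\<^sub>R P x" for r x
      by (rule inj) (simp add: UP linear_scale[OF lin] self_adjointD[OF sa])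
    show "norm (P x) \<le> norm x * 1" for x
      using orth_projD(5)[OF spec_proj(1)[OF B], of "U x"] UP n by (metis mult.right_neutral)
  qed
  moreover have "inner (P x) y = inner x (P y)" for x y
    using U(2)[of "P x" y] U(2)[of x "P y"] self_adjointD(2)[OF sa, of "U x" "U y"] by (simp add: UP)
  ultimately have saP: "self_adjoint P" by (simp add: self_adjoint_def)
  have "spec_fun (U x) = spec_fun x" for x
    by (auto simp: spec_fun_def low_proj_isometry[OF U] n)
  then have m: "spec_measure (U x) = spec_measure x" for x by (simp add: spec_measure_def)
  have "spec_proj B = P"
  proof (rule spec_proj_eqI[OF B saP])
    show "inner (P x) x = measure (spec_measure x) B" for x
      using U(2)[of "P x" x] spec_proj(2)[OF B, of "U x"] by (simp add: UP m)
  qed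
  then show ?thesis using UP by simp
qed

lemma integrable_spec_measure:
  fixes f :: "real \<Rightarrow> real"
  assumes f: "f \<in> borel_measurable borel" and le: "\<And>t. -1 \<le> t \<Longrightarrow> t \<le> bnd \<Longrightarrow> \<bar>f t\<bar> \<le> K"
  shows "integrable (spec_measure x) f"
proof (rule spec.integrable_const_bound[of _ K])
  show "AE t in spec_measure x. norm (f t) \<le> K"
    using AE_spec_measure by eventually_elim (use le in auto)
  show "f \<in> borel_measurable (spec_measure x)" using f by simp
qed

text \<open>Let \<open>h l\<close> be the discrepancy between the form at
  \<open>low_proj l x\<close> and the integral of \<open>t\<close> over \<open>{..l}\<close>. Over
  \<open>{a<..b}\<close> both quantities grow by an amount between \<open>a\<close> and
  \<open>b\<close> times the increment of \<open>spec_fun x\<close>, so \<open>h\<close> is constant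
  by \<open>eq_of_quadratic_increments\<close>.\<close>

lemma spectral_integral: "inner (A x) x = (\<integral>t. t \<partial>spec_measure x)"
proof -
  define I where "I l = (\<integral>t. t * indicator {..l} t \<partial>spec_measure x)" for l
  define h where "h l = inner (A (low_proj l x)) (low_proj l x) - I l" for l
  have int: "integrable (spec_measure x) (\<lambda>t. t * indicator B t)" if "B \<in> sets borel" for B
    by (rule integrable_spec_measure[of _ "max 1 bnd"]) (use that in \<open>auto simp: indicator_def\<close>)
  have intc: "integrable (spec_measure x) (\<lambda>t. c * indicator B t)" if "B \<in> sets borel" for B and c :: real
    by (rule integrable_spec_measure[of _ "\<bar>c\<bar>"]) (use that in \<open>auto simp: indicator_def\<close>)
  have inc: "\<bar>h b - h a\<bar> \<le> (b - a) * (spec_fun x b - spec_fun x a)" if ab: "a \<le> b" for a b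
  proof -
    define g where "g = low_proj b x - low_proj a x"
    have gn: "(norm g)\<^sup>2 = spec_fun x b - spec_fun x a" by (simp add: g_def spec_fun_diff[OF ab])
    have gb: "g \<in> low_space b"
      unfolding g_def using low_space_subspace low_proj_mem low_space_mono[OF ab] by (blast intro: subspace_diff)
    have ga: "inner g m = 0" if "m \<in> low_space a" for m
      using low_proj_orth[OF that, of "low_proj b x"] by (simp add: g_def low_proj_low_proj[OF ab])
    have 1: "inner (A (low_proj b x)) (low_proj b x) - inner (A (low_proj a x)) (low_proj a x) = inner (A g) g"
    proof -
      have "inner g (A (low_proj a x)) = 0" using ga low_space_invariant low_proj_mem by blast
      then have z: "inner (A g) (low_proj a x) = 0" "inner (A (low_proj a x)) g = 0"
        by (simp_all add: self_adjointD(2)[OF self_adj] inner_commute)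
      have "low_proj b x = low_proj a x + g" by (simp add: g_def)
      then have "inner (A (low_proj b x)) (low_proj b x)
          = inner (A (low_proj a x)) (low_proj a x) + inner (A (low_proj a x)) g + inner (A g) (low_proj a x) + inner (A g) g"
        by (simp only: A_simps inner_add_left inner_add_right)
      then show ?thesis using z by simp
    qed
    have 2: "a * (norm g)\<^sup>2 \<le> inner (A g) g" by (rule low_space_orth_ge[OF ga])
    have 3: "inner (A g) g \<le> b * (norm g)\<^sup>2"
      using norm_cauchy_schwarz[of "A g" g] mult_right_mono[OF low_spaceD[OF gb], of "norm g"]
      by (simp add: power2_eq_square)
    have "I b - I a = (\<integral>t. t * indicator {..b} t - t * indicator {..a} t \<partial>spec_measure x)"
      unfolding I_def by (rule Bochner_Integration.integral_diff[symmetric]) (auto intro: int)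
    also have "\<dots> = (\<integral>t. t * indicator {a<..b} t \<partial>spec_measure x)"
      using ab by (intro Bochner_Integration.integral_cong) (auto simp: indicator_def)
    finally have I: "I b - I a = (\<integral>t. t * indicator {a<..b} t \<partial>spec_measure x)" .
    have m: "measure (spec_measure x) {a<..b} = (norm g)\<^sup>2"
      by (simp add: measure_def emeasure_spec_measure_Ioc[OF ab] gn spec_fun_mono[OF ab])
    have c: "(\<integral>t. c * indicator {a<..b} t \<partial>spec_measure x) = c * (norm g)\<^sup>2" for c :: real
      by (simp add: m)
    have 4: "a * (norm g)\<^sup>2 \<le> I b - I a" unfolding I c[symmetric]
      by (rule integral_mono[OF intc int]) (auto simp: indicator_def)
    have 5: "I b - I a \<le> b * (norm g)\<^sup>2" unfolding I c[symmetric]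
      by (rule integral_mono[OF int intc]) (auto simp: indicator_def)
    have "h b - h a = inner (A g) g - (I b - I a)" using 1 by (simp add: h_def)
    then have "\<bar>h b - h a\<bar> \<le> b * (norm g)\<^sup>2 - a * (norm g)\<^sup>2" using 2 3 4 5 by linarith
    then show ?thesis by (simp only: gn left_diff_distrib)
  qed
  \<comment> \<open>At \<open>bnd\<close> the projection is the identity. At \<open>-1\<close>
    everything vanishes; the start lies below \<open>0\<close> so that a possible atom at
    \<open>0\<close> is counted.\<close>
  have "h bnd = h (-1)"
    by (rule eq_of_quadratic_increments[of h "spec_fun x", OF inc]) (use bnd(1) in auto)
  moreover have "I bnd = (\<integral>t. t \<partial>spec_measure x)"
    unfolding I_def by (rule integral_cong_AE) (use AE_spec_measure[of x] in \<open>auto elim: eventually_mono\<close>)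
  moreover have "I (-1) = (\<integral>t. 0 \<partial>spec_measure x)"
    unfolding I_def by (rule integral_cong_AE) (use AE_spec_measure[of x] in \<open>auto elim: eventually_mono\<close>)
  ultimately show ?thesis by (simp add: h_def low_proj_bnd low_proj_neg)
qed

lemma diagonal_measure_spec_proj: "diagonal_measure spec_proj x = spec_measure x"
proof -
  have "diagonal_measure spec_proj x = measure_of UNIV (sets borel) (emeasure (spec_measure x))"
    unfolding diagonal_measure_def
    by (rule measure_of_eq)
      (auto simp: sets.sigma_sets_eq[of borel, simplified] spec_proj(2) spec.emeasure_eq_measure)
  also have "\<dots> = spec_measure x"
    using measure_of_of_measure[of "spec_measure x"] by simp
  finally show ?thesis .
qed

theorem resolves_spec_proj: "resolves A spec_proj"
  by (simp add: resolves_def proj_measure_spec_proj diagonal_measure_spec_proj spectral_integral)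

end

section \<open>Uniqueness of the resolution on half-lines\<close>

context
  fixes E :: "real set \<Rightarrow> 'a::{real_inner, banach} \<Rightarrow> 'a"
  assumes E: "proj_measure E"
begin

lemma proj_measure_orth_proj: "B \<in> sets borel \<Longrightarrow> orth_proj (E B)"
  and proj_measure_empty: "E {} x = 0"
  and proj_measure_Int: "B \<in> sets borel \<Longrightarrow> C \<in> sets borel \<Longrightarrow> E B (E C x) = E (B \<inter> C) x"
  and proj_measure_UN: "range D \<subseteq> sets borel \<Longrightarrow> disjoint_family D \<Longrightarrow>
    (\<lambda>n. \<Sum>i<n. E (D i) x) \<longlonglongrightarrow> E (\<Union>i. D i) x"
  using E unfolding proj_measure_def by blast+

lemma proj_measure_nonneg: "B \<in> sets borel \<Longrightarrow> 0 \<le> inner (E B x) x"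
  using orth_projD(3)[OF proj_measure_orth_proj] by simp

lemma proj_measure_UNIV: "E UNIV x = x"
proof -
  obtain a where "\<And>x. E {-a<..<a} x = x" using E unfolding proj_measure_def by blast
  then show ?thesis using proj_measure_Int[of UNIV "{-a<..<a}" x] by simp
qed

lemma proj_measure_complement:
  assumes B: "B \<in> sets borel"
  shows "E (- B) x = x - E B x"
proof -
  \<comment> \<open>Additivity is available for sequences only, so the pair \<open>B\<close>,
    \<open>- B\<close> is padded with empty sets.\<close>
  define D where "D i = (if i = 0 then B else if i = 1 then - B else {})" for i :: nat
  have "(\<lambda>n. \<Sum>i<n. E (D i) x) \<longlonglongrightarrow> E (\<Union>i. D i) x"
    using B by (intro proj_measure_UN) (auto simp: D_def disjoint_family_on_def)
  moreover have "(\<Union>i. D i) = UNIV" by (auto simp: D_def split: if_splits)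
  ultimately have "(\<lambda>n. \<Sum>i<n. E (D i) x) \<longlonglongrightarrow> x" by (simp add: proj_measure_UNIV)
  moreover have "(\<Sum>i<n. E (D i) x) = E B x + E (- B) x" if "2 \<le> n" for n
  proof -
    have "(\<Sum>i<n. E (D i) x) = (\<Sum>i\<in>{0, 1}. E (D i) x)"
      using that by (intro sum.mono_neutral_right) (auto simp: D_def proj_measure_empty)
    then show ?thesis by (simp add: D_def)
  qed
  then have "(\<lambda>n. \<Sum>i<n. E (D i) x) \<longlonglongrightarrow> E B x + E (- B) x"
    by (intro tendsto_eventually eventually_sequentiallyI)
  ultimately have "x = E B x + E (- B) x" by (rule LIMSEQ_unique)
  then show ?thesis by (simp add: algebra_simps)
qed

lemma sets_diagonal_measure [simp]: "sets (diagonal_measure E x) = sets borel"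
  and space_diagonal_measure [simp]: "space (diagonal_measure E x) = UNIV"
  using sets.sigma_sets_eq[of "borel :: real measure"] by (simp_all add: diagonal_measure_def)

lemma emeasure_diagonal_measure:
  assumes "B \<in> sets borel"
  shows "emeasure (diagonal_measure E x) B = ennreal (inner (E B x) x)"
  unfolding diagonal_measure_def
proof (rule emeasure_measure_of_sigma[OF _ _ _ assms])
  show "sigma_algebra UNIV (sets (borel :: real measure))"
    using sets.sigma_algebra_axioms[of "borel :: real measure"] by simp
  show "positive (sets borel) (\<lambda>B. ennreal (inner (E B x) x))"
    by (simp add: positive_def proj_measure_empty)
  show "countably_additive (sets borel) (\<lambda>B. ennreal (inner (E B x) x))"
  proof (rule countably_additiveI)
    fix D :: "nat \<Rightarrow> real set" assume D: "range D \<subseteq> sets borel" "disjoint_family D"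
    have "(\<lambda>n. inner (\<Sum>i<n. E (D i) x) x) \<longlonglongrightarrow> inner (E (\<Union>i. D i) x) x"
      by (intro tendsto_intros proj_measure_UN D)
    then have "(\<lambda>i. inner (E (D i) x) x) sums inner (E (\<Union>i. D i) x) x"
      by (simp add: sums_def inner_sum_left)
    then have "(\<lambda>i. ennreal (inner (E (D i) x) x)) sums ennreal (inner (E (\<Union>i. D i) x) x)"
      using D(1) by (subst sums_ennreal) (auto intro!: proj_measure_nonneg)
    then show "(\<Sum>i. ennreal (inner (E (D i) x) x)) = ennreal (inner (E (\<Union>i. D i) x) x)"
      by (simp add: sums_iff)
  qed
qed

lemma measure_diagonal_measure: "B \<in> sets borel \<Longrightarrow> measure (diagonal_measure E x) B = inner (E B x) x"
  by (simp add: measure_def emeasure_diagonal_measure proj_measure_nonneg)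

lemma finite_diagonal_measure: "finite_measure (diagonal_measure E x)"
  by (rule finite_measureI) (simp add: emeasure_diagonal_measure)

lemma AE_diagonal_measure: "\<exists>a. AE t in diagonal_measure E x. \<bar>t\<bar> < a"
proof -
  obtain a where a: "\<And>x. E {-a<..<a} x = x" using E unfolding proj_measure_def by blast
  have "E (- {-a<..<a}) x = 0" by (subst proj_measure_complement) (simp_all add: a)
  then have "- {-a<..<a} \<in> null_sets (diagonal_measure E x)"
    by (auto simp: null_sets_def emeasure_diagonal_measure)
  from AE_not_in[OF this] have "AE t in diagonal_measure E x. \<bar>t\<bar> < a"
    by eventually_elim auto
  then show ?thesis by blast
qed

lemma integrable_diagonal_measure:
  assumes "B \<in> sets borel"
  shows "integrable (diagonal_measure E x) (\<lambda>t. indicator B t * t)"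
    "integrable (diagonal_measure E x) (\<lambda>t. indicator B t * (c::real))"
proof -
  interpret finite_measure "diagonal_measure E x" by (rule finite_diagonal_measure)
  have m: "f \<in> borel_measurable (diagonal_measure E x)" if "f \<in> borel_measurable borel" for f :: "real \<Rightarrow> real"
    using that measurable_cong_sets[OF sets_diagonal_measure refl] by blast
  obtain a where a: "AE t in diagonal_measure E x. \<bar>t\<bar> < a" using AE_diagonal_measure by blast
  show "integrable (diagonal_measure E x) (\<lambda>t. indicator B t * t)"
    by (rule integrable_const_bound[of _ "\<bar>a\<bar>"])
      (use a assms in \<open>auto simp: indicator_def intro!: m elim!: eventually_mono\<close>)
  show "integrable (diagonal_measure E x) (\<lambda>t. indicator B t * c)"
    by (rule integrable_const_bound[of _ "\<bar>c\<bar>"])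
      (use assms in \<open>auto simp: indicator_def intro!: m\<close>)
qed

text \<open>Projecting the vector by \<open>E B\<close> restricts its measure to \<open>B\<close>.
  The form of \<open>A\<close> at \<open>E B x\<close> thereby becomes an integral over
  \<open>B\<close> against the measure of \<open>x\<close> itself.\<close>

lemma diagonal_measure_proj:
  assumes B: "B \<in> sets borel"
  shows "diagonal_measure E (E B x) = density (diagonal_measure E x) (\<lambda>t. ennreal (indicator B t))"
proof (rule measure_eqI)
  fix C assume "C \<in> sets (diagonal_measure E (E B x))"
  then have C: "C \<in> sets borel" by simp
  note sa = orth_projD(1)[OF proj_measure_orth_proj]
  have "inner (E C (E B x)) (E B x) = inner (E (B \<inter> C) x) x"
    using self_adjointD(2)[OF sa[OF B], of "E C (E B x)" x] B C
    by (simp add: proj_measure_Int Int_ac)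
  moreover have "(\<integral>\<^sup>+ t. ennreal (indicator B t) * indicator C t \<partial>diagonal_measure E x)
      = (\<integral>\<^sup>+ t. indicator (B \<inter> C) t \<partial>diagonal_measure E x)"
    by (intro nn_integral_cong) (auto simp: indicator_def)
  moreover have "(\<lambda>t. ennreal (indicator B t)) \<in> borel_measurable (diagonal_measure E x)"
    using B by (subst measurable_cong_sets[OF sets_diagonal_measure refl])
      (auto intro!: borel_measurable_indicator measurable_compose[OF _ measurable_ennreal])
  ultimately show "emeasure (diagonal_measure E (E B x)) C
      = emeasure (density (diagonal_measure E x) (\<lambda>t. ennreal (indicator B t))) C"
    using B C by (simp add: emeasure_density emeasure_diagonal_measure)
qed simp

end

context positive_operator
begin

lemma resolves_quadratic_proj:
  assumes E: "resolves A E" and B: "B \<in> sets borel"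
  shows "inner (A (E B x)) (E B x) = (\<integral>t. indicator B t * t \<partial>diagonal_measure E x)"
proof -
  have pm: "proj_measure E" using E by (simp add: resolves_def)
  have m: "f \<in> borel_measurable (diagonal_measure E x)" if "f \<in> borel_measurable borel" for f :: "real \<Rightarrow> real"
    using that measurable_cong_sets[OF sets_diagonal_measure[OF pm] refl] by blast
  have "inner (A (E B x)) (E B x) = (\<integral>t. t \<partial>diagonal_measure E (E B x))"
    using E by (simp add: resolves_def)
  also have "\<dots> = (\<integral>t. indicator B t *\<^sub>R t \<partial>diagonal_measure E x)"
    unfolding diagonal_measure_proj[OF pm B]
    by (rule integral_density) (use B in \<open>auto intro!: m\<close>)
  finally show ?thesis by simp
qed

text \<open>An orthogonal projection is determined by its range, so it suffices that
  \<open>P = E {..l}\<close> maps into \<open>low_space l\<close> and fixes it. The first needs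
  \<open>P\<close> to commute with \<open>A\<close>, so that the form bound on the range holds along
  orbits.\<close>

theorem resolves_unique:
  assumes E: "resolves A E"
  shows "E {..l} = low_proj l"
proof -
  have pm: "proj_measure E" using E by (simp add: resolves_def)
  define P where "P = E {..l}"
  have P: "orth_proj P" unfolding P_def by (rule proj_measure_orth_proj[OF pm]) simp
  note sa = orth_projD(1)[OF P] and PP = orth_projD(2)[OF P]
  have compl: "- {..l} = {l<..}" by auto
  have Q: "E {l<..} x = x - P x" for x
    using proj_measure_complement[OF pm, of "{..l}" x] by (simp add: P_def compl)
  have split: "inner (A x) x = inner (A (P x)) (P x) + inner (A (x - P x)) (x - P x)" for x
  proof -
    have "inner (A x) x = (\<integral>t. indicator {..l} t * t + indicator {l<..} t * t \<partial>diagonal_measure E x)"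
      using E by (auto simp: resolves_def indicator_def intro!: Bochner_Integration.integral_cong)
    also have "\<dots> = (\<integral>t. indicator {..l} t * t \<partial>diagonal_measure E x) + (\<integral>t. indicator {l<..} t * t \<partial>diagonal_measure E x)"
      by (rule Bochner_Integration.integral_add) (auto intro: integrable_diagonal_measure[OF pm])
    finally show ?thesis
      by (simp add: resolves_quadratic_proj[OF E, symmetric] Q[symmetric] P_def[symmetric])
  qed
  \<comment> \<open>\<open>split\<close> says that the form has no cross terms between the range and
    the kernel of \<open>P\<close>. At \<open>f + g\<close> this gives
    \<open>inner (A f) g = 0\<close>; as \<open>P (A f)\<close> is also orthogonal to
    \<open>g\<close>, so is \<open>g\<close> itself.\<close>
  have PA: "A (P x) = P (A (P x))" for x
  proof -
    define f g where "f = P x" and "g = A f - P (A f)"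
    have Pf: "P f = f" and Pg: "P g = 0" by (simp_all add: f_def g_def PP self_adjointD[OF sa])
    have "inner (A (f + g)) (f + g) = inner (A f) f + inner (A g) g"
      using split[of "f + g"] by (simp add: self_adjointD[OF sa] Pf Pg)
    moreover have "inner (A (f + g)) (f + g) = inner (A f) f + 2 * inner (A f) g + inner (A g) g"
      using self_adjointD(2)[OF self_adj, of g f] by (simp add: A_simps inner_simps inner_commute[of g "A f"])
    ultimately have "inner (A f) g = 0" by simp
    moreover have "inner (P (A f)) g = 0" using self_adjointD(2)[OF sa, of "A f" g] Pg by simp
    ultimately have "inner g g = 0" unfolding g_def by (simp only: inner_diff_left)
    then show ?thesis by (simp add: g_def f_def)
  qed
  have le: "inner (A f) f \<le> l * (norm f)\<^sup>2" if f: "P f = f" for f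
  proof -
    have "inner (A f) f = (\<integral>t. indicator {..l} t * t \<partial>diagonal_measure E f)"
      using resolves_quadratic_proj[OF E, of "{..l}" f] f by (simp add: P_def)
    also have "\<dots> \<le> (\<integral>t. indicator {..l} t * l \<partial>diagonal_measure E f)"
      by (rule integral_mono[OF integrable_diagonal_measure[OF pm]]) (auto simp: indicator_def)
    also have "\<dots> = l * (norm f)\<^sup>2"
      using f by (simp add: measure_diagonal_measure[OF pm] power2_norm_eq_inner P_def sets_diagonal_measure[OF pm] space_diagonal_measure[OF pm])
    finally show ?thesis .
  qed
  have mem: "f \<in> low_space l" if f: "P f = f" for f
  proof (cases "l < 0")
    case True
    have "0 \<le> l * (norm f)\<^sup>2" using le[OF f] pos[of f] by linarith
    then have "f = 0" using True by (auto simp: zero_le_mult_iff)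
    then show ?thesis using low_space_subspace subspace_0 by blast
  next
    case False
    have pow: "P ((A ^^ n) f) = (A ^^ n) f" for n
    proof (induction n)
      case (Suc n)
      then show ?case using PA[of "(A ^^ n) f"] by simp
    qed (simp add: f)
    have "norm (A ((A ^^ n) f)) \<le> l * norm ((A ^^ n) f)" for n
      using False pow[of n] pow[of "Suc n"] by (intro norm_le_of_quadratic_le le) auto
    then show ?thesis by (simp add: low_space_def)
  qed
  have fixed: "P f = f" if f: "f \<in> low_space l" for f
  proof -
    define g where "g = f - P f"
    have g: "g \<in> low_space l"
      unfolding g_def using f mem[OF PP] low_space_subspace by (blast intro: subspace_diff)
    have Eg: "E {l<..} g = g" by (simp add: Q g_def PP self_adjointD[OF sa])
    have "inner (A g) g \<le> norm (A g) * norm g" by (rule norm_cauchy_schwarz)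
    also have "\<dots> \<le> l * norm g * norm g" by (intro mult_right_mono low_spaceD g) simp
    finally have q: "inner (A g) g \<le> l * (norm g)\<^sup>2" by (simp add: power2_eq_square)
    \<comment> \<open>All mass of \<open>g\<close> sits on \<open>{l<..}\<close>, where
      \<open>t - l > 0\<close>, yet membership in the low space makes the integral of
      \<open>t - l\<close> nonpositive. Hence there is no mass.\<close>
    let ?M = "diagonal_measure E g"
    have m: "measure ?M {l<..} = (norm g)\<^sup>2"
      by (simp add: measure_diagonal_measure[OF pm] Eg power2_norm_eq_inner)
    have int: "integrable ?M (\<lambda>t. indicator {l<..} t * t - indicator {l<..} t * l)"
      by (intro Bochner_Integration.integrable_diff integrable_diagonal_measure[OF pm]) auto
    have nonneg: "0 \<le> indicator {l<..} t * t - indicator {l<..} t * l" for t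
      by (simp add: indicator_def)
    have "(\<integral>t. indicator {l<..} t * t - indicator {l<..} t * l \<partial>?M) = inner (A g) g - l * (norm g)\<^sup>2"
    proof -
      have "(\<integral>t. indicator {l<..} t * t - indicator {l<..} t * l \<partial>?M)
          = (\<integral>t. indicator {l<..} t * t \<partial>?M) - (\<integral>t. indicator {l<..} t * l \<partial>?M)"
        by (rule Bochner_Integration.integral_diff[OF integrable_diagonal_measure[OF pm]]) simp_all
      then show ?thesis
        using resolves_quadratic_proj[OF E, of "{l<..}" g]
        by (simp add: Eg m space_diagonal_measure[OF pm])
    qed
    then have "(\<integral>t. indicator {l<..} t * t - indicator {l<..} t * l \<partial>?M) = 0"
      using q Bochner_Integration.integral_nonneg[of ?M "\<lambda>t. indicator {l<..} t * t - indicator {l<..} t * l"] nonneg by force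
    then have "AE t in ?M. indicator {l<..} t * t - indicator {l<..} t * l = 0"
      using integral_nonneg_eq_0_iff_AE[OF int] nonneg by simp
    then have "AE t in ?M. t \<notin> {l<..}" by eventually_elim (auto simp: indicator_def split: if_splits)
    then have "measure ?M {l<..} = 0"
      by (subst (asm) AE_iff_measurable[OF _ refl]) (auto simp: measure_def sets_diagonal_measure[OF pm] space_diagonal_measure[OF pm] greaterThan_def)
    then show ?thesis using m by (simp add: g_def)
  qed
  show ?thesis
    using orth_proj_eq_proj_onto[OF low_space_subspace low_space_closed P mem[OF PP] fixed]
    by (simp add: P_def low_proj_def)
qed

end

section \<open>Square-summable functions as a Hilbert space\<close>

definition square_summable :: "('i \<Rightarrow> complex) \<Rightarrow> bool" where
  "square_summable f \<longleftrightarrow> (\<lambda>i. (cmod (f i))\<^sup>2) summable_on UNIV"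

lemma square_summable_mono:
  assumes "square_summable g" "\<And>i. cmod (f i) \<le> cmod (g i)"
  shows "square_summable f"
  unfolding square_summable_def
  by (rule summable_on_comparison_test[OF assms(1)[unfolded square_summable_def]])
    (auto intro: assms(2) power_mono)

lemma square_summable_scale: "square_summable f \<Longrightarrow> square_summable (\<lambda>i. c * f i)"
  unfolding square_summable_def norm_mult power_mult_distrib by (rule summable_on_cmult_right)

lemma norm_add_sq_le: "(norm (a + b))\<^sup>2 \<le> 2 * (norm a)\<^sup>2 + 2 * (norm b)\<^sup>2"
  for a b :: "'a::real_inner"
proof -
  have "(norm (a + b))\<^sup>2 + (norm (a - b))\<^sup>2 = 2 * (norm a)\<^sup>2 + 2 * (norm b)\<^sup>2"
    unfolding power2_norm_eq_inner by (simp add: inner_simps inner_commute)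
  then show ?thesis using zero_le_power2[of "norm (a - b)"] by linarith
qed

lemma square_summable_add:
  assumes "square_summable f" "square_summable g"
  shows "square_summable (\<lambda>i. f i + g i)"
  unfolding square_summable_def
proof (rule summable_on_comparison_test)
  show "(\<lambda>i. 2 * (cmod (f i))\<^sup>2 + 2 * (cmod (g i))\<^sup>2) summable_on UNIV"
    using assms unfolding square_summable_def by (intro summable_on_add summable_on_cmult_right)
qed (auto intro: norm_add_sq_le)

lemma mult_le_sum_squares:
  fixes a b :: real
  assumes "0 \<le> a" "0 \<le> b"
  shows "a * b \<le> a\<^sup>2 + b\<^sup>2"
  using sum_squares_bound[of a b] mult_nonneg_nonneg[OF assms] unfolding mult.assoc by linarith

lemma square_summable_inner:
  assumes "square_summable f" "square_summable g"
  shows "(\<lambda>i. inner (f i) (g i)) summable_on UNIV"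
proof (rule abs_summable_summable, rule summable_on_comparison_test)
  show "(\<lambda>i. (cmod (f i))\<^sup>2 + (cmod (g i))\<^sup>2) summable_on UNIV"
    using assms unfolding square_summable_def by (rule summable_on_add)
  show "norm (inner (f i) (g i)) \<le> (cmod (f i))\<^sup>2 + (cmod (g i))\<^sup>2" for i
  proof -
    have "norm (inner (f i) (g i)) \<le> cmod (f i) * cmod (g i)" by (simp add: Cauchy_Schwarz_ineq2)
    also have "\<dots> \<le> (cmod (f i))\<^sup>2 + (cmod (g i))\<^sup>2"
      by (rule mult_le_sum_squares) simp_all
    finally show ?thesis .
  qed
qed auto

typedef 'i l2 = "{f :: 'i \<Rightarrow> complex. square_summable f}"
  morphisms l2_fun l2_of
  by (intro exI[of _ "\<lambda>_. 0"]) (simp add: square_summable_def)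

lemma square_summable_l2_fun: "square_summable (l2_fun x)"
  using l2_fun[of x] by simp

lemma l2_fun_l2_of: "square_summable f \<Longrightarrow> l2_fun (l2_of f) = f"
  by (simp add: l2_of_inverse)

lemma l2_eqI: "(\<And>i. l2_fun x i = l2_fun y i) \<Longrightarrow> x = y"
  using l2_fun_inject by blast

instantiation l2 :: (type) real_vector
begin

definition "0 = l2_of (\<lambda>_. 0)"
definition "x + y = l2_of (\<lambda>i. l2_fun x i + l2_fun y i)"
definition "- x = l2_of (\<lambda>i. - l2_fun x i)"
definition "x - y = l2_of (\<lambda>i. l2_fun x i - l2_fun y i)" for x y :: "'a l2"
definition "r *\<^sub>R x = l2_of (\<lambda>i. of_real r * l2_fun x i)"

lemma l2_fun_zero: "l2_fun 0 i = 0"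
  by (simp add: zero_l2_def l2_fun_l2_of square_summable_def)

lemma l2_fun_add: "l2_fun (x + y) i = l2_fun x i + l2_fun y i"
  by (simp add: plus_l2_def l2_fun_l2_of square_summable_add square_summable_l2_fun)

lemma l2_fun_scaleR: "l2_fun (r *\<^sub>R x) i = of_real r * l2_fun x i"
  by (simp add: scaleR_l2_def l2_fun_l2_of square_summable_scale square_summable_l2_fun)

lemma l2_fun_uminus: "l2_fun (- x) i = - l2_fun x i"
  using square_summable_scale[OF square_summable_l2_fun[of x], of "-1"]
  by (simp add: uminus_l2_def l2_fun_l2_of)

lemma l2_fun_diff: "l2_fun (x - y) i = l2_fun x i - l2_fun y i"
  using square_summable_add[OF square_summable_l2_fun[of x] square_summable_scale[OF square_summable_l2_fun[of y], of "-1"]]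
  by (simp add: minus_l2_def l2_fun_l2_of)

instance
  by standard
    (rule l2_eqI; simp add: l2_fun_zero l2_fun_add l2_fun_scaleR l2_fun_uminus l2_fun_diff algebra_simps)+

end

instantiation l2 :: (type) real_inner
begin

text \<open>On complex numbers \<open>inner\<close> is the real part of \<open>a * cnj b\<close>, so
  this is the real part of the Hermitian product.\<close>

definition "inner x y = (\<Sum>\<^sub>\<infinity>i. inner (l2_fun x i) (l2_fun y i))"
definition "norm x = sqrt (inner x x)" for x :: "'a l2"
definition "dist x y = norm (x - y)" for x y :: "'a l2"
definition "sgn x = x /\<^sub>R norm x" for x :: "'a l2"
definition [code del]: "uniformity = (INF e\<in>{0<..}. principal {(x :: 'a l2, y). dist x y < e})"
definition [code del]: "open (U :: 'a l2 set) \<longleftrightarrow> (\<forall>x\<in>U. eventually (\<lambda>(x', y). x' = x \<longrightarrow> y \<in> U) uniformity)"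

lemma l2_inner_summable: "(\<lambda>i. inner (l2_fun x i) (l2_fun y i)) summable_on UNIV"
  by (intro square_summable_inner square_summable_l2_fun)

instance
proof
  fix x y z :: "'a l2" and r :: real
  show "inner x y = inner y x" by (simp add: inner_l2_def inner_commute)
  show "inner (x + y) z = inner x z + inner y z"
    unfolding inner_l2_def l2_fun_add inner_add_left by (intro infsum_add l2_inner_summable)
  show "inner (r *\<^sub>R x) y = r * inner x y"
    unfolding inner_l2_def l2_fun_scaleR scaleR_conv_of_real[symmetric] inner_scaleR_left
    by (rule infsum_cmult_right') 
  show "0 \<le> inner x x" unfolding inner_l2_def by (rule infsum_nonneg) simp
  show "inner x x = 0 \<longleftrightarrow> x = 0"
  proof
    assume 0: "inner x x = 0"
    have "inner (l2_fun x i) (l2_fun x i) = 0" for i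
      by (rule nonneg_infsum_le_0D[OF _ l2_inner_summable]) (use 0 in \<open>auto simp: inner_l2_def\<close>)
    then show "x = 0" by (intro l2_eqI) (simp add: l2_fun_zero)
  qed (simp add: inner_l2_def l2_fun_zero)
qed (simp_all add: dist_l2_def sgn_l2_def uniformity_l2_def open_l2_def norm_l2_def)

end

lemma l2_norm_sq: "(norm x)\<^sup>2 = (\<Sum>\<^sub>\<infinity>i. (cmod (l2_fun x i))\<^sup>2)"
  unfolding power2_norm_eq_inner inner_l2_def ..

lemma cmod_l2_fun_le: "cmod (l2_fun x i) \<le> norm x"
proof (rule power2_le_imp_le)
  have "(\<Sum>i\<in>{i}. (cmod (l2_fun x i))\<^sup>2) \<le> (norm x)\<^sup>2"
    unfolding l2_norm_sq
    by (rule finite_sum_le_infsum) (use square_summable_l2_fun[of x] in \<open>auto simp: square_summable_def\<close>)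
  then show "(cmod (l2_fun x i))\<^sup>2 \<le> (norm x)\<^sup>2" by simp
qed simp

lemma bounded_linear_l2_fun: "bounded_linear (\<lambda>x. l2_fun x i)"
  by (rule bounded_linear_intro[where K=1])
    (auto simp: l2_fun_add l2_fun_scaleR scaleR_conv_of_real cmod_l2_fun_le)

text \<open>Coordinates converge separately. The Cauchy bound passes to the limit on each finite
  index set and only then to the full sum, which gives both square summability of the limit and
  convergence in norm.\<close>

instance l2 :: (type) banach
proof
  fix X :: "nat \<Rightarrow> 'a l2"
  assume X: "Cauchy X"
  have "Cauchy (\<lambda>n. l2_fun (X n) i)" for i
    using bounded_linear.Cauchy[OF bounded_linear_l2_fun X] .
  then have "\<exists>l. (\<lambda>n. l2_fun (X n) i) \<longlonglongrightarrow> l" for i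
    using Cauchy_convergent convergent_def by blast
  then obtain l where l: "\<And>i. (\<lambda>n. l2_fun (X n) i) \<longlonglongrightarrow> l i" by metis
  have fin: "(\<Sum>i\<in>F. (cmod (l2_fun (X m) i - l i))\<^sup>2) \<le> e\<^sup>2"
    if N: "\<And>m n. N \<le> m \<Longrightarrow> N \<le> n \<Longrightarrow> dist (X m) (X n) < e" and m: "N \<le> m" and F: "finite F" for F m N e
  proof (rule LIMSEQ_le_const2)
    show "(\<lambda>n. \<Sum>i\<in>F. (cmod (l2_fun (X m) i - l2_fun (X n) i))\<^sup>2) \<longlonglongrightarrow> (\<Sum>i\<in>F. (cmod (l2_fun (X m) i - l i))\<^sup>2)"
      by (intro tendsto_intros l)
    have "(\<Sum>i\<in>F. (cmod (l2_fun (X m) i - l2_fun (X n) i))\<^sup>2) \<le> e\<^sup>2" if "N \<le> n" for n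
    proof -
      have "(\<Sum>i\<in>F. (cmod (l2_fun (X m - X n) i))\<^sup>2) \<le> (norm (X m - X n))\<^sup>2"
        unfolding l2_norm_sq
        by (rule finite_sum_le_infsum)
          (use F square_summable_l2_fun[of "X m - X n"] in \<open>auto simp: square_summable_def\<close>)
      also have "\<dots> \<le> e\<^sup>2"
        using N[OF m that] by (intro power_mono) (auto simp: dist_norm)
      finally show ?thesis by (simp add: l2_fun_diff)
    qed
    then show "\<exists>N. \<forall>n\<ge>N. (\<Sum>i\<in>F. (cmod (l2_fun (X m) i - l2_fun (X n) i))\<^sup>2) \<le> e\<^sup>2" by blast
  qed
  have sq: "square_summable (\<lambda>i. l2_fun (X m) i - l i)"
    if N: "\<And>m n. N \<le> m \<Longrightarrow> N \<le> n \<Longrightarrow> dist (X m) (X n) < e" and m: "N \<le> m" for m N e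
    unfolding square_summable_def
    by (rule nonneg_bounded_partial_sums_imp_summable_on[of _ _ "e\<^sup>2"])
      (auto intro!: eventually_finite_subsets_at_top_weakI fin[OF N m])
  obtain N where N: "\<And>m n. N \<le> m \<Longrightarrow> N \<le> n \<Longrightarrow> dist (X m) (X n) < 1"
    using metric_CauchyD[OF X, of 1] by auto
  have "square_summable l"
  proof -
    have "square_summable (\<lambda>i. l2_fun (X N) i + (-1) * (l2_fun (X N) i - l i))"
      by (intro square_summable_add square_summable_l2_fun square_summable_scale sq[OF N]) auto
    then show ?thesis by simp
  qed
  then have lf: "l2_fun (l2_of l) = l" by (rule l2_fun_l2_of)
  have "X \<longlonglongrightarrow> l2_of l"
  proof (rule metric_LIMSEQ_I)
    fix e :: real assume e: "0 < e"
    then obtain N where N: "\<And>m n. N \<le> m \<Longrightarrow> N \<le> n \<Longrightarrow> dist (X m) (X n) < e / 2"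
      using metric_CauchyD[OF X, of "e / 2"] by auto
    have "dist (X m) (l2_of l) < e" if m: "N \<le> m" for m
    proof -
      have "(norm (X m - l2_of l))\<^sup>2 \<le> (e / 2)\<^sup>2"
        unfolding l2_norm_sq l2_fun_diff lf
        by (rule infsum_le_finite_sums)
          (use sq[OF N m] fin[OF N m] in \<open>auto simp: square_summable_def\<close>)
      then have "norm (X m - l2_of l) \<le> e / 2" by (rule power2_le_imp_le) (use e in simp)
      then show ?thesis using e by (simp add: dist_norm)
    qed
    then show "\<exists>N. \<forall>n\<ge>N. dist (X n) (l2_of l) < e" by blast
  qed
  then show "convergent X" by (auto simp: convergent_def)
qed

section \<open>Random walks on countable groups\<close>

lemma has_sum_pmf:
  assumes "set_pmf p \<subseteq> A"
  shows "(pmf p has_sum 1) A"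
proof -
  have "pmf p summable_on A"
    by (rule abs_summable_summable[OF abs_summable_equivalent[THEN iffD2, OF pmf_abs_summable]])
  moreover have "infsum (pmf p) A = 1"
    using infsetsum_pmf_eq_1[OF assms] infsetsum_infsum[OF pmf_abs_summable[of p A]] by simp
  ultimately show ?thesis using has_sum_infsum by metis
qed

lemma has_sum_minus:
  fixes f g :: "'b \<Rightarrow> 'c::topological_ab_group_add"
  assumes "(f has_sum a) A" "(g has_sum b) A"
  shows "((\<lambda>x. f x - g x) has_sum (a - b)) A"
  using has_sum_add[OF assms(1), of "\<lambda>x. - g x" "- b"] assms(2) by (simp add: has_sum_uminus)

lemma has_sum_cong_imp:
  assumes "(f has_sum a) A" "\<And>x. x \<in> A \<Longrightarrow> f x = g x"
  shows "(g has_sum a) A"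
  using has_sum_cong[of A f g a] assms by blast

lemma inner_complex_eq_Re: "inner a b = Re (a * cnj b)"
  by (simp add: inner_complex_def)

text \<open>An infinite countable carrier is enumerated bijectively by all natural numbers, which
  makes \<open>vec\<close> and \<open>fn\<close> mutually inverse between \<open>ell2 G\<close> and
  \<open>nat l2\<close>.\<close>

locale symmetric_walk = group G for G (structure) +
  fixes \<mu> :: "'a pmf"
  assumes countable_carrier: "countable (carrier G)"
    and infinite_carrier: "infinite (carrier G)"
    and supp: "set_pmf \<mu> \<subseteq> carrier G"
    and symm: "x \<in> carrier G \<Longrightarrow> pmf \<mu> (inv x) = pmf \<mu> x"
begin

text \<open>The square-summable functions on the group are identified with \<open>\<ell>\<^sup>2(\<nat>)\<close> by enumerating the
  carrier, so that they form a type of class \<open>banach\<close>.\<close>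

definition vec :: "('a \<Rightarrow> complex) \<Rightarrow> nat l2" where
  "vec f = l2_of (\<lambda>n. f (from_nat_into (carrier G) n))"

definition fn :: "nat l2 \<Rightarrow> 'a \<Rightarrow> complex" where
  "fn h x = (if x \<in> carrier G then l2_fun h (to_nat_on (carrier G) x) else 0)"

lemma bij_enum: "bij_betw (from_nat_into (carrier G)) UNIV (carrier G)"
  by (rule bij_betw_from_nat_into[OF countable_carrier infinite_carrier])

lemma enum_mem: "from_nat_into (carrier G) n \<in> carrier G"
  by (rule from_nat_into) auto

lemma ell2_iff:
  "f \<in> ell2 G \<longleftrightarrow> (\<forall>x. x \<notin> carrier G \<longrightarrow> f x = 0) \<and> square_summable (\<lambda>n. f (from_nat_into (carrier G) n))"
  using summable_on_reindex_bij_betw[OF bij_enum, of "\<lambda>x. (cmod (f x))\<^sup>2"]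
  by (auto simp: ell2_def square_summable_def)

lemma fn_enum: "fn h (from_nat_into (carrier G) n) = l2_fun h n"
  by (simp add: fn_def enum_mem to_nat_on_from_nat_into_infinite[OF countable_carrier infinite_carrier])

lemma fn_ell2: "fn h \<in> ell2 G"
  unfolding ell2_iff by (simp add: fn_enum square_summable_l2_fun) (simp add: fn_def)

lemma vec_fn [simp]: "vec (fn h) = h"
  unfolding vec_def fn_enum by (rule l2_fun_inverse)

lemma fn_vec: "f \<in> ell2 G \<Longrightarrow> fn (vec f) = f"
  by (auto simp: fn_def vec_def ell2_iff l2_fun_l2_of from_nat_into_to_nat_on[OF countable_carrier])

lemma fn_outside: "x \<notin> carrier G \<Longrightarrow> fn h x = 0"
  by (simp add: fn_def)

lemma fn_eqI: "(\<And>x. x \<in> carrier G \<Longrightarrow> fn h x = fn k x) \<Longrightarrow> h = k"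
  by (metis ext fn_outside vec_fn)

lemma fn_simps [simp]:
  "fn 0 x = 0" "fn (h + k) x = fn h x + fn k x" "fn (h - k) x = fn h x - fn k x"
  "fn (r *\<^sub>R h) x = of_real r * fn h x" "fn (- h) x = - fn h x"
  by (simp_all add: fn_def l2_fun_zero l2_fun_add l2_fun_diff l2_fun_scaleR l2_fun_uminus)

lemma bounded_linear_fn: "bounded_linear (\<lambda>h. fn h x)"
  by (cases "x \<in> carrier G") (simp_all add: fn_def bounded_linear_l2_fun bounded_linear_zero)

lemma fn_sum: "fn (\<Sum>i\<in>I. h i) x = (\<Sum>i\<in>I. fn (h i) x)"
  by (rule linear_sum[OF bounded_linear.linear[OF bounded_linear_fn]])

lemma inner_fn: "inner h k = (\<Sum>\<^sub>\<infinity>x\<in>carrier G. inner (fn h x) (fn k x))"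
  unfolding inner_l2_def
  by (subst infsum_reindex_bij_betw[OF bij_enum, symmetric]) (simp add: fn_enum)

lemma summable_fn: "(\<lambda>x. inner (fn h x) (fn k x)) summable_on carrier G"
  by (subst summable_on_reindex_bij_betw[OF bij_enum, symmetric]) (simp add: fn_enum l2_inner_summable)

lemma norm_sq_fn: "(norm h)\<^sup>2 = (\<Sum>\<^sub>\<infinity>x\<in>carrier G. (cmod (fn h x))\<^sup>2)"
  unfolding power2_norm_eq_inner inner_fn ..

lemma summable_fn_sq: "(\<lambda>x. (cmod (fn h x))\<^sup>2) summable_on carrier G"
  using summable_fn[of h h] by (simp add: dot_square_norm)

lemma ell2_norm_fn: "ell2_norm G (fn h) = norm h"
  by (simp add: ell2_norm_def norm_sq_fn[symmetric])

lemma norm_le_fn: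
  assumes "\<And>x. x \<in> carrier G \<Longrightarrow> cmod (fn h x) \<le> cmod (fn k x)"
  shows "norm h \<le> norm k"
proof (rule power2_le_imp_le)
  show "(norm h)\<^sup>2 \<le> (norm k)\<^sup>2"
    unfolding norm_sq_fn by (rule infsum_mono[OF summable_fn_sq summable_fn_sq]) (simp add: assms power_mono)
qed simp

lemma ell2_mono:
  assumes "g \<in> ell2 G" "\<And>x. cmod (f x) \<le> cmod (g x)"
  shows "f \<in> ell2 G"
proof -
  have "f x = 0" if "x \<notin> carrier G" for x
    using assms(2)[of x] assms(1) that by (simp add: ell2_def)
  then show ?thesis using assms square_summable_mono[of "\<lambda>n. g (from_nat_into (carrier G) n)"]
    by (auto simp: ell2_iff)
qed

section \<open>The complex structure, seen through real isometries\<close>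

definition cscale :: "complex \<Rightarrow> nat l2 \<Rightarrow> nat l2" where
  "cscale c h = vec (\<lambda>x. c * fn h x)"

lemma fn_cscale [simp]: "fn (cscale c h) x = c * fn h x"
proof -
  have "(\<lambda>x. c * fn h x) \<in> ell2 G"
    using fn_ell2[of h] square_summable_scale by (auto simp: ell2_iff)
  then show ?thesis by (simp add: cscale_def fn_vec)
qed

lemma cscale_of_real: "cscale (of_real r) h = r *\<^sub>R h"
  by (rule fn_eqI) simp

lemma cscale_cscale: "cscale c (cscale d h) = cscale (c * d) h"
  by (rule fn_eqI) simp

lemma inner_cscale_unit:
  assumes "cmod u = 1"
  shows "inner (cscale u h) (cscale u k) = inner h k"
proof -
  have "u * cnj u = 1" using complex_norm_square[of u] assms by simp
  moreover have "(u * a) * cnj (u * b) = (u * cnj u) * (a * cnj b)" for a b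
    by (simp add: mult_ac)
  ultimately have "inner (u * a) (u * b) = inner a b" for a b
    unfolding inner_complex_eq_Re by (metis mult_1)
  then show ?thesis by (simp add: inner_fn)
qed

lemma bounded_linear_cscale_unit:
  assumes "cmod u = 1"
  shows "bounded_linear (cscale u)"
proof (rule bounded_linear_intro[where K=1])
  show "norm (cscale u h) \<le> norm h * 1" for h
    by (simp add: norm_eq_sqrt_inner inner_cscale_unit[OF assms])
qed (rule fn_eqI, simp add: algebra_simps)+

lemma surj_cscale_unit:
  assumes "cmod u = 1"
  shows "surj (cscale u)"
proof (rule surjI)
  have "u \<noteq> 0" using assms by auto
  then show "cscale u (cscale (inverse u) h) = h" for h
    by (intro fn_eqI) (simp add: mult.assoc[symmetric])
qed

text \<open>Multiplication by \<open>\<i>\<close> is an isometry with square \<open>-1\<close>,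
  hence skew.\<close>

lemma inner_cscale_i: "inner (cscale \<i> h) k = - inner h (cscale \<i> k)"
proof -
  have "inner (cscale \<i> h) (cscale \<i> (cscale \<i> k)) = inner h (cscale \<i> k)"
    by (rule inner_cscale_unit) simp
  moreover have "cscale \<i> (cscale \<i> k) = - k" by (rule fn_eqI) (simp add: mult.assoc[symmetric])
  ultimately show ?thesis by simp
qed

text \<open>The imaginary part of the Hermitian product is the real product with
  \<open>\<i> k\<close>, so a Hermitian identity amounts to two real ones.\<close>

lemma ell2_inner_fn: "ell2_inner G (fn h) (fn k) = Complex (inner h k) (inner h (cscale \<i> k))"
proof -
  have "(\<lambda>x. fn h x * cnj (fn k x)) summable_on carrier G"
  proof (rule abs_summable_summable, rule summable_on_comparison_test)
    show "(\<lambda>x. (cmod (fn h x))\<^sup>2 + (cmod (fn k x))\<^sup>2) summable_on carrier G"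
      by (intro summable_on_add summable_fn_sq)
    show "norm (fn h x * cnj (fn k x)) \<le> (cmod (fn h x))\<^sup>2 + (cmod (fn k x))\<^sup>2" for x
      using mult_le_sum_squares[of "cmod (fn h x)" "cmod (fn k x)"] by (simp add: norm_mult)
  qed auto
  then show ?thesis
    unfolding ell2_inner_def
    by (intro complex_eqI)
      (simp_all add: infsum_Re[symmetric] infsum_Im[symmetric] inner_fn inner_complex_eq_Re algebra_simps)
qed

lemma Re_ell2_inner_fn: "Re (ell2_inner G (fn h) (fn k)) = inner h k"
  by (simp add: ell2_inner_fn)

section \<open>Left and right translations\<close>

definition permute :: "('a \<Rightarrow> 'a) \<Rightarrow> nat l2 \<Rightarrow> nat l2" where
  "permute \<pi> h = vec (\<lambda>x. if x \<in> carrier G then fn h (\<pi> x) else 0)"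

context
  fixes \<pi> assumes bij: "bij_betw \<pi> (carrier G) (carrier G)"
begin

lemma fn_permute: "x \<in> carrier G \<Longrightarrow> fn (permute \<pi> h) x = fn h (\<pi> x)"
proof -
  have "(\<lambda>x. (cmod (fn h (\<pi> x)))\<^sup>2) summable_on carrier G"
    using summable_on_reindex_bij_betw[OF bij, of "\<lambda>x. (cmod (fn h x))\<^sup>2"] summable_fn_sq by simp
  then have "(\<lambda>x. if x \<in> carrier G then fn h (\<pi> x) else 0) \<in> ell2 G"
    by (auto simp: ell2_def cong: summable_on_cong)
  then show "x \<in> carrier G \<Longrightarrow> fn (permute \<pi> h) x = fn h (\<pi> x)" by (simp add: permute_def fn_vec)
qed

lemma inner_permute: "inner (permute \<pi> h) (permute \<pi> k) = inner h k"
  unfolding inner_fn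
  by (subst (2) infsum_reindex_bij_betw[OF bij, symmetric]) (simp add: fn_permute cong: infsum_cong)

lemma norm_permute: "norm (permute \<pi> h) = norm h"
  by (simp add: norm_eq_sqrt_inner inner_permute)

lemma bounded_linear_permute: "bounded_linear (permute \<pi>)"
  by (rule bounded_linear_intro[where K=1]; (rule fn_eqI)?; simp add: fn_permute norm_permute)

end

definition rtrans :: "'a \<Rightarrow> nat l2 \<Rightarrow> nat l2" where
  "rtrans y = permute (\<lambda>x. x \<otimes> inv y)"

definition ltrans :: "'a \<Rightarrow> nat l2 \<Rightarrow> nat l2" where
  "ltrans y = permute (\<lambda>x. inv y \<otimes> x)"

lemma bij_rtrans: "y \<in> carrier G \<Longrightarrow> bij_betw (\<lambda>x. x \<otimes> inv y) (carrier G) (carrier G)"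
  by (rule bij_betw_byWitness[where f'="\<lambda>x. x \<otimes> y"]) (auto simp: m_assoc)

lemma bij_ltrans: "y \<in> carrier G \<Longrightarrow> bij_betw (\<lambda>x. inv y \<otimes> x) (carrier G) (carrier G)"
  by (rule bij_betw_byWitness[where f'="\<lambda>x. y \<otimes> x"]) (auto simp: m_assoc[symmetric])

lemma fn_rtrans: "y \<in> carrier G \<Longrightarrow> x \<in> carrier G \<Longrightarrow> fn (rtrans y h) x = fn h (x \<otimes> inv y)"
  unfolding rtrans_def by (rule fn_permute[OF bij_rtrans])

lemma fn_ltrans: "y \<in> carrier G \<Longrightarrow> x \<in> carrier G \<Longrightarrow> fn (ltrans y h) x = fn h (inv y \<otimes> x)"
  unfolding ltrans_def by (rule fn_permute[OF bij_ltrans])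

lemma rtrans_inverse: "y \<in> carrier G \<Longrightarrow> rtrans y (rtrans (inv y) h) = h"
  by (rule fn_eqI) (simp add: fn_rtrans m_assoc)

lemma inner_rtrans:
  assumes y: "y \<in> carrier G"
  shows "inner (rtrans y h) k = inner h (rtrans (inv y) k)"
  using inner_permute[OF bij_rtrans[OF y], of h "rtrans (inv y) k"] rtrans_inverse[OF y]
  by (simp add: rtrans_def)

lemma norm_rtrans: "y \<in> carrier G \<Longrightarrow> norm (rtrans y h) = norm h"
  unfolding rtrans_def by (rule norm_permute[OF bij_rtrans])

lemma bounded_linear_rtrans: "y \<in> carrier G \<Longrightarrow> bounded_linear (rtrans y)"
  unfolding rtrans_def by (rule bounded_linear_permute[OF bij_rtrans])

section \<open>The Markov operator, the Laplacian and their symmetries\<close>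

lemma has_sum_mu: "(pmf \<mu> has_sum 1) (carrier G)"
  by (rule has_sum_pmf[OF supp])

text \<open>A series of vectors rather than a pointwise formula: it converges absolutely in norm
  because translations are isometries, and every bounded linear map passes through it.\<close>

definition markov :: "nat l2 \<Rightarrow> nat l2" where
  "markov h = (\<Sum>\<^sub>\<infinity>y\<in>carrier G. pmf \<mu> y *\<^sub>R rtrans y h)"

definition lap :: "nat l2 \<Rightarrow> nat l2" where
  "lap h = h - markov h"

lemma has_sum_norm_markov: "((\<lambda>y. norm (pmf \<mu> y *\<^sub>R rtrans y h)) has_sum norm h) (carrier G)"
proof -
  have "((\<lambda>y. pmf \<mu> y * norm h) has_sum norm h) (carrier G)"
    using has_sum_cmult_left[OF has_sum_mu, of "norm h"] by simp
  then show ?thesis by (rule has_sum_cong_imp) (simp add: norm_rtrans)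
qed

lemma has_sum_markov: "((\<lambda>y. pmf \<mu> y *\<^sub>R rtrans y h) has_sum markov h) (carrier G)"
  unfolding markov_def
  by (rule has_sum_infsum[OF abs_summable_summable[OF has_sum_imp_summable[OF has_sum_norm_markov]]])

lemma norm_markov_le: "norm (markov h) \<le> norm h"
  using norm_infsum_bound[OF has_sum_imp_summable[OF has_sum_norm_markov[of h]]] infsumI[OF has_sum_norm_markov]
  unfolding markov_def by simp

lemma markov_commute:
  assumes T: "bounded_linear T" "\<And>y h. y \<in> carrier G \<Longrightarrow> T (rtrans y h) = rtrans y (T h)"
  shows "T (markov h) = markov (T h)"
proof -
  have "((\<lambda>y. T (pmf \<mu> y *\<^sub>R rtrans y h)) has_sum T (markov h)) (carrier G)"
    using has_sum_bounded_linear[OF T(1) has_sum_markov] by (simp add: o_def)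
  then have "((\<lambda>y. pmf \<mu> y *\<^sub>R rtrans y (T h)) has_sum T (markov h)) (carrier G)"
    by (rule has_sum_cong_imp) (simp add: linear_scale[OF bounded_linear.linear[OF T(1)]] T(2))
  then show ?thesis using has_sum_markov has_sum_unique by blast
qed

lemma bounded_linear_markov: "bounded_linear markov"
proof (rule bounded_linear_intro[where K=1])
  show "markov (h + k) = markov h + markov k" for h k
  proof (rule has_sum_unique[OF has_sum_markov])
    show "((\<lambda>y. pmf \<mu> y *\<^sub>R rtrans y (h + k)) has_sum markov h + markov k) (carrier G)"
      using has_sum_add[OF has_sum_markov[of h] has_sum_markov[of k]]
      by (rule has_sum_cong_imp)
        (simp add: scaleR_add_right linear_add[OF bounded_linear.linear[OF bounded_linear_rtrans]])
  qed
  show "markov (r *\<^sub>R h) = r *\<^sub>R markov h" for r h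
    by (rule markov_commute[symmetric, OF bounded_linear_scaleR_right])
      (simp add: linear_scale[OF bounded_linear.linear[OF bounded_linear_rtrans]])
qed (simp add: norm_markov_le)

lemma has_sum_inner_markov: "((\<lambda>y. pmf \<mu> y * inner (rtrans y h) k) has_sum inner (markov h) k) (carrier G)"
  using has_sum_bounded_linear[OF bounded_linear_inner_left[of k] has_sum_markov[of h]] by (simp add: o_def)

text \<open>The adjoint of \<open>rtrans y\<close> is \<open>rtrans (inv y)\<close>; reindexing by
  inversion and the symmetry of \<open>\<mu>\<close> restore the original sum.\<close>

lemma self_adjoint_markov: "inner (markov h) k = inner h (markov k)"
proof (rule has_sum_unique)
  show "((\<lambda>y. pmf \<mu> y * inner (rtrans y h) k) has_sum inner (markov h) k) (carrier G)"
    by (rule has_sum_inner_markov)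
  have "((\<lambda>y. pmf \<mu> (inv y) * inner (rtrans (inv y) k) h) has_sum inner (markov k) h) (carrier G)"
  proof (subst has_sum_reindex_bij_betw[of "m_inv G" "carrier G" "carrier G" "\<lambda>y. pmf \<mu> y * inner (rtrans y k) h"])
    show "bij_betw (m_inv G) (carrier G) (carrier G)"
      by (rule bij_betw_byWitness[where f'="m_inv G"]) auto
  qed (rule has_sum_inner_markov)
  then have "((\<lambda>y. pmf \<mu> y * inner (rtrans y h) k) has_sum inner (markov k) h) (carrier G)"
  proof (rule has_sum_cong_imp)
    fix y assume y: "y \<in> carrier G"
    show "pmf \<mu> (inv y) * inner (rtrans (inv y) k) h = pmf \<mu> y * inner (rtrans y h) k"
      unfolding symm[OF y] inner_rtrans[OF y, of h k] by (simp only: inner_commute)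
  qed
  then show "((\<lambda>y. pmf \<mu> y * inner (rtrans y h) k) has_sum inner h (markov k)) (carrier G)"
    by (simp only: inner_commute[of h])
qed

lemma self_adjoint_lap: "self_adjoint lap"
  unfolding self_adjoint_def lap_def
  by (auto simp: inner_simps self_adjoint_markov intro!: bounded_linear_sub bounded_linear_ident bounded_linear_markov)

text \<open>Energy as half the mean square of the increments. This shows positivity at once, and
  also that contractions applied to the values of a function do not increase its energy.\<close>

lemma dirichlet_form: "((\<lambda>y. pmf \<mu> y * (norm (h - rtrans y h))\<^sup>2 / 2) has_sum inner (lap h) h) (carrier G)"
proof -
  have "((\<lambda>y. pmf \<mu> y * (norm h)\<^sup>2 - pmf \<mu> y * inner (rtrans y h) h) has_sum 1 * (norm h)\<^sup>2 - inner (markov h) h) (carrier G)"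
    by (intro has_sum_minus has_sum_cmult_left has_sum_mu has_sum_inner_markov)
  then have sum: "((\<lambda>y. pmf \<mu> y * (norm h)\<^sup>2 - pmf \<mu> y * inner (rtrans y h) h) has_sum inner (lap h) h) (carrier G)"
    by (simp add: lap_def inner_diff_left power2_norm_eq_inner)
  have "pmf \<mu> y * (norm h)\<^sup>2 - pmf \<mu> y * inner (rtrans y h) h = pmf \<mu> y * (norm (h - rtrans y h))\<^sup>2 / 2"
    if "y \<in> carrier G" for y
  proof -
    have "(norm (h - rtrans y h))\<^sup>2 = (norm h)\<^sup>2 - 2 * inner (rtrans y h) h + (norm (rtrans y h))\<^sup>2"
      unfolding power2_norm_eq_inner by (simp add: inner_simps inner_commute)
    then have "(norm h)\<^sup>2 - inner (rtrans y h) h = (norm (h - rtrans y h))\<^sup>2 / 2"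
      using that by (simp add: norm_rtrans)
    then show ?thesis by (simp add: right_diff_distrib[symmetric])
  qed
  with sum show ?thesis by (rule has_sum_cong_imp)
qed

sublocale positive_operator lap
proof
  show "0 \<le> inner (lap h) h" for h by (rule has_sum_nonneg[OF dirichlet_form]) simp
qed (rule self_adjoint_lap)

lemma fn_markov: "x \<in> carrier G \<Longrightarrow> ((\<lambda>y. of_real (pmf \<mu> y) * fn h (x \<otimes> inv y)) has_sum fn (markov h) x) (carrier G)"
  using has_sum_bounded_linear[OF bounded_linear_fn[of x] has_sum_markov[of h]]
  by (rule has_sum_cong_imp) (simp add: fn_rtrans)

lemma fn_lap: "fn (lap h) = laplace_operator G \<mu> (fn h)"
proof
  fix x
  show "fn (lap h) x = laplace_operator G \<mu> (fn h) x"
  proof (cases "x \<in> carrier G")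
    case True
    then have "fn (markov h) x = markov_operator G \<mu> (fn h) x"
      using infsumI[OF fn_markov[OF True, of h]] by (simp add: markov_operator_def mult.commute)
    then show ?thesis by (simp add: lap_def laplace_operator_def)
  next
    case False
    then show ?thesis by (simp add: laplace_operator_def markov_operator_def fn_outside)
  qed
qed

lemma lap_commute:
  assumes T: "bounded_linear T" "\<And>y h. y \<in> carrier G \<Longrightarrow> T (rtrans y h) = rtrans y (T h)"
  shows "T (lap h) = lap (T h)"
  using markov_commute[OF T] by (simp add: lap_def linear_diff[OF bounded_linear.linear[OF T(1)]])

lemma cscale_lap: "cmod u = 1 \<Longrightarrow> cscale u (lap h) = lap (cscale u h)"
  by (rule lap_commute[OF bounded_linear_cscale_unit]) (auto intro!: fn_eqI simp: fn_rtrans)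

lemma ltrans_lap: "y \<in> carrier G \<Longrightarrow> ltrans y (lap h) = lap (ltrans y h)"
  unfolding ltrans_def
  by (rule lap_commute[OF bounded_linear_permute[OF bij_ltrans]])
    (auto intro!: fn_eqI simp: fn_rtrans fn_permute[OF bij_ltrans] m_assoc)

lemma low_proj_cscale:
  assumes "cmod u = 1"
  shows "low_proj l (cscale u h) = cscale u (low_proj l h)"
  by (rule low_proj_isometry)
    (use assms in \<open>auto simp: bounded_linear_cscale_unit inner_cscale_unit surj_cscale_unit cscale_lap\<close>)

lemma low_proj_ltrans:
  assumes y: "y \<in> carrier G"
  shows "low_proj l (ltrans y h) = ltrans y (low_proj l h)"
proof (rule low_proj_isometry)
  show "surj (ltrans y)"
  proof (rule surjI)
    show "ltrans y (ltrans (inv y) h) = h" for h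
      using y by (intro fn_eqI) (simp add: fn_ltrans m_assoc[symmetric])
  qed
qed (use y in \<open>auto simp: ltrans_lap\<close>, auto simp: ltrans_def bounded_linear_permute bij_ltrans inner_permute)

end

section \<open>Transfer of the spectral theorem to \<open>ell2 G\<close>, and the two bounds' common
  tools\<close>

context symmetric_walk
begin

lemma ell2_ball: "(\<forall>f\<in>ell2 G. P f) \<longleftrightarrow> (\<forall>h. P (fn h))"
  by (metis fn_ell2 fn_vec)

lemma fn_add_fun: "(\<lambda>x. fn h x + fn k x) = fn (h + k)"
  and fn_cscale_fun: "(\<lambda>x. c * fn h x) = fn (cscale c h)"
  and fn_zero_fun: "(\<lambda>x. 0) = fn 0"
  and fn_diff_sum_fun: "(\<lambda>x. fn h x - (\<Sum>i\<in>I. fn (d i) x)) = fn (h - (\<Sum>i\<in>I. d i))"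
  by (auto simp: fn_sum)

lemma fn_inject: "fn h = fn k \<longleftrightarrow> h = k"
  by (metis vec_fn)

text \<open>Write \<open>c\<close> as modulus times phase: the phase is an isometry commuting with
  \<open>lap\<close>, the modulus a real scalar.\<close>

lemma spec_proj_cscale:
  assumes B: "B \<in> sets borel"
  shows "spec_proj B (cscale c h) = cscale c (spec_proj B h)"
proof -
  obtain u where u: "cmod u = 1" "c = of_real (cmod c) * u"
  proof (cases "c = 0")
    case False
    then show ?thesis by (intro that[of "sgn c"]) (simp add: norm_sgn, simp add: sgn_eq)
  qed (use that[of 1] in auto)
  have c: "cscale c k = cmod c *\<^sub>R cscale u k" for k
    by (subst u(2)) (simp add: cscale_cscale[symmetric] cscale_of_real)
  have "spec_proj B (cscale u h) = cscale u (spec_proj B h)"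
    by (rule spec_proj_isometry[OF B])
      (use u in \<open>auto simp: bounded_linear_cscale_unit inner_cscale_unit surj_cscale_unit cscale_lap\<close>)
  then show ?thesis
    by (simp add: c self_adjointD(5)[OF orth_projD(1)[OF spec_proj(1)[OF B]]])
qed

lemma spectral_measure_for_exists:
  "spectral_measure_for G (laplace_operator G \<mu>) (\<lambda>B f. fn (spec_proj B (vec f)))"
proof -
  note sa = orth_projD(1)[OF spec_proj(1)]
  note pm = proj_measure_spec_proj[unfolded proj_measure_def]
  have bdd: "bounded_operator G (\<lambda>f. fn (spec_proj B (vec f)))" if B: "B \<in> sets borel" for B
    unfolding bounded_operator_def ell2_ball fn_add_fun fn_cscale_fun vec_fn ell2_norm_fn fn_inject
    using orth_projD(5)[OF spec_proj(1)[OF B]]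
    by (auto simp: fn_ell2 self_adjointD(3)[OF sa[OF B]] spec_proj_cscale[OF B] intro!: exI[of _ 1])
  have op: "orthogonal_projection G (\<lambda>f. fn (spec_proj B (vec f)))" if B: "B \<in> sets borel" for B
    unfolding orthogonal_projection_def ell2_ball vec_fn ell2_inner_fn
    using bdd[OF B]
    by (simp add: orth_projD(2)[OF spec_proj(1)[OF B]] self_adjointD(2)[OF sa[OF B]] spec_proj_cscale[OF B])
  have pvm: "projection_valued_measure G (\<lambda>B f. fn (spec_proj B (vec f)))"
    unfolding projection_valued_measure_def ell2_ball vec_fn fn_zero_fun fn_inject fn_diff_sum_fun ell2_norm_fn
  proof (intro conjI ballI allI impI)
    show "\<exists>a. \<forall>h. spec_proj {- a<..<a} h = h" "\<And>h. spec_proj {} h = 0"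
      using pm by auto
    show "spec_proj B (spec_proj C h) = spec_proj (B \<inter> C) h" if "B \<in> sets borel" "C \<in> sets borel" for B C h
      using that by (rule spec_proj_Int)
    show "(\<lambda>n. norm (spec_proj (\<Union>i. B i) h - (\<Sum>i<n. spec_proj (B i) h))) \<longlonglongrightarrow> 0"
      if "range B \<subseteq> sets borel" "disjoint_family B" for B :: "nat \<Rightarrow> real set" and h
    proof -
      have "(\<lambda>n. norm (spec_proj (\<Union>i. B i) h - (\<Sum>i<n. spec_proj (B i) h)))
          \<longlonglongrightarrow> norm (spec_proj (\<Union>i. B i) h - spec_proj (\<Union>i. B i) h)"
        by (intro tendsto_intros spec_proj_UN[OF that])
      then show ?thesis by simp
    qed
  qed (rule op)
  have "scalar_spectral_measure G (\<lambda>B f. fn (spec_proj B (vec f))) (fn h) = diagonal_measure spec_proj h" for h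
    by (simp add: scalar_spectral_measure_def diagonal_measure_def Re_ell2_inner_fn)
  \<comment> \<open>The required identity is complex. Its imaginary part vanishes because
    \<open>lap\<close> is symmetric and commutes with the skew operator \<open>\<i>\<close>.\<close>
  moreover have "inner (lap h) (cscale \<i> h) = 0" for h
  proof -
    have "inner (lap h) (cscale \<i> h) = inner h (cscale \<i> (lap h))"
      by (simp add: self_adjointD(2)[OF self_adj] cscale_lap)
    also have "\<dots> = - inner (cscale \<i> h) (lap h)" by (simp add: inner_cscale_i)
    finally show ?thesis by (simp add: inner_commute)
  qed
  ultimately show ?thesis
    unfolding spectral_measure_for_def ell2_ball
    using pvm resolves_spec_proj[unfolded resolves_def]
    by (simp add: fn_lap[symmetric] ell2_inner_fn complex_eq_iff)
qed

text \<open>Valid for an arbitrary witness, hence for the one picked by \<open>SOME\<close> in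
  \<open>spectral_measure\<close>.\<close>

lemma resolves_lap:
  assumes E: "spectral_measure_for G (laplace_operator G \<mu>) E"
  shows "resolves lap (\<lambda>B h. vec (E B (fn h)))"
proof -
  note pvm = E[unfolded spectral_measure_for_def, THEN conjunct1]
  have op: "orthogonal_projection G (E B)" if "B \<in> sets borel" for B
    using pvm that unfolding projection_valued_measure_def by blast
  have mem: "E B (fn h) \<in> ell2 G" if "B \<in> sets borel" for B h
    using op[OF that] fn_ell2 unfolding orthogonal_projection_def bounded_operator_def by blast
  define F where "F = (\<lambda>B h. vec (E B (fn h)))"
  have fnF: "fn (F B h) = E B (fn h)" if "B \<in> sets borel" for B h
    unfolding F_def by (rule fn_vec[OF mem[OF that]])
  have opF: "orth_proj (F B)" if B: "B \<in> sets borel" for B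
  proof -
    note o = op[OF B, unfolded orthogonal_projection_def bounded_operator_def ell2_ball fn_add_fun
        fn_cscale_fun fnF[OF B, symmetric] fn_inject ell2_norm_fn]
    obtain C where C: "\<And>h. norm (F B h) \<le> C * norm h" using o by blast
    have "bounded_linear (F B)"
    proof (rule bounded_linear_intro[where K=C])
      show "F B (h + k) = F B h + F B k" for h k using o by blast
      show "F B (r *\<^sub>R h) = r *\<^sub>R F B h" for r h
        using o cscale_of_real by metis
      show "norm (F B h) \<le> norm h * C" for h using C by (simp add: mult.commute)
    qed
    moreover have "inner (F B h) k = inner h (F B k)" for h k
      using o Re_ell2_inner_fn by metis
    ultimately show ?thesis using o by (simp add: orth_proj_def self_adjoint_def)
  qed
  have "proj_measure F"
    unfolding proj_measure_def
  proof (intro conjI ballI allI impI)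
    show "\<exists>a. \<forall>h. F {- a<..<a} h = h"
      using pvm unfolding projection_valued_measure_def ell2_ball F_def by (metis vec_fn)
    show "F {} h = 0" for h
      using pvm unfolding projection_valued_measure_def ell2_ball F_def by (metis vec_fn fn_zero_fun)
    show "F B (F C h) = F (B \<inter> C) h" if "B \<in> sets borel" "C \<in> sets borel" for B C h
    proof -
      have "E B (E C (fn h)) = E (B \<inter> C) (fn h)"
        using pvm that fn_ell2 unfolding projection_valued_measure_def by blast
      then show ?thesis using fnF[OF that(2)] by (metis F_def)
    qed
    show "(\<lambda>n. \<Sum>i<n. F (B i) h) \<longlonglongrightarrow> F (\<Union>i. B i) h"
      if B: "range B \<subseteq> sets borel" "disjoint_family B" for B :: "nat \<Rightarrow> real set" and h
    proof -
      have Bi: "B i \<in> sets borel" "(\<Union>i. B i) \<in> sets borel" for i using B by auto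
      have "(\<lambda>n. ell2_norm G (\<lambda>x. E (\<Union>i. B i) (fn h) x - (\<Sum>i<n. E (B i) (fn h) x))) \<longlonglongrightarrow> 0"
        using pvm B fn_ell2 unfolding projection_valued_measure_def by blast
      then have "(\<lambda>n. norm (F (\<Union>i. B i) h - (\<Sum>i<n. F (B i) h))) \<longlonglongrightarrow> 0"
        by (simp only: fnF[OF Bi(1), symmetric] fnF[OF Bi(2), symmetric] fn_diff_sum_fun ell2_norm_fn)
      then show ?thesis
        by (simp add: tendsto_iff dist_norm norm_minus_commute)
    qed
  qed (rule opF)
  moreover have "inner (lap h) h = (\<integral>t. t \<partial>diagonal_measure F h)" for h
  proof -
    have "scalar_spectral_measure G E (fn h) = diagonal_measure F h"
      unfolding scalar_spectral_measure_def diagonal_measure_def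
    proof (rule measure_of_eq)
      fix B assume "B \<in> sigma_sets UNIV (sets (borel :: real measure))"
      then have "B \<in> sets borel" using sets.sigma_sets_eq[of "borel :: real measure"] by simp
      then show "ennreal (Re (ell2_inner G (E B (fn h)) (fn h))) = ennreal (inner (F B h) h)"
        using Re_ell2_inner_fn[of "F B h" h] by (simp add: fnF)
    qed simp
    moreover have "ell2_inner G (laplace_operator G \<mu> (fn h)) (fn h)
        = complex_of_real (\<integral>t. t \<partial>scalar_spectral_measure G E (fn h))"
      using E fn_ell2 unfolding spectral_measure_for_def by blast
    ultimately show ?thesis
      using Re_ell2_inner_fn[of "lap h" h] by (simp add: fn_lap)
  qed
  ultimately show ?thesis by (simp add: resolves_def F_def)
qed

definition delta :: "'a \<Rightarrow> nat l2" where
  "delta x = vec (indicator {x})"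

lemma fn_delta: "x \<in> carrier G \<Longrightarrow> fn (delta x) = indicator {x}"
proof -
  assume x: "x \<in> carrier G"
  have "(\<lambda>z. (cmod (indicator {x} z))\<^sup>2) summable_on carrier G"
    by (rule finite_nonzero_values_imp_summable_on) (auto simp: indicator_def)
  then have "indicator {x} \<in> ell2 G"
    using x by (auto simp: ell2_def indicator_eq_0_iff)
  then show ?thesis by (simp add: delta_def fn_vec)
qed

lemma spectral_distribution_eq: "spectral_distribution G \<mu> l = (norm (low_proj l (delta \<one>)))\<^sup>2"
proof -
  define E where "E = spectral_measure G (laplace_operator G \<mu>)"
  have E: "spectral_measure_for G (laplace_operator G \<mu>) E"
    unfolding E_def spectral_measure_def by (rule someI[of "spectral_measure_for G (laplace_operator G \<mu>)", OF spectral_measure_for_exists])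
  have u: "vec (E {..l} (fn h)) = low_proj l h" for h
    using resolves_unique[OF resolves_lap[OF E], of l] by metis
  have "projection_valued_measure G E" using E by (simp add: spectral_measure_for_def)
  then have "orthogonal_projection G (E {..l})"
    unfolding projection_valued_measure_def using atMost_borel[of l] by blast
  then have "E {..l} (fn h) \<in> ell2 G" for h
    using fn_ell2[of h] by (simp add: orthogonal_projection_def bounded_operator_def)
  then have "E {..l} (fn h) = fn (low_proj l h)" for h using u fn_vec by metis
  then have "spectral_distribution G \<mu> l = inner (low_proj l (delta \<one>)) (delta \<one>)"
    unfolding spectral_distribution_def group_trace_def spectral_projection_def E_def[symmetric]
      fn_delta[OF one_closed, symmetric]
    by (simp add: Re_ell2_inner_fn)
  then show ?thesis by (simp add: orth_projD(3)[OF low_proj_orth_proj])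
qed

text \<open>Left translations carry \<open>delta \<one>\<close> to every \<open>delta x\<close> and
  commute with the projection, so all diagonal entries of the projection agree with the
  trace.\<close>

lemma norm_low_proj_delta:
  assumes x: "x \<in> carrier G"
  shows "(norm (low_proj l (delta x)))\<^sup>2 = spectral_distribution G \<mu> l"
proof -
  have "delta x = ltrans x (delta \<one>)"
  proof (rule fn_eqI)
    fix z assume z: "z \<in> carrier G"
    have "inv x \<otimes> z = \<one> \<longleftrightarrow> z = x"
      using x z by (metis inv_closed inv_inv inv_equality l_inv)
    then show "fn (delta x) z = fn (ltrans x (delta \<one>)) z"
      using x z by (simp add: fn_ltrans fn_delta indicator_def)
  qed
  then show ?thesis
    using x by (simp add: low_proj_ltrans spectral_distribution_eq)
      (simp add: ltrans_def norm_permute bij_ltrans)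
qed

lemma lambda1_eq:
  "lambda1 G \<mu> \<Omega> = Inf {inner (lap h) h / (norm h)\<^sup>2 | h. h \<noteq> 0 \<and> {x. fn h x \<noteq> 0} \<subseteq> \<Omega>}"
proof -
  have *: "{\<Phi> f | f. f \<in> ell2 G \<and> Q f} = {\<Phi> (fn h) | h. Q (fn h)}" for \<Phi> :: "('a \<Rightarrow> complex) \<Rightarrow> real" and Q
  proof safe
    show "\<exists>h. \<Phi> f = \<Phi> (fn h) \<and> Q (fn h)" if "f \<in> ell2 G" "Q f" for f
      using that by (intro exI[of _ "vec f"]) (simp add: fn_vec)
  qed (use fn_ell2 in blast)
  have "{x. fn h x \<noteq> 0} \<noteq> {} \<longleftrightarrow> h \<noteq> 0" for h
    using fn_eqI[of h 0] by auto
  then show ?thesis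
    by (simp only: lambda1_def * fn_lap[symmetric] Re_ell2_inner_fn ell2_norm_fn)
qed

lemma lambda1_le:
  assumes "h \<noteq> 0" "{x. fn h x \<noteq> 0} \<subseteq> \<Omega>"
  shows "lambda1 G \<mu> \<Omega> \<le> inner (lap h) h / (norm h)\<^sup>2"
  unfolding lambda1_eq using assms
  by (intro cInf_lower) (auto intro!: bdd_belowI[of _ 0] simp: pos)

lemma rayleigh_nonempty:
  assumes "\<Omega> \<noteq> {}" "\<Omega> \<subseteq> carrier G"
  shows "{inner (lap h) h / (norm h)\<^sup>2 | h. h \<noteq> 0 \<and> {x. fn h x \<noteq> 0} \<subseteq> \<Omega>} \<noteq> {}"
proof -
  obtain x where x: "x \<in> \<Omega>" using assms by blast
  then have "fn (delta x) = indicator {x}" using assms by (intro fn_delta) auto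
  then have "fn (delta x) x = 1" "{z. fn (delta x) z \<noteq> 0} \<subseteq> \<Omega>"
    using x by (auto simp: indicator_def split: if_splits)
  moreover from this have "delta x \<noteq> 0" using fn_simps(1)[of x] by auto
  ultimately show ?thesis by blast
qed

lemma isoperimetric_profile_le:
  assumes "finite \<Omega>" "\<Omega> \<subseteq> carrier G" "1 \<le> card \<Omega>" "real (card \<Omega>) \<le> v"
    and h: "h \<noteq> 0" "{x. fn h x \<noteq> 0} \<subseteq> \<Omega>"
  shows "isoperimetric_profile G \<mu> v \<le> inner (lap h) h / (norm h)\<^sup>2"
proof -
  have "0 \<le> lambda1 G \<mu> \<Omega>'" if "\<Omega>' \<subseteq> carrier G" "1 \<le> card \<Omega>'" for \<Omega>'
    unfolding lambda1_eq using that
    by (intro cInf_greatest[OF rayleigh_nonempty]) (auto simp: pos)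
  then have "isoperimetric_profile G \<mu> v \<le> lambda1 G \<mu> \<Omega>"
    unfolding isoperimetric_profile_def using assms
    by (intro cInf_lower) (auto intro!: bdd_belowI[of _ 0])
  also have "\<dots> \<le> inner (lap h) h / (norm h)\<^sup>2" by (rule lambda1_le[OF h])
  finally show ?thesis .
qed

text \<open>The hypothesis is strict because neither of the two nested infima need be attained;
  \<open>1 \<le> v\<close> makes \<open>{\<one>}\<close> an admissible set.\<close>

lemma isoperimetric_profile_lessD:
  assumes v: "1 \<le> v" and less: "isoperimetric_profile G \<mu> v < l"
  obtains \<Omega> h where "finite \<Omega>" "\<Omega> \<subseteq> carrier G" "real (card \<Omega>) \<le> v" "h \<noteq> 0"
    "{x. fn h x \<noteq> 0} \<subseteq> \<Omega>" "inner (lap h) h < l * (norm h)\<^sup>2"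
proof -
  let ?S = "{lambda1 G \<mu> \<Omega> | \<Omega>. finite \<Omega> \<and> \<Omega> \<subseteq> carrier G \<and> 1 \<le> card \<Omega> \<and> real (card \<Omega>) \<le> v}"
  have "lambda1 G \<mu> {\<one>} \<in> ?S" using v by (auto intro!: exI[of _ "{\<one>}"])
  then have "?S \<noteq> {}" by blast
  from cInf_lessD[OF this less[unfolded isoperimetric_profile_def]] obtain \<Omega> where
    \<Omega>: "finite \<Omega>" "\<Omega> \<subseteq> carrier G" "1 \<le> card \<Omega>" "real (card \<Omega>) \<le> v" "lambda1 G \<mu> \<Omega> < l"
    by auto
  then have "\<Omega> \<noteq> {}" by auto
  from cInf_lessD[OF rayleigh_nonempty[OF this \<Omega>(2)] \<Omega>(5)[unfolded lambda1_eq]] obtain h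
    where h: "h \<noteq> 0" "{x. fn h x \<noteq> 0} \<subseteq> \<Omega>" "inner (lap h) h / (norm h)\<^sup>2 < l"
    by auto
  then have "inner (lap h) h < l * (norm h)\<^sup>2" by (simp add: pos_divide_less_eq)
  then show ?thesis using that \<Omega> h by blast
qed

text \<open>A Chebyshev argument: the part \<open>g\<close> of \<open>h\<close> above
  \<open>2 l\<close> has energy at least \<open>2 l (norm g)^2\<close>, but at most the energy of
  \<open>h\<close>, because the low space is invariant and cross terms vanish. So \<open>g\<close>
  carries at most half of the mass.\<close>

lemma spectral_distribution_lower:
  assumes \<Omega>: "finite \<Omega>" "\<Omega> \<subseteq> carrier G" and l: "0 < l"
    and h: "h \<noteq> 0" "{x. fn h x \<noteq> 0} \<subseteq> \<Omega>" "inner (lap h) h \<le> l * (norm h)\<^sup>2"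
  shows "1 \<le> 2 * real (card \<Omega>) * spectral_distribution G \<mu> (2 * l)"
proof -
  define P where "P = low_proj (2 * l)"
  have P: "orth_proj P" unfolding P_def by (rule low_proj_orth_proj)
  define g where "g = h - P h"
  let ?N = "spectral_distribution G \<mu> (2 * l)"
  have g: "inner g m = 0" if "m \<in> low_space (2 * l)" for m
    unfolding g_def P_def using low_proj_orth[OF that] .
  have "inner g (lap (P h)) = 0" by (rule g) (simp add: P_def low_space_invariant low_proj_mem)
  then have z: "inner (lap g) (P h) = 0" "inner (lap (P h)) g = 0"
    using self_adjointD(2)[OF self_adj, of g "P h"] inner_commute[of g "lap (P h)"] by simp_all
  have "h = P h + g" by (simp add: g_def)
  then have "inner (lap h) h = inner (lap (P h)) (P h) + inner (lap (P h)) g + inner (lap g) (P h) + inner (lap g) g"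
    by (metis (no_types, lifting) A_simps(1) inner_add_left inner_add_right add.assoc)
  then have "inner (lap g) g \<le> l * (norm h)\<^sup>2" using z h(3) pos[of "P h"] by linarith
  moreover have "2 * l * (norm g)\<^sup>2 \<le> inner (lap g) g" by (rule low_space_orth_ge[OF g])
  ultimately have "l * (2 * (norm g)\<^sup>2) \<le> l * (norm h)\<^sup>2" by simp
  then have "2 * (norm g)\<^sup>2 \<le> (norm h)\<^sup>2" using l by (simp only: mult_le_cancel_left_pos)
  then have half: "(norm h)\<^sup>2 \<le> 2 * (norm (P h))\<^sup>2"
    using orth_projD(4)[OF P, of h] by (simp add: g_def)
  have N: "sqrt ?N = norm (P (delta x))" if "x \<in> carrier G" for x
    using norm_low_proj_delta[OF that, of "2 * l"] by (simp add: P_def real_sqrt_unique)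
  have N0: "0 \<le> ?N" by (simp add: spectral_distribution_eq)
  \<comment> \<open>After expansion into point masses, each term has projected norm
    \<open>cmod (fn h x) * sqrt ?N\<close>. The triangle inequality followed by Cauchy-Schwarz over
    \<open>\<Omega>\<close> produces the factor \<open>card \<Omega>\<close>.\<close>
  have comp: "h = (\<Sum>x\<in>\<Omega>. cscale (fn h x) (delta x))"
  proof (rule fn_eqI)
    fix z assume "z \<in> carrier G"
    have "fn (\<Sum>x\<in>\<Omega>. cscale (fn h x) (delta x)) z = (\<Sum>x\<in>\<Omega>. if x = z then fn h x else 0)"
      unfolding fn_sum using \<Omega> by (intro sum.cong) (auto simp: fn_delta indicator_def)
    then show "fn h z = fn (\<Sum>x\<in>\<Omega>. cscale (fn h x) (delta x)) z"
      using \<Omega> h(2) by auto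
  qed
  have norm_term: "norm (P (cscale c (delta x))) = cmod c * sqrt ?N" if x: "x \<in> carrier G" for c x
  proof (cases "c = 0")
    case True
    then have "cscale c (delta x) = 0" by (intro fn_eqI) simp
    then show ?thesis using True by (simp add: self_adjointD[OF orth_projD(1)[OF P]])
  next
    case False
    define u where "u = sgn c"
    have u: "cmod u = 1" using False by (simp add: u_def norm_sgn)
    have "c = of_real (cmod c) * u" using False by (simp add: u_def sgn_eq)
    then have "cscale c (delta x) = cmod c *\<^sub>R cscale u (delta x)"
      by (metis cscale_cscale cscale_of_real)
    then have "norm (P (cscale c (delta x))) = cmod c * norm (cscale u (P (delta x)))"
      by (simp add: self_adjointD[OF orth_projD(1)[OF P]]) (simp add: P_def low_proj_cscale[OF u])
    also have "norm (cscale u (P (delta x))) = norm (P (delta x))"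
      by (simp add: norm_eq_sqrt_inner inner_cscale_unit[OF u])
    finally show ?thesis using N[OF x] by simp
  qed
  have "norm (P h) = norm (\<Sum>x\<in>\<Omega>. P (cscale (fn h x) (delta x)))"
    by (subst comp) (simp add: linear_sum[OF bounded_linear.linear[OF self_adjointD(1)[OF orth_projD(1)[OF P]]]])
  also have "\<dots> \<le> (\<Sum>x\<in>\<Omega>. norm (P (cscale (fn h x) (delta x))))" by (rule norm_sum)
  also have "\<dots> = (\<Sum>x\<in>\<Omega>. cmod (fn h x)) * sqrt ?N"
    unfolding sum_distrib_right using \<Omega> by (intro sum.cong norm_term) auto
  finally have "(norm (P h))\<^sup>2 \<le> ((\<Sum>x\<in>\<Omega>. cmod (fn h x)) * sqrt ?N)\<^sup>2"
    by (intro power_mono) auto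
  also have "\<dots> = (\<Sum>x\<in>\<Omega>. cmod (fn h x))\<^sup>2 * ?N" using N0 by (simp add: power_mult_distrib)
  also have "\<dots> \<le> ((\<Sum>x\<in>\<Omega>. (cmod (fn h x))\<^sup>2) * card \<Omega>) * ?N"
    by (intro mult_right_mono sum_squared_le_sum_of_squares N0)
  also have "\<dots> \<le> ((norm h)\<^sup>2 * card \<Omega>) * ?N"
    unfolding norm_sq_fn using \<Omega>
    by (intro mult_right_mono N0 finite_sum_le_infsum summable_fn_sq) auto
  finally have "(norm h)\<^sup>2 * 1 \<le> (norm h)\<^sup>2 * (2 * real (card \<Omega>) * ?N)" using half by simp
  moreover have "0 < (norm h)\<^sup>2" using h(1) by simp
  ultimately show ?thesis by (simp only: mult_le_cancel_left_pos)
qed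

end

section \<open>Lazy walk, truncation, and the upper bound for the spectral distribution\<close>

context symmetric_walk
begin

text \<open>Half of the identity is mixed in because the Markov operator may have spectrum near
  \<open>-1\<close>, where it loses little norm although the energy is large. For the lazy operator
  the loss of squared norm does control the energy.\<close>

definition lazy :: "nat l2 \<Rightarrow> nat l2" where
  "lazy h = h - (1/2) *\<^sub>R lap h"

lemma lazy_markov: "lazy h = (1/2) *\<^sub>R h + (1/2) *\<^sub>R markov h"
  by (simp add: lazy_def lap_def scaleR_diff_right scaleR_left_diff_distrib[symmetric] algebra_simps)
    (simp add: scaleR_add_left[symmetric])

lemma norm_lazy_le: "norm (lazy h) \<le> norm h"
  using norm_triangle_ineq[of "(1/2) *\<^sub>R h" "(1/2) *\<^sub>R markov h"] norm_markov_le[of h]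
  by (simp add: lazy_markov)

text \<open>Contractivity of \<open>1 - lap\<close> means
  \<open>(norm (lap h))^2 \<le> 2 * inner (lap h) h\<close>, so the quadratic term in the expansion
  cancels at most half of the energy.\<close>

lemma lazy_decrement: "inner (lap h) h / 2 \<le> (norm h)\<^sup>2 - (norm (lazy h))\<^sup>2"
proof -
  have "(norm (h - lap h))\<^sup>2 \<le> (norm h)\<^sup>2"
    using norm_markov_le[of h] by (intro power_mono) (simp_all add: lap_def)
  then have "(norm (lap h))\<^sup>2 \<le> 2 * inner (lap h) h"
    unfolding power2_norm_eq_inner by (simp add: inner_simps inner_commute)
  moreover have "(norm (lazy h))\<^sup>2 = (norm h)\<^sup>2 - inner (lap h) h + (norm (lap h))\<^sup>2 / 4"
    unfolding lazy_def power2_norm_eq_inner by (simp add: inner_simps inner_commute)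
  ultimately show ?thesis by linarith
qed

text \<open>\<open>lazy\<close> commutes with \<open>low_proj l\<close>, and on the low space each
  step keeps at least the factor \<open>1 - l / 2\<close> by the reverse triangle inequality;
  \<open>l \<le> 2\<close> keeps this factor nonnegative.\<close>

lemma lazy_power_lower:
  assumes l: "0 \<le> l" "l \<le> 2"
  shows "(1 - l / 2) ^ n * norm (low_proj l h) \<le> norm ((lazy ^^ n) h)"
proof -
  note lin = self_adjointD[OF orth_projD(1)[OF low_proj_orth_proj[of l]]]
  have comm: "low_proj l (lazy k) = lazy (low_proj l k)" for k
    by (simp add: lazy_def lin low_proj_A)
  have commn: "low_proj l ((lazy ^^ n) h) = (lazy ^^ n) (low_proj l h)" for n
    by (rule funpow_commute[of "low_proj l" lazy, OF comm])
  have step: "(1 - l / 2) * norm k \<le> norm (lazy k)" if "k \<in> low_space l" for k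
    using norm_triangle_ineq2[of k "(1/2) *\<^sub>R lap k"] low_spaceD[OF that]
    by (simp add: lazy_def algebra_simps)
  have "(1 - l / 2) ^ n * norm (low_proj l h) \<le> norm ((lazy ^^ n) (low_proj l h))"
  proof (induction n)
    case (Suc n)
    have "(lazy ^^ n) (low_proj l h) \<in> low_space l"
      using commn[of n] low_proj_mem by metis
    from step[OF this] have "(1 - l / 2) * norm ((lazy ^^ n) (low_proj l h)) \<le> norm ((lazy ^^ Suc n) (low_proj l h))"
      by simp
    moreover have "(1 - l / 2) * ((1 - l / 2) ^ n * norm (low_proj l h)) \<le> (1 - l / 2) * norm ((lazy ^^ n) (low_proj l h))"
      using Suc l by (intro mult_left_mono) auto
    ultimately show ?case by (simp add: mult.assoc)
  qed simp
  also have "\<dots> = norm (low_proj l ((lazy ^^ n) h))" by (simp add: commn)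
  also have "\<dots> \<le> norm ((lazy ^^ n) h)" by (rule orth_projD(5)[OF low_proj_orth_proj])
  finally show ?thesis .
qed

text \<open>The mass bound is phrased by finite sums, the form in which averaging, truncation and
  the count of a level set use it.\<close>

definition subprob :: "nat l2 \<Rightarrow> bool" where
  "subprob h \<longleftrightarrow> (\<forall>x\<in>carrier G. Im (fn h x) = 0 \<and> 0 \<le> Re (fn h x)) \<and>
     (\<forall>F. finite F \<longrightarrow> F \<subseteq> carrier G \<longrightarrow> (\<Sum>x\<in>F. Re (fn h x)) \<le> 1)"

lemma subprob_delta: "x \<in> carrier G \<Longrightarrow> subprob (delta x)"
proof -
  assume x: "x \<in> carrier G"
  have "(\<Sum>z\<in>F. Re (indicator {x} z)) \<le> 1" if "finite F" for F
  proof -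
    have "(\<Sum>z\<in>F. Re (indicator {x} z)) = (\<Sum>z\<in>F. if z = x then 1 else 0)"
      by (intro sum.cong) (auto simp: indicator_def)
    then show ?thesis using that by simp
  qed
  then show ?thesis using x by (auto simp: subprob_def fn_delta indicator_def)
qed

text \<open>Coordinates and finite sums of coordinates are bounded real functionals, so they pass
  through the average of translates, each of which satisfies the same constraints.\<close>

lemma subprob_markov:
  assumes h: "subprob h"
  shows "subprob (markov h)"
proof -
  have rt: "subprob (rtrans y h)" if y: "y \<in> carrier G" for y
    unfolding subprob_def
  proof (intro conjI ballI allI impI)
    show "Im (fn (rtrans y h) x) = 0" "0 \<le> Re (fn (rtrans y h) x)" if "x \<in> carrier G" for x
      using h y that by (auto simp: subprob_def fn_rtrans)
    fix F assume F: "finite F" "F \<subseteq> carrier G"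
    have inj: "inj_on (\<lambda>x. x \<otimes> inv y) F"
      using bij_rtrans[OF y] F(2) by (auto simp: bij_betw_def intro: inj_on_subset)
    have "(\<Sum>x\<in>F. Re (fn (rtrans y h) x)) = (\<Sum>x\<in>F. Re (fn h (x \<otimes> inv y)))"
      using F y by (intro sum.cong) (auto simp: fn_rtrans)
    also have "\<dots> = (\<Sum>z\<in>(\<lambda>x. x \<otimes> inv y) ` F. Re (fn h z))"
      using sum.reindex[OF inj, of "\<lambda>z. Re (fn h z)"] by simp
    also have "\<dots> \<le> 1"
    proof -
      have "finite ((\<lambda>x. x \<otimes> inv y) ` F)" "(\<lambda>x. x \<otimes> inv y) ` F \<subseteq> carrier G" using F y by auto
      then show ?thesis using h unfolding subprob_def by blast
    qed
    finally show "(\<Sum>x\<in>F. Re (fn (rtrans y h) x)) \<le> 1" .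
  qed
  have sum: "((\<lambda>y. pmf \<mu> y * \<phi> (rtrans y h)) has_sum \<phi> (markov h)) (carrier G)"
    if "bounded_linear \<phi>" for \<phi> :: "nat l2 \<Rightarrow> real"
    using has_sum_bounded_linear[OF that has_sum_markov[of h]]
    by (rule has_sum_cong_imp) (simp add: linear_scale[OF bounded_linear.linear[OF that]])
  have blRe: "bounded_linear (\<lambda>h. Re (fn h x))" and blIm: "bounded_linear (\<lambda>h. Im (fn h x))" for x
    by (rule bounded_linear_compose[OF bounded_linear_Re bounded_linear_fn],
        rule bounded_linear_compose[OF bounded_linear_Im bounded_linear_fn])
  show ?thesis
    unfolding subprob_def
  proof (intro conjI ballI allI impI)
    fix x assume x: "x \<in> carrier G"
    have "((\<lambda>y. 0) has_sum Im (fn (markov h) x)) (carrier G)"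
      using sum[OF blIm] by (rule has_sum_cong_imp) (use rt x in \<open>auto simp: subprob_def\<close>)
    then show "Im (fn (markov h) x) = 0" using has_sum_unique has_sum_0_simp by metis
    show "0 \<le> Re (fn (markov h) x)"
      using sum[OF blRe] by (rule has_sum_nonneg) (use rt x in \<open>auto simp: subprob_def\<close>)
  next
    fix F assume F: "finite F" "F \<subseteq> carrier G"
    show "(\<Sum>x\<in>F. Re (fn (markov h) x)) \<le> 1"
    proof (rule has_sum_mono[OF sum has_sum_mu])
      show "bounded_linear (\<lambda>h. \<Sum>x\<in>F. Re (fn h x))" by (intro bounded_linear_sum blRe)
      show "pmf \<mu> y * (\<Sum>x\<in>F. Re (fn (rtrans y h) x)) \<le> pmf \<mu> y" if "y \<in> carrier G" for y
        using rt[OF that] F mult_left_mono[of _ 1 "pmf \<mu> y"] by (auto simp: subprob_def)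
    qed
  qed
qed

lemma subprob_lazy:
  assumes h: "subprob h"
  shows "subprob (lazy h)"
proof -
  note m = subprob_markov[OF h]
  show ?thesis
    unfolding subprob_def
  proof (intro conjI ballI allI impI)
    show "Im (fn (lazy h) x) = 0" "0 \<le> Re (fn (lazy h) x)" if "x \<in> carrier G" for x
      using h m that by (auto simp: subprob_def lazy_markov)
    fix F assume F: "finite F" "F \<subseteq> carrier G"
    have "(\<Sum>x\<in>F. Re (fn (lazy h) x)) = (1/2) * (\<Sum>x\<in>F. Re (fn h x)) + (1/2) * (\<Sum>x\<in>F. Re (fn (markov h) x))"
      by (simp add: lazy_markov sum.distrib sum_divide_distrib)
    moreover have "(\<Sum>x\<in>F. Re (fn h x)) \<le> 1" "(\<Sum>x\<in>F. Re (fn (markov h) x)) \<le> 1"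
      using h m F by (auto simp: subprob_def)
    ultimately show "(\<Sum>x\<in>F. Re (fn (lazy h) x)) \<le> 1" by simp
  qed
qed

text \<open>A Nash inequality: truncating \<open>h\<close> from below at a quarter of its squared norm keeps half of that
  norm, does not increase the energy, and leaves a support controlled by the \<open>\<ell>\<^sup>1\<close>-norm.\<close>

lemma isoperimetric_profile_le_subprob:
  assumes h: "subprob h" "h \<noteq> 0" and v: "4 / (norm h)\<^sup>2 \<le> v"
  shows "isoperimetric_profile G \<mu> v \<le> 2 * inner (lap h) h / (norm h)\<^sup>2"
proof -
  \<comment> \<open>Truncation at height \<open>s\<close> costs at most \<open>2 s\<close> times the
    total mass, hence at most \<open>u / 2\<close>.\<close>
  define u s where "u = (norm h)\<^sup>2" and "s = u / 4"
  have u: "0 < u" and s: "0 < s" using h(2) by (auto simp: u_def s_def)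
  define a where "a x = Re (fn h x)" for x
  have a0: "0 \<le> a x" and ha: "fn h x = of_real (a x)" for x
    using h(1) by (cases "x \<in> carrier G"; auto simp: subprob_def a_def fn_outside complex_eq_iff)+
  define g where "g = vec (\<lambda>x. of_real (max 0 (a x - s)))"
  have "(\<lambda>x. complex_of_real (max 0 (a x - s))) \<in> ell2 G"
    by (rule ell2_mono[OF fn_ell2[of h]]) (use s a0 in \<open>auto simp: ha max_def\<close>)
  then have fg: "fn g x = of_real (max 0 (a x - s))" for x unfolding g_def by (simp add: fn_vec)
  define \<Omega> where "\<Omega> = {x \<in> carrier G. s < a x}"
  have supp_g: "{x. fn g x \<noteq> 0} \<subseteq> \<Omega>"
  proof
    fix x assume "x \<in> {x. fn g x \<noteq> 0}"
    then have "s < a x" by (auto simp: fg max_def split: if_splits)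
    moreover from this have "x \<in> carrier G" using s fn_outside[of x h] by (cases "x \<in> carrier G") (auto simp: a_def)
    ultimately show "x \<in> \<Omega>" by (simp add: \<Omega>_def)
  qed
  \<comment> \<open>Markov's inequality for a density of mass at most 1: a level set above
    \<open>s\<close> has at most \<open>1 / s = 4 / u\<close> points.\<close>
  have "card F \<le> nat \<lfloor>1 / s\<rfloor>" if F: "F \<subseteq> \<Omega>" "finite F" for F
  proof -
    have "s * card F = (\<Sum>x\<in>F. s)" by simp
    also have "\<dots> \<le> (\<Sum>x\<in>F. a x)" using F by (intro sum_mono) (auto simp: \<Omega>_def)
    also have "\<dots> \<le> 1" using h(1) F by (auto simp: subprob_def a_def \<Omega>_def)
    finally have "real (card F) \<le> 1 / s" using s by (simp add: field_simps)
    then show ?thesis by (simp add: le_nat_floor)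
  qed
  then have \<Omega>: "finite \<Omega>" "card \<Omega> \<le> nat \<lfloor>1 / s\<rfloor>"
    using finite_if_finite_subsets_card_bdd[of \<Omega> "nat \<lfloor>1 / s\<rfloor>"] by auto
  have card_v: "real (card \<Omega>) \<le> v"
  proof -
    have "real (card \<Omega>) \<le> real (nat \<lfloor>1 / s\<rfloor>)" using \<Omega>(2) by simp
    also have "\<dots> \<le> 1 / s" using s by simp
    also have "\<dots> \<le> v" using v by (simp add: s_def u_def)
    finally show ?thesis .
  qed
  have "u \<le> (norm g)\<^sup>2 + 2 * s"
    unfolding u_def norm_sq_fn[of h]
  proof (rule infsum_le_finite_sums[OF summable_fn_sq])
    fix F assume F: "finite F" "F \<subseteq> carrier G"
    have "(cmod (fn h x))\<^sup>2 \<le> (cmod (fn g x))\<^sup>2 + 2 * s * a x" for x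
    proof (cases "a x \<le> s")
      case True
      have "a x * a x \<le> s * a x" using True a0 by (intro mult_right_mono)
      also have "\<dots> \<le> 2 * s * a x" using a0[of x] s by simp
      finally show ?thesis using True by (simp add: ha fg power2_eq_square max_def)
    next
      case False
      have "(a x)\<^sup>2 \<le> (a x - s)\<^sup>2 + 2 * s * a x" by (simp add: power2_diff)
      then show ?thesis using False by (simp add: ha fg max_def del: of_real_diff)
    qed
    then have "(\<Sum>x\<in>F. (cmod (fn h x))\<^sup>2) \<le> (\<Sum>x\<in>F. (cmod (fn g x))\<^sup>2 + 2 * s * a x)"
      by (rule sum_mono)
    also have "\<dots> = (\<Sum>x\<in>F. (cmod (fn g x))\<^sup>2) + 2 * s * (\<Sum>x\<in>F. a x)"
      by (simp add: sum.distrib sum_distrib_left)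
    also have "(\<Sum>x\<in>F. (cmod (fn g x))\<^sup>2) \<le> (norm g)\<^sup>2"
      unfolding norm_sq_fn by (rule finite_sum_le_infsum[OF summable_fn_sq]) (use F in auto)
    also have "2 * s * (\<Sum>x\<in>F. a x) \<le> 2 * s * 1"
      using h(1) F s by (intro mult_left_mono) (auto simp: subprob_def a_def)
    finally show "(\<Sum>x\<in>F. (cmod (fn h x))\<^sup>2) \<le> (norm g)\<^sup>2 + 2 * s" by simp
  qed
  then have g_norm: "u / 2 \<le> (norm g)\<^sup>2" by (simp add: s_def)
  then have g0: "g \<noteq> 0" using u by auto
  have energy: "inner (lap g) g \<le> inner (lap h) h"
  proof (rule has_sum_mono[OF dirichlet_form dirichlet_form])
    fix y assume y: "y \<in> carrier G"
    \<comment> \<open>The map \<open>t \<mapsto> max 0 (t - s)\<close> is 1-Lipschitz, so each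
      increment in the Dirichlet form shrinks.\<close>
    have "norm (g - rtrans y g) \<le> norm (h - rtrans y h)"
    proof (rule norm_le_fn)
      fix x assume x: "x \<in> carrier G"
      have "\<bar>max 0 (a x - s) - max 0 (a (x \<otimes> inv y) - s)\<bar> \<le> \<bar>a x - a (x \<otimes> inv y)\<bar>"
        by (auto simp: max_def)
      then show "cmod (fn (g - rtrans y g) x) \<le> cmod (fn (h - rtrans y h) x)"
        using x y by (simp add: fn_rtrans ha fg of_real_diff[symmetric] del: of_real_diff)
    qed
    then have "(norm (g - rtrans y g))\<^sup>2 \<le> (norm (h - rtrans y h))\<^sup>2" by (intro power_mono) auto
    then show "pmf \<mu> y * (norm (g - rtrans y g))\<^sup>2 / 2 \<le> pmf \<mu> y * (norm (h - rtrans y h))\<^sup>2 / 2"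
      by (intro divide_right_mono mult_left_mono) auto
  qed
  have "\<Omega> \<noteq> {}"
  proof
    assume "\<Omega> = {}"
    then have "fn g x = fn 0 x" for x using supp_g by auto
    then show False using g0 fn_eqI by blast
  qed
  then have "isoperimetric_profile G \<mu> v \<le> inner (lap g) g / (norm g)\<^sup>2"
    using \<Omega>(1) card_v g0 supp_g
    by (intro isoperimetric_profile_le[of \<Omega>]) (auto simp: \<Omega>_def Suc_le_eq card_gt_0_iff)
  also have "\<dots> \<le> inner (lap h) h / (u / 2)"
    using energy g_norm u pos by (intro frac_le) auto
  finally show ?thesis by (simp add: u_def mult.commute)
qed

text \<open>Running the walk for time \<open>ln v / l\<close> instead of \<open>1 / l\<close> avoids a logarithmic loss in the energy.\<close>

lemma isoperimetric_profile_upper: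
  assumes l: "0 < l" "l \<le> 1" and v: "1 \<le> v" and N: "1 / v \<le> spectral_distribution G \<mu> l"
  shows "isoperimetric_profile G \<mu> (4 * exp 4 * v ^ 5) \<le> 6 * l"
proof -
  define f where "f n = (lazy ^^ n) (delta \<one>)" for n
  define a where "a n = (norm (f n))\<^sup>2" for n
  define q where "q = 1 - l / 2"
  have q: "0 < q" "q < 1" using l by (auto simp: q_def)
  have f_Suc: "f (Suc n) = lazy (f n)" for n by (simp add: f_def)
  have sub: "subprob (f n)" for n
    by (induction n) (simp_all add: f_def subprob_delta subprob_lazy)
  have a_Suc: "a (Suc n) \<le> a n" for n
    unfolding a_def f_Suc by (intro power_mono norm_lazy_le) simp
  have a_anti: "a n \<le> a m" if "m \<le> n" for m n using lift_Suc_antimono_le[of a, OF a_Suc that] .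
  have a0: "a 0 = 1"
  proof -
    have "a 0 = (\<Sum>\<^sub>\<infinity>x\<in>carrier G. (cmod (indicator {\<one>} x))\<^sup>2)"
      by (simp add: a_def f_def norm_sq_fn fn_delta)
    also have "\<dots> = (\<Sum>\<^sub>\<infinity>x\<in>{\<one>}. 1)"
      by (rule infsum_cong_neutral) (auto simp: indicator_def)
    finally show ?thesis by simp
  qed
  have a_lower: "q ^ (2 * n) / v \<le> a n" for n
  proof -
    have "(q ^ n * norm (low_proj l (delta \<one>)))\<^sup>2 \<le> a n"
      unfolding a_def f_def q_def using lazy_power_lower[of l n "delta \<one>"] l by (intro power_mono) auto
    then have "q ^ (2 * n) * spectral_distribution G \<mu> l \<le> a n"
      by (simp add: power_mult_distrib spectral_distribution_eq power_even_eq)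
    moreover have "q ^ (2 * n) * (1 / v) \<le> q ^ (2 * n) * spectral_distribution G \<mu> l"
      using N q by (intro mult_left_mono) auto
    ultimately show ?thesis by simp
  qed
  \<comment> \<open>Long enough for \<open>q ^ T \<le> 1 / v\<close>, as
    \<open>q \<le> exp (- l / 2)\<close>. The successor leaves at least one step even for
    \<open>v = 1\<close>.\<close>
  define T where "T = Suc (nat \<lceil>2 * ln v / l\<rceil>)"
  have ln0: "0 \<le> 2 * ln v / l" using v l by simp
  have T1: "2 * ln v / l \<le> real T" and T2: "real T \<le> 2 * ln v / l + 2"
    using ln0 unfolding T_def by linarith+
  have qT: "q ^ T \<le> 1 / v"
  proof -
    have "q \<le> exp (- (l / 2))" using exp_ge_add_one_self[of "- (l / 2)"] by (simp add: q_def)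
    then have "q ^ T \<le> exp (- (l / 2)) ^ T" using q by (intro power_mono) auto
    also have "\<dots> = exp (- (l / 2 * T))" by (simp add: exp_of_nat_mult[symmetric] mult.commute)
    also have "\<dots> \<le> exp (- ln v)" using T1 l by (simp add: field_simps)
    also have "\<dots> = 1 / v" using v by (simp add: exp_minus field_simps)
    finally show ?thesis .
  qed
  \<comment> \<open>If every step before \<open>T\<close> lost more than the factor
    \<open>q ^ 3\<close>, then \<open>a T < q ^ (2 * T) * q ^ T \<le> q ^ (2 * T) / v\<close>,
    against \<open>a_lower\<close>. The third power of \<open>q\<close> is the surplus that pays for
    \<open>1 / v\<close>.\<close>
  obtain n where n: "n < T" "q ^ 3 * a n \<le> a (Suc n)"
  proof (rule ccontr)
    assume "\<not> thesis"
    then have less: "a (Suc n) < q ^ 3 * a n" if "n < T" for n using that \<open>\<And>n. \<lbrakk>n < T; q ^ 3 * a n \<le> a (Suc n)\<rbrakk> \<Longrightarrow> thesis\<close> by force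
    have le: "n \<le> T \<Longrightarrow> a n \<le> (q ^ 3) ^ n" for n
    proof (induction n)
      case (Suc n)
      have "q ^ 3 * a n \<le> q ^ 3 * (q ^ 3) ^ n" using Suc q by (intro mult_left_mono) auto
      then show ?case using less[of n] Suc.prems by simp
    qed (simp add: a0)
    obtain K where K: "T = Suc K" by (simp add: T_def)
    have "a T < q ^ 3 * a K" using less[of K] by (simp add: K)
    also have "\<dots> \<le> q ^ 3 * (q ^ 3) ^ K" using le[of K] q by (intro mult_left_mono) (auto simp: K)
    also have "\<dots> = (q ^ 3) ^ T" by (simp add: K)
    also have "\<dots> = q ^ (2 * T) * q ^ T"
      by (simp only: power_mult[symmetric] power_add[symmetric]) (simp add: algebra_simps)
    also have "\<dots> \<le> q ^ (2 * T) * (1 / v)" using q qT by (intro mult_left_mono) auto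
    also have "\<dots> \<le> a T" using a_lower[of T] by simp
    finally show False by simp
  qed
  \<comment> \<open>From \<open>ln q \<ge> - l\<close> and \<open>T \<le> 2 * ln v / l + 2\<close>,
    the factor \<open>q ^ (2 * T)\<close> is at least \<open>exp (- 4) / v ^ 4\<close>;
    \<open>a_lower\<close> contributes one more power of \<open>v\<close>.\<close>
  have "exp (- 4) / v ^ 5 \<le> a T"
  proof -
    have "- l \<le> ln q"
    proof -
      have "- (l / 2) - 2 * (l / 2)\<^sup>2 \<le> ln (1 - l / 2)"
        using l by (intro ln_one_minus_pos_lower_bound) auto
      moreover have "(l / 2)\<^sup>2 * 4 \<le> l" using l by (simp add: power2_eq_square mult_left_le)
      ultimately show ?thesis by (simp add: q_def)
    qed
    have "exp (- 4) / v ^ 4 = exp (- 4 - 4 * ln v)"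
    proof -
      have "exp (4 * ln v) = v ^ 4" using v exp_of_nat_mult[of 4 "ln v"] by simp
      then show ?thesis by (simp add: exp_diff)
    qed
    also have "- 4 - 4 * ln v \<le> real (2 * T) * ln q"
    proof -
      have "real (2 * T) * l \<le> 2 * (2 * ln v / l + 2) * l" using T2 l by (intro mult_right_mono) auto
      also have "\<dots> = 4 * ln v + 4 * l" using l by (simp add: field_simps)
      finally have "real (2 * T) * l \<le> 4 + 4 * ln v" using l by simp
      moreover have "real (2 * T) * (- l) \<le> real (2 * T) * ln q" using \<open>- l \<le> ln q\<close> by (intro mult_left_mono) auto
      ultimately show ?thesis by linarith
    qed
    then have "exp (- 4 - 4 * ln v) \<le> exp (real (2 * T) * ln q)" by simp
    also have "\<dots> = q ^ (2 * T)" using q exp_of_nat_mult[of "2 * T" "ln q"] by simp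
    finally have "exp (- 4) / v ^ 4 / v \<le> q ^ (2 * T) / v" using v by (intro divide_right_mono) auto
    also have "\<dots> \<le> a T" by (rule a_lower)
    finally show ?thesis by (simp add: power_Suc[of v 4, simplified] mult.commute)
  qed
  also have "\<dots> \<le> a n" using n(1) by (intro a_anti) simp
  finally have an: "exp (- 4) / v ^ 5 \<le> a n" .
  then have an0: "0 < a n" using v by (smt (verit) divide_pos_pos exp_gt_zero zero_less_power)
  \<comment> \<open>Bernoulli bounds the relative loss \<open>1 - q ^ 3\<close> by
    \<open>3 * l / 2\<close>. The decrement doubles this, and so does truncation, which makes
    \<open>6 * l\<close>.\<close>
  have "1 + real 3 * (- (l / 2)) \<le> (1 + (- (l / 2))) ^ 3"
    using l by (intro Bernoulli_inequality) auto
  then have q3: "1 - 3 * l / 2 \<le> q ^ 3" by (simp add: q_def)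
  have "inner (lap (f n)) (f n) / 2 \<le> a n - a (Suc n)"
    unfolding a_def f_Suc by (rule lazy_decrement)
  also have "\<dots> \<le> (1 - q ^ 3) * a n" using n(2) by (simp add: left_diff_distrib)
  also have "\<dots> \<le> 3 * l / 2 * a n" using q3 an0 by (intro mult_right_mono) auto
  finally have energy: "inner (lap (f n)) (f n) \<le> 3 * l * a n" by simp
  have "isoperimetric_profile G \<mu> (4 * exp 4 * v ^ 5) \<le> 2 * inner (lap (f n)) (f n) / (norm (f n))\<^sup>2"
  proof (rule isoperimetric_profile_le_subprob[OF sub])
    show "f n \<noteq> 0" using an0 by (auto simp: a_def)
    have "4 / a n \<le> 4 / (exp (- 4) / v ^ 5)"
      using an v by (intro divide_left_mono mult_pos_pos an0) auto
    also have "\<dots> = 4 * exp 4 * v ^ 5" by (simp add: exp_minus field_simps)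
    finally show "4 / (norm (f n))\<^sup>2 \<le> 4 * exp 4 * v ^ 5" by (simp add: a_def)
  qed
  also have "\<dots> \<le> 6 * l" using energy an0 by (simp add: a_def[symmetric] field_simps)
  finally show ?thesis .
qed

lemma spectral_distribution_mono: "l \<le> m \<Longrightarrow> spectral_distribution G \<mu> l \<le> spectral_distribution G \<mu> m"
  using spec_fun_mono[of l m "delta \<one>"] by (simp add: spectral_distribution_eq spec_fun_def)

lemma spectral_distribution_nonneg: "0 \<le> spectral_distribution G \<mu> l"
  by (simp add: spectral_distribution_eq)

end

section \<open>Comparison functions\<close>

text \<open>Exhaustion by sets \<open>W n\<close> closed under products one stage later; inverses
  enter at stage 0 only, since \<open>generate\<close> inverts generators alone.\<close>

lemma countable_generate:
  fixes G (structure)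
  assumes "countable S"
  shows "countable (generate G S)"
proof -
  define W where "W n = ((\<lambda>X. X \<union> (\<lambda>(a, b). a \<otimes> b) ` (X \<times> X)) ^^ n) (insert \<one> (S \<union> m_inv G ` S))" for n
  have W_Suc: "W (Suc n) = W n \<union> (\<lambda>(a, b). a \<otimes> b) ` (W n \<times> W n)" for n
    by (simp add: W_def)
  have mono: "W m \<subseteq> W n" if "m \<le> n" for m n
    using that by (rule lift_Suc_mono_le[rotated]) (auto simp: W_Suc)
  have "countable (W n)" for n
  proof (induction n)
    case 0
    then show ?case using assms by (simp add: W_def)
  next
    case (Suc n)
    then show ?case by (simp add: W_Suc)
  qed
  moreover have "generate G S \<subseteq> (\<Union>n. W n)"
  proof
    fix x assume "x \<in> generate G S"
    then show "x \<in> (\<Union>n. W n)"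
    proof induction
      case (eng x y)
      then obtain m n where "x \<in> W m" "y \<in> W n" by auto
      then have "x \<in> W (max m n)" "y \<in> W (max m n)"
        using mono[of m "max m n"] mono[of n "max m n"] by auto
      then have "x \<otimes> y \<in> W (Suc (max m n))" by (auto simp: W_Suc)
      then show ?case by blast
    qed (auto intro!: exI[of _ 0] simp: W_def)
  qed
  ultimately show ?thesis by (meson countable_UN countable_subset countableI_type)
qed

section \<open>Generalized inverses of decreasing functions and the doubling condition\<close>

context
  fixes L :: "real \<Rightarrow> real"
  assumes L_anti: "antimono_on {0<..} L"
    and L_lim: "(L \<longlongrightarrow> 0) at_top"
begin

lemma L_antiD: "0 < v \<Longrightarrow> v \<le> w \<Longrightarrow> L w \<le> L v"
  using L_anti by (auto simp: monotone_on_def)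

lemma generalized_inverse_le: "0 < v \<Longrightarrow> L v \<le> x \<Longrightarrow> generalized_inverse L x \<le> v"
  unfolding generalized_inverse_def by (rule cInf_lower) (auto intro!: bdd_belowI[of _ 0])

lemma generalized_inverse_nonempty:
  assumes "0 < x"
  shows "{v. 0 < v \<and> L v \<le> x} \<noteq> {}"
proof -
  have "eventually (\<lambda>v. L v < x) at_top" using order_tendstoD(2)[OF L_lim assms] .
  then have "eventually (\<lambda>v. L v < x \<and> 0 < v) at_top"
    using eventually_gt_at_top[of 0] by eventually_elim simp
  from eventually_happens'[OF trivial_limit_at_top_linorder this]
  obtain v where "L v < x" "0 < v" by blast
  then have "v \<in> {v. 0 < v \<and> L v \<le> x}" by simp
  then show ?thesis by blast
qed

lemma le_generalized_inverse:
  assumes "0 < x" "0 < v" "x < L v"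
  shows "v \<le> generalized_inverse L x"
  unfolding generalized_inverse_def
proof (rule cInf_greatest[OF generalized_inverse_nonempty[OF assms(1)]])
  show "v \<le> w" if "w \<in> {v. 0 < v \<and> L v \<le> x}" for w
    using that assms L_antiD[of w v] by fastforce
qed

text \<open>Strictness matters: where \<open>L\<close> jumps, the infimum defining the inverse need
  not be attained.\<close>

lemma L_le_of_generalized_inverse_less:
  assumes "0 < x" "generalized_inverse L x < y"
  shows "L y \<le> x"
proof -
  obtain v where "0 < v" "L v \<le> x" "v < y"
    using cInf_lessD[OF generalized_inverse_nonempty[OF assms(1)]] assms(2)
    unfolding generalized_inverse_def by auto
  then show ?thesis using L_antiD[of v y] by simp
qed

text \<open>Under \<open>v = exp x\<close>, doubling \<open>x\<close> is squaring
  \<open>v\<close>.\<close>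

lemma doubling_square:
  assumes "doubling_near_infinity (L \<circ> exp)"
  obtains c V where "0 < c" "1 \<le> V" "\<And>v. V \<le> v \<Longrightarrow> c * L v \<le> L (v\<^sup>2)"
proof -
  obtain c X where c: "0 < c" and X: "\<And>x. X \<le> x \<Longrightarrow> c * L (exp x) \<le> L (exp (2 * x))"
    using assms unfolding doubling_near_infinity_def eventually_at_top_linorder by auto
  have "c * L v \<le> L (v\<^sup>2)" if "max 1 (exp X) \<le> v" for v
  proof -
    have v: "0 < v" using that by simp
    moreover have "X \<le> ln v" using that v by (simp add: ln_ge_iff)
    ultimately show ?thesis
      using X[of "ln v"] exp_double[of "ln v"] by simp
  qed
  then show ?thesis using that[OF c, of "max 1 (exp X)"] by simp
qed

end

theorem theorem1p4:
  fixes G :: "('g, 'b) monoid_scheme" and \<mu> :: "'g pmf" and L :: "real \<Rightarrow> real"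
  assumes "group G"
    and "infinite (carrier G)"
    and "finitely_generated_group G"
    and "amenable_group G"
    and "admissible_measure G \<mu>"
    and "\<And>v. 0 < v \<Longrightarrow> 0 < L v"
    and "antimono_on {0<..} L"
    and "(L \<longlongrightarrow> 0) at_top"
    and "doubling_near_infinity (L \<circ> exp)"
  shows "(preceq_near_infinity L (isoperimetric_profile G \<mu>) \<longrightarrow>
            dil_preceq_near_zero (spectral_distribution G \<mu>) (recip_generalized_inverse L)) \<and>
         (preceq_near_infinity (isoperimetric_profile G \<mu>) L \<longrightarrow>
            dil_preceq_near_zero (recip_generalized_inverse L) (spectral_distribution G \<mu>))"
proof -
  obtain S where "finite S" "generate G S = carrier G"
    using assms(3) unfolding finitely_generated_group_def finite_generating_set_def by blast
  then have countable: "countable (carrier G)" using countable_generate[OF countable_finite, of S G] by simp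
  have supp: "set_pmf \<mu> \<subseteq> carrier G" and symm: "\<forall>x\<in>carrier G. pmf \<mu> x = pmf \<mu> (inv\<^bsub>G\<^esub> x)"
    using assms(5) unfolding admissible_measure_def by blast+
  interpret symmetric_walk G \<mu>
    by (intro symmetric_walk.intro symmetric_walk_axioms.intro assms(1,2) countable supp)
      (rule symm[rule_format, symmetric])
  note L_pos = assms(6) and L = assms(7,8)
  note anti = L_antiD[OF L]
  let ?N = "spectral_distribution G \<mu>" and ?\<Lambda> = "isoperimetric_profile G \<mu>"
  let ?inv = "generalized_inverse L"
  obtain c V where c: "0 < c" and V: "1 \<le> V" and dbl: "\<And>v. V \<le> v \<Longrightarrow> c * L v \<le> L (v\<^sup>2)"
    using doubling_square[OF L assms(9)] by blast
  have "dil_preceq_near_zero ?N (recip_generalized_inverse L)" if "preceq_near_infinity L ?\<Lambda>"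
  proof -
    obtain C D x0 where C: "0 < C" and D: "0 < D" and x0: "0 < x0"
      and le: "\<And>x. x0 \<le> x \<Longrightarrow> L x \<le> C * ?\<Lambda> (D * x)"
      using \<open>preceq_near_infinity L ?\<Lambda>\<close> unfolding preceq_near_infinity_def by blast
    \<comment> \<open>The 6 and \<open>C\<close> come from the profile bound and the comparison,
      \<open>c ^ 3\<close> from the three squarings between \<open>v\<close> and
      \<open>v ^ 8\<close>.\<close>
    define K where "K = 6 * C / c ^ 3"
    have K: "0 < K" using C c by (simp add: K_def)
    \<comment> \<open>The entries serve, in order, the squaring estimate, \<open>x0 \<le> y\<close>,
      and the inclusion of the constant of \<open>y\<close> in one factor \<open>v\<close>, so that
      \<open>y \<le> v ^ 6 \<le> v ^ 8\<close>.\<close>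
    define v0 where "v0 = Max {V, x0 * D, 4 * exp 4 / D}"
    have v0: "V \<le> v0" "x0 * D \<le> v0" "4 * exp 4 / D \<le> v0" by (auto simp: v0_def)
    have key: "L v \<le> K * l" if v: "v0 \<le> v" and l: "0 < l" "l \<le> 1" and N: "1 / v \<le> ?N l" for v l
    proof -
      have v1: "1 \<le> v" "V \<le> v" using v v0 V by auto
      \<comment> \<open>Chosen so that \<open>D * y\<close> is the volume at which the profile is
        bounded.\<close>
      define y where "y = 4 * exp 4 * v ^ 5 / D"
      have "v * 1 \<le> (4 * exp 4) * v ^ 5"
      proof -
        have "1 * v \<le> (4 * exp 4) * v" using v1 exp_ge_add_one_self[of "4::real"] by (intro mult_right_mono) auto
        also have "\<dots> \<le> (4 * exp 4) * v ^ 5" using v1 power_increasing[of 1 5 v] by (intro mult_left_mono) auto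
        finally show ?thesis by simp
      qed
      then have "x0 * D \<le> 4 * exp 4 * v ^ 5" using v v0 by simp
      then have "x0 \<le> y" using D by (simp add: y_def pos_le_divide_eq)
      then have "L y \<le> C * ?\<Lambda> (D * y)" by (rule le)
      also have "D * y = 4 * exp 4 * v ^ 5" using D by (simp add: y_def)
      also have "C * ?\<Lambda> (4 * exp 4 * v ^ 5) \<le> C * (6 * l)"
        using C isoperimetric_profile_upper[OF l v1(1) N] by (intro mult_left_mono) auto
      finally have Ly: "L y \<le> 6 * C * l" by simp
      have y0: "0 < y" using \<open>x0 \<le> y\<close> x0 by simp
      have "y \<le> v ^ 8"
      proof -
        have "y = (4 * exp 4 / D) * v ^ 5" by (simp add: y_def)
        also have "\<dots> \<le> v * v ^ 5" using v v0 v1 by (intro mult_right_mono) auto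
        also have "\<dots> \<le> v ^ 8" using v1 power_increasing[of 6 8 v] by (simp add: power_Suc[symmetric] del: power_Suc)
        finally show ?thesis .
      qed
      have sq: "V \<le> z\<^sup>2" if "V \<le> z" for z
        using that V power_increasing[of 1 2 z] by simp
      have "c ^ 3 * L v = c * (c * (c * L v))" by (simp add: power3_eq_cube)
      also have "\<dots> \<le> c * (c * L (v\<^sup>2))" using c dbl[OF v1(2)] by (intro mult_left_mono) auto
      also have "\<dots> \<le> c * L ((v\<^sup>2)\<^sup>2)" using c dbl[OF sq[OF v1(2)]] by (intro mult_left_mono) auto
      also have "\<dots> \<le> L (((v\<^sup>2)\<^sup>2)\<^sup>2)" by (intro dbl sq v1)
      also have "\<dots> = L (v ^ 8)" by (simp flip: power_mult)
      also have "\<dots> \<le> L y" by (rule anti[OF y0 \<open>y \<le> v ^ 8\<close>])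
      also note Ly
      finally show ?thesis using c by (simp add: K_def pos_le_divide_eq mult.commute mult.left_commute)
    qed
    have v00: "0 < v0" using v0 V by linarith
    \<comment> \<open>Below \<open>\<epsilon>\<close> one has \<open>l \<le> 1\<close> and
      \<open>K * l < L v0\<close>, hence the inverse at \<open>K * l\<close> is at least
      \<open>v0\<close>, in particular positive.\<close>
    define \<epsilon> where "\<epsilon> = min 1 (L v0 / K)"
    have \<epsilon>: "0 < \<epsilon>" using K L_pos[OF v00] by (simp add: \<epsilon>_def)
    have "?N l \<le> recip_generalized_inverse L (K * l)" if l: "0 \<le> l" "l < \<epsilon>" for l
    proof (cases "l = 0")
      case True
      \<comment> \<open>At \<open>l = 0\<close> the right-hand side is the default value
        \<open>0\<close>, so there must be no mass at zero. Otherwise a fixed \<open>v\<close> would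
        satisfy the hypothesis of \<open>key\<close> for every small \<open>m\<close>, and
        \<open>L v \<le> K * m \<le> L v / 2\<close>.\<close>
      have "?N 0 \<le> 0"
      proof (rule ccontr)
        assume "\<not> ?N 0 \<le> 0"
        then have N0: "0 < ?N 0" by simp
        define v where "v = max v0 (1 / ?N 0)"
        have v: "v0 \<le> v" "1 / ?N 0 \<le> v" "0 < v" using v00 by (auto simp: v_def)
        define m where "m = min 1 (L v / (2 * K))"
        have m: "0 < m" "m \<le> 1" "m \<le> L v / (2 * K)" using K L_pos[OF v(3)] by (auto simp: m_def)
        have "1 / v \<le> ?N 0" using v N0 by (simp add: field_simps)
        also have "\<dots> \<le> ?N m" using m by (intro spectral_distribution_mono) simp
        finally have "L v \<le> K * m" using key v m by blast
        also have "\<dots> \<le> K * (L v / (2 * K))" using m K by (intro mult_left_mono) auto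
        also have "\<dots> = L v / 2" using K by simp
        finally show False using L_pos[OF v(3)] by simp
      qed
      then show ?thesis using True by (simp add: recip_generalized_inverse_def)
    next
      case False
      then have l0: "0 < l" "l \<le> 1" using l by (auto simp: \<epsilon>_def)
      have Kl: "0 < K * l" "K * l < L v0" using l l0 K by (auto simp: \<epsilon>_def field_simps)
      have w: "v0 \<le> ?inv (K * l)" by (rule le_generalized_inverse[OF L Kl(1) v00 Kl(2)])
      then have w0: "0 < ?inv (K * l)" using v00 by simp
      have rw: "recip_generalized_inverse L (K * l) = 1 / ?inv (K * l)"
        using K l0 by (simp add: recip_generalized_inverse_def)
      show ?thesis
      proof (cases "?N l = 0")
        case True
        then show ?thesis using w0 by (simp add: rw)
      next
        case False
        then have N: "0 < ?N l" using spectral_distribution_nonneg[of l] by simp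
        \<comment> \<open>Since \<open>K * l < L v0\<close>, \<open>key\<close> at \<open>v0\<close>
          excludes this; hence \<open>1 / ?N l\<close> is large enough to take the role of
          \<open>v\<close>.\<close>
        have "\<not> 1 / v0 \<le> ?N l" using key[OF order_refl l0] Kl by auto
        then have "v0 \<le> 1 / ?N l" using N v00 by (simp add: field_simps)
        from key[OF this l0] have "L (1 / ?N l) \<le> K * l" by simp
        then have "?inv (K * l) \<le> 1 / ?N l" using N by (intro generalized_inverse_le[OF L]) auto
        then show ?thesis using N w0 by (simp add: rw field_simps)
      qed
    qed
    then show ?thesis unfolding dil_preceq_near_zero_def using K \<epsilon> by blast
  qed
  moreover have "dil_preceq_near_zero (recip_generalized_inverse L) ?N" if "preceq_near_infinity ?\<Lambda> L"
  proof -
    obtain C D x0 where C: "0 < C" and D: "0 < D" and x0: "0 < x0"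
      and le: "\<And>x. x0 \<le> x \<Longrightarrow> ?\<Lambda> x \<le> C * L (D * x)"
      using \<open>preceq_near_infinity ?\<Lambda> L\<close> unfolding preceq_near_infinity_def by blast
    \<comment> \<open>For \<open>w \<ge> v0\<close> the entries give, in order,
      \<open>1 \<le> w / 2\<close>, \<open>x0 \<le> w / 2\<close>, \<open>V \<le> z\<close> and
      \<open>2 * w \<le> z^2\<close>.\<close>
    define v0 where "v0 = Max {2, 2 * x0, 2 * V / D, 8 / D\<^sup>2}"
    have v0: "2 \<le> v0" "2 * x0 \<le> v0" "2 * V / D \<le> v0" "8 / D\<^sup>2 \<le> v0" by (auto simp: v0_def)
    have v00: "0 < v0" using v0 by linarith
    \<comment> \<open>\<open>2 * (C / c) * l\<close> lies strictly above the profile bound, as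
      extracting a near-minimizer demands; the spectral estimate doubles it once more.\<close>
    define K where "K = 4 * (C / c)"
    have K: "0 < K" using C c by (simp add: K_def)
    have "recip_generalized_inverse L l \<le> ?N (K * l)" if l: "0 \<le> l" "l < L v0" for l
    proof (cases "l = 0")
      case True
      then show ?thesis by (simp add: recip_generalized_inverse_def spectral_distribution_nonneg)
    next
      case False
      then have l0: "0 < l" using l by simp
      define w where "w = ?inv l"
      have w: "v0 \<le> w" unfolding w_def by (rule le_generalized_inverse[OF L l0 v00 l(2)])
      \<comment> \<open>The profile is taken at \<open>w / 2\<close> so that the factor 2 in the
        spectral estimate leaves exactly \<open>w\<close>. One squaring carries \<open>z\<close>
        beyond \<open>2 * w\<close>, which exceeds \<open>?inv l\<close>, so that
        \<open>L (2 * w) \<le> l\<close>.\<close>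
      define z where "z = D * (w / 2)"
      have zV: "V \<le> z"
      proof -
        have "2 * V / D \<le> w" using w v0 by simp
        then show ?thesis using D by (simp add: z_def field_simps)
      qed
      have zw: "2 * w \<le> z\<^sup>2"
      proof -
        have "8 / D\<^sup>2 \<le> w" using w v0 by simp
        then have "8 \<le> w * D\<^sup>2" using D by (simp add: pos_divide_le_eq)
        then have "8 * w \<le> w * D\<^sup>2 * w" using w v00 by (intro mult_right_mono) auto
        then show ?thesis by (simp add: z_def power2_eq_square algebra_simps)
      qed
      have "c * L z \<le> L (z\<^sup>2)" by (rule dbl[OF zV])
      also have "\<dots> \<le> L (2 * w)" using anti[OF _ zw] w v00 by simp
      also have "\<dots> \<le> l"
        using w v00 by (intro L_le_of_generalized_inverse_less[OF L l0]) (simp add: w_def[symmetric])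
      finally have Lz: "L z \<le> l / c" using c by (simp add: field_simps)
      have "?\<Lambda> (w / 2) \<le> C * L z" unfolding z_def using w v0 by (intro le) simp
      also have "\<dots> \<le> C * (l / c)" using Lz C by (intro mult_left_mono) auto
      also have "\<dots> < 2 * (C / c) * l" using C c l0 by (simp add: field_simps)
      finally have less: "?\<Lambda> (w / 2) < 2 * (C / c) * l" .
      have "1 \<le> w / 2" using w v0 by simp
      then obtain \<Omega> h where \<Omega>: "finite \<Omega>" "\<Omega> \<subseteq> carrier G" "real (card \<Omega>) \<le> w / 2"
        and h: "h \<noteq> 0" "{x. fn h x \<noteq> 0} \<subseteq> \<Omega>" "inner (lap h) h < 2 * (C / c) * l * (norm h)\<^sup>2"
        using isoperimetric_profile_lessD[OF _ less] by metis
      have "1 \<le> 2 * real (card \<Omega>) * ?N (2 * (2 * (C / c) * l))"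
        using C c l0 h by (intro spectral_distribution_lower[OF \<Omega>(1,2)]) auto
      also have "2 * (2 * (C / c) * l) = K * l" by (simp add: K_def)
      also have "2 * real (card \<Omega>) * ?N (K * l) \<le> w * ?N (K * l)"
        using \<Omega>(3) by (intro mult_right_mono spectral_distribution_nonneg) simp
      finally have "1 / w \<le> ?N (K * l)" using w v00 by (simp add: field_simps)
      then show ?thesis using l0 by (simp add: recip_generalized_inverse_def w_def)
    qed
    then show ?thesis unfolding dil_preceq_near_zero_def using K L_pos[OF v00] by blast
  qed
  ultimately show ?thesis by blast
qed

end
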